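(* Let $(M,g)$ be a Riemannian manifold, $f$ a smooth positive function on $M$ such that $\operatorname{grad}f\neq0$ at every point of $M$, and let $TM$ be equipped with the Mus-Gradient metric $g^{f}$. Put $\alpha=1+\|\operatorname{grad}f\|^2$. Then the canonical projection $\pi_{\alpha}:(TM,g^{f})\to(M,g)$ is biharmonic if and only if $$\operatorname{Ricci}(\operatorname{grad}\ln\alpha)+\frac12\operatorname{grad}(\Delta\ln\alpha)+\frac18\operatorname{grad}\big(\|\operatorname{grad}\ln\alpha\|^2\big)=0.$$
   Context: In induced local coordinates $(x^i,y^i)$ on $TM$, the vertical and horizontal lifts of $X=X^i\frac{\partial}{\partial x^i}$ are $X^V=X^i\frac{\partial}{\partial y^i}$ and $X^H=X^i\big(\frac{\partial}{\partial x^i}-y^j\Gamma_{ij}^k\frac{\partial}{\partial y^k}\big)$. The Mus-Gradient metric $g^{f}$ on $TM$ is defined by $g^{f}(X^H,Y^H)_{(x,u)}=g_x(X,Y)$, $g^{f}(X^H,Y^V)_{(x,u)}=0$, $g^{f}(X^V,Y^V)_{(x,u)}=g_x(X,Y)+X_x(f)Y_x(f)$ for $X,Y\in\Gamma(TM)$, $(x,u)\in TM$. The map $\pi_\alpha$ is $(x,u)\mapsto x$. Gradient, norm, $\operatorname{Ricci}(X)=\sum_iR(X,E_i)E_i$ (for a local $g$-orthonormal frame $(E_i)$, with $R(X,Y)Z=\nabla_X\nabla_YZ-\nabla_Y\nabla_XZ-\nabla_{[X,Y]}Z$) and the Laplacian $\Delta h=\operatorname{div}\operatorname{grad}h$ are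 those of $(M,g)$. For a smooth map $\varphi$ between Riemannian manifolds with local orthonormal frame $(e_i)$ of the source, the tension field is $\tau(\varphi)=\sum_i\big(\nabla^{\varphi}_{e_i}d\varphi(e_i)-d\varphi(\nabla_{e_i}e_i)\big)$ and the bitension field is $\tau_2(\varphi)=-\sum_iR^{N}(\tau(\varphi),d\varphi(e_i))d\varphi(e_i)-\sum_i\big(\nabla^{\varphi}_{e_i}\nabla^{\varphi}_{e_i}\tau(\varphi)-\nabla^{\varphi}_{\nabla_{e_i}e_i}\tau(\varphi)\big)$, where $N$ is the target; $\varphi$ is biharmonic iff $\tau_2(\varphi)=0$. *)

theory Defs
  imports "HOL-Analysis.Analysis"
begin

text \<open>\<open>Ck_on\<close> and \<open>smooth_on\<close> are meant for open \<open>S\<close>.\<close>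

fun Ck_on :: "nat \<Rightarrow> 'a::real_normed_vector set \<Rightarrow> ('a \<Rightarrow> 'b::real_normed_vector) \<Rightarrow> bool" where
  "Ck_on 0 S f \<longleftrightarrow> continuous_on S f"
| "Ck_on (Suc k) S f \<longleftrightarrow>
     (\<forall>x\<in>S. f differentiable (at x)) \<and> (\<forall>v. Ck_on k S (\<lambda>x. frechet_derivative f (at x) v))"

definition smooth_on :: "'a::real_normed_vector set \<Rightarrow> ('a \<Rightarrow> 'b::real_normed_vector) \<Rightarrow> bool" where
  "smooth_on S f \<longleftrightarrow> (\<forall>k. Ck_on k S f)"


text \<open>
  Smooth manifolds of dimension \<open>CARD('n)\<close>.  A chart is a pair of its domain and its
  coordinate map; the atlas is not required to be maximal.

  A tangent vector at \<open>p\<close> is represented by its components in all charts around \<open>p\<close>: a function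
  \<open>v\<close> with \<open>v c :: real ^ 'n\<close>, obeying the usual transformation rule, and with the value 0
  on everything that is not a chart around \<open>p\<close>.  Linear combinations of tangent vectors are
  taken chart by chart.
\<close>

type_synonym ('a, 'n) chart = "'a set \<times> ('a \<Rightarrow> real ^ 'n)"
type_synonym ('a, 'n) tvec = "('a, 'n) chart \<Rightarrow> real ^ 'n"

record ('a, 'n) smooth_mfd =
  topo :: "'a topology"
  atlas :: "('a, 'n) chart set"

record ('a, 'n) riem_mfd = "('a, 'n) smooth_mfd" +
  riem :: "'a \<Rightarrow> ('a, 'n) tvec \<Rightarrow> ('a, 'n) tvec \<Rightarrow> real"

abbreviation points :: "('a, 'n::finite, 'z) smooth_mfd_scheme \<Rightarrow> 'a set" where
  "points M \<equiv> topspace (topo M)"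

abbreviation cdom :: "('a, 'n::finite) chart \<Rightarrow> 'a set" where
  "cdom c \<equiv> fst c"

abbreviation cmap :: "('a, 'n::finite) chart \<Rightarrow> 'a \<Rightarrow> real ^ 'n" where
  "cmap c \<equiv> snd c"

definition cinv :: "('a, 'n::finite) chart \<Rightarrow> real ^ 'n \<Rightarrow> 'a" where
  "cinv c = inv_into (cdom c) (cmap c)"

definition charts_at :: "('a, 'n::finite, 'z) smooth_mfd_scheme \<Rightarrow> 'a \<Rightarrow> ('a, 'n) chart set" where
  "charts_at M p = {c \<in> atlas M. p \<in> cdom c}"

definition chart_at :: "('a, 'n::finite, 'z) smooth_mfd_scheme \<Rightarrow> 'a \<Rightarrow> ('a, 'n) chart" where
  "chart_at M p = (SOME c. c \<in> charts_at M p)"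

definition smooth_manifold :: "('a, 'n::finite, 'z) smooth_mfd_scheme \<Rightarrow> bool" where
  "smooth_manifold M \<longleftrightarrow>
     Hausdorff_space (topo M) \<and> second_countable (topo M) \<and>
     (\<Union>c\<in>atlas M. cdom c) = points M \<and>
     (\<forall>c\<in>atlas M. openin (topo M) (cdom c) \<and> open (cmap c ` cdom c) \<and>
        homeomorphic_map (subtopology (topo M) (cdom c)) (top_of_set (cmap c ` cdom c)) (cmap c)) \<and>
     (\<forall>c\<in>atlas M. \<forall>d\<in>atlas M. smooth_on (cmap c ` (cdom c \<inter> cdom d)) (\<lambda>x. cmap d (cinv c x)))"

definition tangent_space :: "('a, 'n::finite, 'z) smooth_mfd_scheme \<Rightarrow> 'a \<Rightarrow> ('a, 'n) tvec set" where
  "tangent_space M p =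
     {v. (\<forall>c\<in>charts_at M p. \<forall>d\<in>charts_at M p.
            v d = frechet_derivative (\<lambda>x. cmap d (cinv c x)) (at (cmap c p)) (v c)) \<and>
         (\<forall>d. d \<notin> charts_at M p \<longrightarrow> v d = 0)}"

text \<open>The tangent vector at \<open>p\<close> whose components in the chart \<open>c\<close> are \<open>\<xi>\<close>.\<close>

definition tangent_of ::
  "('a, 'n::finite, 'z) smooth_mfd_scheme \<Rightarrow> 'a \<Rightarrow> ('a, 'n) chart \<Rightarrow> real ^ 'n \<Rightarrow> ('a, 'n) tvec" where
  "tangent_of M p c \<xi> =
     (\<lambda>d. if d \<in> charts_at M p
          then frechet_derivative (\<lambda>x. cmap d (cinv c x)) (at (cmap c p)) \<xi> else 0)"

definition smooth_function ::
  "('a, 'n::finite, 'z) smooth_mfd_scheme \<Rightarrow> ('a \<Rightarrow> real) \<Rightarrow> bool" where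
  "smooth_function M h \<longleftrightarrow> (\<forall>c\<in>atlas M. smooth_on (cmap c ` cdom c) (\<lambda>x. h (cinv c x)))"

definition smooth_map ::
  "('a, 'm::finite, 'y) smooth_mfd_scheme \<Rightarrow> ('b, 'n::finite, 'z) smooth_mfd_scheme \<Rightarrow> ('a \<Rightarrow> 'b) \<Rightarrow> bool" where
  "smooth_map M N \<phi> \<longleftrightarrow>
     continuous_map (topo M) (topo N) \<phi> \<and>
     (\<forall>c\<in>atlas M. \<forall>d\<in>atlas N.
        smooth_on (cmap c ` {p \<in> cdom c. \<phi> p \<in> cdom d}) (\<lambda>x. cmap d (\<phi> (cinv c x))))"

text \<open>The derivative \<open>v(h)\<close> of a vector-valued function \<open>h\<close> along a tangent vector \<open>v\<close> at \<open>p\<close>.\<close>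

definition dir ::
  "('a, 'n::finite, 'z) smooth_mfd_scheme \<Rightarrow> 'a \<Rightarrow> ('a, 'n) tvec \<Rightarrow> ('a \<Rightarrow> 'b::real_normed_vector) \<Rightarrow> 'b" where
  "dir M p v h =
     (let c = chart_at M p in frechet_derivative (\<lambda>x. h (cinv c x)) (at (cmap c p)) (v c))"

definition differential ::
  "('a, 'm::finite, 'y) smooth_mfd_scheme \<Rightarrow> ('b, 'n::finite, 'z) smooth_mfd_scheme \<Rightarrow> ('a \<Rightarrow> 'b) \<Rightarrow>
   'a \<Rightarrow> ('a, 'm) tvec \<Rightarrow> ('b, 'n) tvec" where
  "differential M N \<phi> p v =
     (\<lambda>d. if d \<in> charts_at N (\<phi> p) then dir M p v (\<lambda>q. cmap d (\<phi> q)) else 0)"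

definition smooth_field_on ::
  "('a, 'n::finite, 'z) smooth_mfd_scheme \<Rightarrow> 'a set \<Rightarrow> ('a \<Rightarrow> ('a, 'n) tvec) \<Rightarrow> bool" where
  "smooth_field_on M U X \<longleftrightarrow>
     (\<forall>q\<in>U. X q \<in> tangent_space M q) \<and>
     (\<forall>c\<in>atlas M. smooth_on (cmap c ` (U \<inter> cdom c)) (\<lambda>x. X (cinv c x) c))"

definition tangent_bilinear ::
  "('a, 'n::finite, 'z) smooth_mfd_scheme \<Rightarrow> 'a \<Rightarrow> (('a, 'n) tvec \<Rightarrow> ('a, 'n) tvec \<Rightarrow> real) \<Rightarrow> bool" where
  "tangent_bilinear M p B \<longleftrightarrow>
     (\<forall>u\<in>tangent_space M p. \<forall>v\<in>tangent_space M p. \<forall>w\<in>tangent_space M p. \<forall>a.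
        B (\<lambda>c. u c + a *\<^sub>R v c) w = B u w + a * B v w \<and>
        B w (\<lambda>c. u c + a *\<^sub>R v c) = B w u + a * B w v)"

definition tangent_symmetric ::
  "('a, 'n::finite, 'z) smooth_mfd_scheme \<Rightarrow> 'a \<Rightarrow> (('a, 'n) tvec \<Rightarrow> ('a, 'n) tvec \<Rightarrow> real) \<Rightarrow> bool" where
  "tangent_symmetric M p B \<longleftrightarrow>
     (\<forall>u\<in>tangent_space M p. \<forall>v\<in>tangent_space M p. B u v = B v u)"

definition metric_matrix ::
  "('a, 'n::finite, 'z) riem_mfd_scheme \<Rightarrow> ('a, 'n) chart \<Rightarrow> real ^ 'n \<Rightarrow> real ^ 'n ^ 'n" where
  "metric_matrix M c x =
     (\<chi> i j. riem M (cinv c x) (tangent_of M (cinv c x) c (axis i 1)) (tangent_of M (cinv c x) c (axis j 1)))"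

definition riemannian_manifold :: "('a, 'n::finite, 'z) riem_mfd_scheme \<Rightarrow> bool" where
  "riemannian_manifold M \<longleftrightarrow>
     smooth_manifold M \<and>
     (\<forall>p\<in>points M. tangent_bilinear M p (riem M p) \<and> tangent_symmetric M p (riem M p) \<and>
        (\<forall>v\<in>tangent_space M p. v \<noteq> (\<lambda>_. 0) \<longrightarrow> riem M p v v > 0)) \<and>
     (\<forall>c\<in>atlas M. smooth_on (cmap c ` cdom c) (metric_matrix M c))"

definition tangent_norm :: "('a, 'n::finite, 'z) riem_mfd_scheme \<Rightarrow> 'a \<Rightarrow> ('a, 'n) tvec \<Rightarrow> real" where
  "tangent_norm M p v = sqrt (riem M p v v)"

text \<open>
  The Christoffel symbols \<open>\<Gamma>\<^sub>i\<^sub>j\<^sup>k\<close> of the Levi-Civita connection at the point with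
  coordinates \<open>x\<close> in the chart \<open>c\<close>.
\<close>

definition christoffel ::
  "('a, 'n::finite, 'z) riem_mfd_scheme \<Rightarrow> ('a, 'n) chart \<Rightarrow> real ^ 'n \<Rightarrow> 'n \<Rightarrow> 'n \<Rightarrow> 'n \<Rightarrow> real" where
  "christoffel M c x i j k =
     (let dg = (\<lambda>i j l. frechet_derivative (\<lambda>y. metric_matrix M c y $ j $ l) (at x) (axis i 1))
      in (1/2) * (\<Sum>l\<in>UNIV. matrix_inv (metric_matrix M c x) $ k $ l * (dg i j l + dg j i l - dg l i j)))"

definition christoffel_term ::
  "('a, 'n::finite, 'z) riem_mfd_scheme \<Rightarrow> ('a, 'n) chart \<Rightarrow> real ^ 'n \<Rightarrow> real ^ 'n \<Rightarrow> real ^ 'n \<Rightarrow> real ^ 'n" where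
  "christoffel_term M c x \<xi> \<eta> =
     (\<chi> k. \<Sum>i\<in>UNIV. \<Sum>j\<in>UNIV. christoffel M c x i j k * \<xi> $ i * \<eta> $ j)"

text \<open>\<open>cov M p v Y\<close> is \<open>\<nabla>\<^sub>v Y\<close> for a vector \<open>v\<close> at \<open>p\<close> and a vector field \<open>Y\<close> near \<open>p\<close>.\<close>

definition cov ::
  "('a, 'n::finite, 'z) riem_mfd_scheme \<Rightarrow> 'a \<Rightarrow> ('a, 'n) tvec \<Rightarrow> ('a \<Rightarrow> ('a, 'n) tvec) \<Rightarrow> ('a, 'n) tvec" where
  "cov M p v Y =
     (\<lambda>d. if d \<in> charts_at M p
          then dir M p v (\<lambda>q. Y q d) + christoffel_term M d (cmap d p) (v d) (Y p d) else 0)"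

text \<open>
  \<open>pullback_cov M N \<phi> p v V\<close> is \<open>\<nabla>\<^sup>\<phi>\<^sub>v V\<close> for a section \<open>V\<close> of the pull-back bundle,
  that is, \<open>V q\<close> is tangent to \<open>N\<close> at \<open>\<phi> q\<close>.
\<close>

definition pullback_cov ::
  "('a, 'm::finite, 'y) riem_mfd_scheme \<Rightarrow> ('b, 'n::finite, 'z) riem_mfd_scheme \<Rightarrow> ('a \<Rightarrow> 'b) \<Rightarrow>
   'a \<Rightarrow> ('a, 'm) tvec \<Rightarrow> ('a \<Rightarrow> ('b, 'n) tvec) \<Rightarrow> ('b, 'n) tvec" where
  "pullback_cov M N \<phi> p v V =
     (\<lambda>d. if d \<in> charts_at N (\<phi> p)
          then dir M p v (\<lambda>q. V q d)
               + christoffel_term N d (cmap d (\<phi> p)) (differential M N \<phi> p v d) (V p d)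
          else 0)"

definition lie_bracket ::
  "('a, 'n::finite, 'z) smooth_mfd_scheme \<Rightarrow> ('a \<Rightarrow> ('a, 'n) tvec) \<Rightarrow> ('a \<Rightarrow> ('a, 'n) tvec) \<Rightarrow>
   'a \<Rightarrow> ('a, 'n) tvec" where
  "lie_bracket M X Y p =
     (\<lambda>d. if d \<in> charts_at M p
          then dir M p (X p) (\<lambda>q. Y q d) - dir M p (Y p) (\<lambda>q. X q d) else 0)"

definition curvature_field ::
  "('a, 'n::finite, 'z) riem_mfd_scheme \<Rightarrow> ('a \<Rightarrow> ('a, 'n) tvec) \<Rightarrow> ('a \<Rightarrow> ('a, 'n) tvec) \<Rightarrow>
   ('a \<Rightarrow> ('a, 'n) tvec) \<Rightarrow> 'a \<Rightarrow> ('a, 'n) tvec" where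
  "curvature_field M X Y Z p =
     (\<lambda>d. cov M p (X p) (\<lambda>q. cov M q (Y q) Z) d
        - cov M p (Y p) (\<lambda>q. cov M q (X q) Z) d
        - cov M p (lie_bracket M X Y p) Z d)"

text \<open>
  \<open>curvature_field\<close> is tensorial, so the curvature of vectors at \<open>p\<close> may be computed from
  arbitrary extensions to fields near \<open>p\<close>; we take those with constant components in some chart.
\<close>

definition extend_tvec ::
  "('a, 'n::finite, 'z) smooth_mfd_scheme \<Rightarrow> 'a \<Rightarrow> ('a, 'n) tvec \<Rightarrow> 'a \<Rightarrow> ('a, 'n) tvec" where
  "extend_tvec M p u = (\<lambda>q. tangent_of M q (chart_at M p) (u (chart_at M p)))"

definition curvature ::
  "('a, 'n::finite, 'z) riem_mfd_scheme \<Rightarrow> 'a \<Rightarrow> ('a, 'n) tvec \<Rightarrow> ('a, 'n) tvec \<Rightarrow> ('a, 'n) tvec \<Rightarrow> ('a, 'n) tvec" where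
  "curvature M p u v w =
     curvature_field M (extend_tvec M p u) (extend_tvec M p v) (extend_tvec M p w) p"

text \<open>
  Local orthonormal frames.  The traces below do not depend on the frame, so each of them is
  defined by means of some local orthonormal frame around the point considered.
\<close>

definition orthonormal_frame ::
  "('a, 'n::finite, 'z) riem_mfd_scheme \<Rightarrow> 'a \<Rightarrow> ('n \<Rightarrow> 'a \<Rightarrow> ('a, 'n) tvec) \<Rightarrow> bool" where
  "orthonormal_frame M p e \<longleftrightarrow>
     (\<exists>U. openin (topo M) U \<and> p \<in> U \<and> (\<forall>i. smooth_field_on M U (e i)) \<and>
        (\<forall>q\<in>U. \<forall>i j. riem M q (e i q) (e j q) = (if i = j then 1 else 0)))"

definition frame_at ::
  "('a, 'n::finite, 'z) riem_mfd_scheme \<Rightarrow> 'a \<Rightarrow> 'n \<Rightarrow> 'a \<Rightarrow> ('a, 'n) tvec" where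
  "frame_at M p = (SOME e. orthonormal_frame M p e)"

definition grad ::
  "('a, 'n::finite, 'z) riem_mfd_scheme \<Rightarrow> ('a \<Rightarrow> real) \<Rightarrow> 'a \<Rightarrow> ('a, 'n) tvec" where
  "grad M h p =
     (THE u. u \<in> tangent_space M p \<and> (\<forall>v\<in>tangent_space M p. riem M p u v = dir M p v h))"

definition divergence ::
  "('a, 'n::finite, 'z) riem_mfd_scheme \<Rightarrow> ('a \<Rightarrow> ('a, 'n) tvec) \<Rightarrow> 'a \<Rightarrow> real" where
  "divergence M X p =
     (let e = frame_at M p in \<Sum>i\<in>UNIV. riem M p (cov M p (e i p) X) (e i p))"

definition laplacian :: "('a, 'n::finite, 'z) riem_mfd_scheme \<Rightarrow> ('a \<Rightarrow> real) \<Rightarrow> 'a \<Rightarrow> real" where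
  "laplacian M h p = divergence M (grad M h) p"

definition ricci ::
  "('a, 'n::finite, 'z) riem_mfd_scheme \<Rightarrow> 'a \<Rightarrow> ('a, 'n) tvec \<Rightarrow> ('a, 'n) tvec" where
  "ricci M p v =
     (let e = frame_at M p in (\<lambda>d. \<Sum>i\<in>UNIV. curvature M p v (e i p) (e i p) d))"

definition tension ::
  "('a, 'm::finite, 'y) riem_mfd_scheme \<Rightarrow> ('b, 'n::finite, 'z) riem_mfd_scheme \<Rightarrow> ('a \<Rightarrow> 'b) \<Rightarrow>
   'a \<Rightarrow> ('b, 'n) tvec" where
  "tension M N \<phi> p =
     (let e = frame_at M p in
      (\<lambda>d. \<Sum>i\<in>UNIV. pullback_cov M N \<phi> p (e i p) (\<lambda>q. differential M N \<phi> q (e i q)) d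
                  - differential M N \<phi> p (cov M p (e i p) (e i)) d))"

definition bitension ::
  "('a, 'm::finite, 'y) riem_mfd_scheme \<Rightarrow> ('b, 'n::finite, 'z) riem_mfd_scheme \<Rightarrow> ('a \<Rightarrow> 'b) \<Rightarrow>
   'a \<Rightarrow> ('b, 'n) tvec" where
  "bitension M N \<phi> p =
     (let e = frame_at M p; \<tau> = tension M N \<phi> in
      (\<lambda>d. - (\<Sum>i\<in>UNIV. curvature N (\<phi> p) (\<tau> p)
                  (differential M N \<phi> p (e i p)) (differential M N \<phi> p (e i p)) d)
          - (\<Sum>i\<in>UNIV. pullback_cov M N \<phi> p (e i p) (\<lambda>q. pullback_cov M N \<phi> q (e i q) \<tau>) d
                  - pullback_cov M N \<phi> p (cov M p (e i p) (e i)) \<tau> d)))"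

definition biharmonic ::
  "('a, 'm::finite, 'y) riem_mfd_scheme \<Rightarrow> ('b, 'n::finite, 'z) riem_mfd_scheme \<Rightarrow> ('a \<Rightarrow> 'b) \<Rightarrow> bool" where
  "biharmonic M N \<phi> \<longleftrightarrow>
     smooth_map M N \<phi> \<and> (\<forall>p\<in>points M. bitension M N \<phi> p = (\<lambda>_. 0))"

text \<open>
  The tangent bundle.  A chart \<open>x\<close> of \<open>M\<close> induces the coordinates \<open>(x, y)\<close> on its part of
  the bundle, with \<open>y\<close> the components of the vector; the topology is the one that makes
  the induced charts homeomorphisms.
\<close>

definition join :: "real ^ 'm::finite \<Rightarrow> real ^ 'n::finite \<Rightarrow> real ^ ('m + 'n)" where
  "join a b = (\<chi> k. case k of Inl i \<Rightarrow> a $ i | Inr j \<Rightarrow> b $ j)"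

definition induced_chart ::
  "('a, 'n::finite, 'z) smooth_mfd_scheme \<Rightarrow> ('a, 'n) chart \<Rightarrow> ('a \<times> ('a, 'n) tvec, 'n + 'n) chart" where
  "induced_chart M c =
     ({(p, u). p \<in> cdom c \<and> u \<in> tangent_space M p}, \<lambda>(p, u). join (cmap c p) (u c))"

definition tangent_bundle ::
  "('a, 'n::finite, 'z) smooth_mfd_scheme \<Rightarrow> ('a \<times> ('a, 'n) tvec, 'n + 'n) smooth_mfd" where
  "tangent_bundle M =
     (let A = induced_chart M ` atlas M in
      \<lparr> topo = topology_generated_by {{z \<in> cdom C. cmap C z \<in> W} | C W. C \<in> A \<and> open W},
        atlas = A \<rparr>)"

definition vlift ::
  "('a, 'n::finite, 'z) riem_mfd_scheme \<Rightarrow> 'a \<times> ('a, 'n) tvec \<Rightarrow> ('a, 'n) tvec \<Rightarrow>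
   ('a \<times> ('a, 'n) tvec, 'n + 'n) tvec" where
  "vlift M z X =
     (let c = chart_at M (fst z) in
      tangent_of (tangent_bundle M) z (induced_chart M c) (join 0 (X c)))"

definition hlift ::
  "('a, 'n::finite, 'z) riem_mfd_scheme \<Rightarrow> 'a \<times> ('a, 'n) tvec \<Rightarrow> ('a, 'n) tvec \<Rightarrow>
   ('a \<times> ('a, 'n) tvec, 'n + 'n) tvec" where
  "hlift M z X =
     (let c = chart_at M (fst z) in
      tangent_of (tangent_bundle M) z (induced_chart M c)
        (join (X c) (- christoffel_term M c (cmap c (fst z)) (X c) (snd z c))))"

text \<open>
  The Mus-Gradient metric at \<open>z = (x, u)\<close>: the defining identities determine the form, since
  every tangent vector of the bundle at \<open>z\<close> is the sum of a horizontal and a vertical lift.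
\<close>

definition mus_gradient_form ::
  "('a, 'n::finite, 'z) riem_mfd_scheme \<Rightarrow> ('a \<Rightarrow> real) \<Rightarrow> 'a \<times> ('a, 'n) tvec \<Rightarrow>
   (('a \<times> ('a, 'n) tvec, 'n + 'n) tvec \<Rightarrow> ('a \<times> ('a, 'n) tvec, 'n + 'n) tvec \<Rightarrow> real) \<Rightarrow> bool" where
  "mus_gradient_form M f z G \<longleftrightarrow>
     tangent_bilinear (tangent_bundle M) z G \<and> tangent_symmetric (tangent_bundle M) z G \<and>
     (\<forall>X\<in>tangent_space M (fst z). \<forall>Y\<in>tangent_space M (fst z).
        G (hlift M z X) (hlift M z Y) = riem M (fst z) X Y \<and>
        G (hlift M z X) (vlift M z Y) = 0 \<and>
        G (vlift M z X) (vlift M z Y) = riem M (fst z) X Y + dir M (fst z) X f * dir M (fst z) Y f)"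

definition mus_gradient_bundle ::
  "('a, 'n::finite, 'z) riem_mfd_scheme \<Rightarrow> ('a \<Rightarrow> real) \<Rightarrow>
   ('a \<times> ('a, 'n) tvec, 'n + 'n) riem_mfd" where
  "mus_gradient_bundle M f =
     \<lparr> topo = topo (tangent_bundle M), atlas = atlas (tangent_bundle M),
       riem = (\<lambda>z. SOME G. mus_gradient_form M f z G) \<rparr>"

end

theory Submission
  imports Defs
begin

text \<open>
  The Mus-Gradient metric makes the projection \<open>\<pi>\<close> a Riemannian submersion, because horizontal lifts keep
  their inner products and are orthogonal to the fibres. Its tension field is therefore minus the trace of
  the second fundamental form of the fibres, projected to the base. Paired with \<open>X\<close>, this is half the
  trace, with respect to the fibre metric \<open>k = g + df \<otimes> df\<close>, of the derivative of \<open>k\<close> along the horizontal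
  lift of \<open>X\<close>. Horizontal lifts come from parallel transport, which preserves \<open>g\<close>, so only the Hessian of
  \<open>f\<close> remains, and the trace is \<open>2 Hess f(X, grad f) / (1 + \<parallel>grad f\<parallel>\<^sup>2) = X(ln \<alpha>)\<close>. Hence the tension field
  is \<open>V \<circ> \<pi>\<close> with \<open>V = (1/2) grad (ln \<alpha>)\<close>: lemmas \<open>chr_vertical\<close>, \<open>tension_coord\<close> and \<open>tension_projection\<close>.

  For a field of the form \<open>V \<circ> \<pi>\<close> the second derivatives in the bitension field add up to the rough
  Laplacian of \<open>V\<close> on \<open>M\<close> plus \<open>\<nabla>\<^sub>V V\<close>, the latter because the tension field is again \<open>V\<close>. As \<open>V\<close> is a gradient,
  Bochner's formula (\<open>rough_laplacian_grad\<close>) gives \<open>grad (div V) + Ricci V\<close> for the former, and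
  \<open>\<nabla>\<^sub>V V = (1/2) grad (\<parallel>V\<parallel>\<^sup>2)\<close>. Together with the curvature term of the bitension field, which contributes another
  \<open>Ricci V\<close>, this yields minus the left-hand side of the asserted equation, at every point of
  the bundle (\<open>bitension_projection\<close>); since \<open>\<pi>\<close> is onto, the equivalence follows.

  The computations take place in one chart of \<open>M\<close> and the induced chart of the bundle, where \<open>\<pi>\<close> is linear.
  Orthonormal frames and the charts used for derivatives are arbitrary choices; the choice is removed
  by \<open>onb_trace_unique\<close> for frames, and for charts by the chain rule (\<open>dir_chart\<close>) and the transformation
  law of the Christoffel symbols (\<open>isometry_chr\<close>), which makes covariant derivatives and horizontal
  lifts chart-independent. The Christoffel symbols of the bundle are needed only paired with horizontal
  vectors, and there the Koszul formula suffices.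
\<close>


section \<open>Calculus of smooth functions on open sets\<close>

abbreviation der :: "('a::real_normed_vector \<Rightarrow> 'b::real_normed_vector) \<Rightarrow> 'a \<Rightarrow> 'a \<Rightarrow> 'b" where
  "der f x \<equiv> frechet_derivative f (at x)"

lemma der_has_derivative: "f differentiable (at x) \<Longrightarrow> (f has_derivative der f x) (at x)"
  by (simp add: frechet_derivative_works)

lemma der_eq: "(f has_derivative f') (at x) \<Longrightarrow> der f x v = f' v"
  by (simp add: frechet_derivative_at[symmetric])

lemma der_cong:
  assumes "open S" "x \<in> S" "\<And>y. y \<in> S \<Longrightarrow> f y = g y"
  shows "der f x = der g x"
proof -
  have *: "(f has_derivative f') (at x) \<longleftrightarrow> (g has_derivative f') (at x)" for f'
    using assms has_derivative_transform_within_open[of f f' x UNIV S g]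
      has_derivative_transform_within_open[of g f' x UNIV S f] by auto
  show ?thesis by (simp add: frechet_derivative_def *)
qed

lemma differentiable_cong_open:
  assumes "open S" "x \<in> S" "\<And>y. y \<in> S \<Longrightarrow> f y = g y"
  shows "f differentiable (at x) \<longleftrightarrow> g differentiable (at x)"
proof -
  have *: "(f has_derivative f') (at x) \<longleftrightarrow> (g has_derivative f') (at x)" for f'
    using assms has_derivative_transform_within_open[of f f' x UNIV S g]
      has_derivative_transform_within_open[of g f' x UNIV S f] by auto
  show ?thesis by (simp add: differentiable_def *)
qed

lemma der_add_vec: "f differentiable (at x) \<Longrightarrow> der f x (v + w) = der f x v + der f x w"
  by (simp add: linear_frechet_derivative linear_add)

lemma der_scaleR_vec: "f differentiable (at x) \<Longrightarrow> der f x (c *\<^sub>R v) = c *\<^sub>R der f x v"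
  by (simp add: linear_frechet_derivative linear_scale)

lemma der_sum_vec: "f differentiable (at x) \<Longrightarrow> der f x (\<Sum>i\<in>I. v i) = (\<Sum>i\<in>I. der f x (v i))"
  by (simp add: linear_frechet_derivative linear_sum)

lemma der_zero_vec [simp]: "f differentiable (at x) \<Longrightarrow> der f x 0 = 0"
  by (simp add: linear_frechet_derivative linear_0)

lemma der_add:
  "f differentiable (at x) \<Longrightarrow> g differentiable (at x) \<Longrightarrow> der (\<lambda>x. f x + g x) x v = der f x v + der g x v"
  by (rule der_eq) (intro has_derivative_add der_has_derivative)

lemma der_sum:
  "(\<And>i. i \<in> I \<Longrightarrow> f i differentiable (at x)) \<Longrightarrow> der (\<lambda>x. \<Sum>i\<in>I. f i x) x v = (\<Sum>i\<in>I. der (f i) x v)"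
  by (rule der_eq) (intro has_derivative_sum der_has_derivative)

lemma der_bounded_linear:
  "bounded_linear L \<Longrightarrow> f differentiable (at x) \<Longrightarrow> der (\<lambda>x. L (f x)) x v = L (der f x v)"
  by (rule der_eq) (rule bounded_linear.has_derivative[OF _ der_has_derivative])

lemma der_linear: "bounded_linear L \<Longrightarrow> der L x v = L v"
  by (rule der_eq) (rule bounded_linear_imp_has_derivative)

lemma (in bounded_bilinear) der_prod:
  assumes "f differentiable (at x)" "g differentiable (at x)"
  shows "der (\<lambda>x. prod (f x) (g x)) x v = prod (f x) (der g x v) + prod (der f x v) (g x)"
  by (rule der_eq) (intro FDERIV assms der_has_derivative)

lemma (in bounded_bilinear) differentiable_prod:
  assumes "f differentiable (at x)" "g differentiable (at x)"
  shows "(\<lambda>x. prod (f x) (g x)) differentiable (at x)"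
  using FDERIV[OF der_has_derivative[OF assms(1)] der_has_derivative[OF assms(2)]]
  by (auto simp: differentiable_def)

lemma der_compose:
  assumes "f differentiable (at x)" "g differentiable (at (f x))"
  shows "der (\<lambda>x. g (f x)) x v = der g (f x) (der f x v)"
  using frechet_derivative_compose[OF assms] by (simp add: o_def fun_eq_iff)

lemma differentiable_compose_at:
  assumes "f differentiable (at x)" "g differentiable (at (f x))"
  shows "(\<lambda>x. g (f x)) differentiable (at x)"
  using differentiable_chain_at[OF assms] by (simp add: o_def)

lemma bounded_linear_differentiable: "bounded_linear L \<Longrightarrow> L differentiable (at x)"
  by (meson bounded_linear_imp_has_derivative differentiable_def)

lemma bounded_linear_compose_differentiable:
  "bounded_linear L \<Longrightarrow> f differentiable (at x) \<Longrightarrow> (\<lambda>x. L (f x)) differentiable (at x)"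
  using differentiable_compose_at[of f x L] bounded_linear_differentiable by blast


lemma Ck_on_cong:
  assumes "open S" "\<And>x. x \<in> S \<Longrightarrow> f x = g x"
  shows "Ck_on k S f \<longleftrightarrow> Ck_on k S g"
  using assms(2)
proof (induction k arbitrary: f g)
  case 0 then show ?case by (auto intro: continuous_on_cong[THEN iffD1])
next
  case (Suc k)
  have "Ck_on k S (\<lambda>x. der f x v) \<longleftrightarrow> Ck_on k S (\<lambda>x. der g x v)" for v
    by (rule Suc.IH) (simp add: der_cong[OF assms(1) _ Suc.prems])
  then show ?case
    using differentiable_cong_open[OF assms(1) _ Suc.prems] by auto
qed

lemma Ck_on_subset: "Ck_on k S f \<Longrightarrow> T \<subseteq> S \<Longrightarrow> Ck_on k T f"
  by (induction k arbitrary: f) (auto intro: continuous_on_subset)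

lemma Ck_on_pred: "Ck_on (Suc k) S f \<Longrightarrow> Ck_on k S f"
proof (induction k arbitrary: f)
  case 0 then show ?case
    by (auto intro!: continuous_at_imp_continuous_on differentiable_imp_continuous_within)
next
  case (Suc k) then show ?case by (metis Ck_on.simps(2))
qed

lemma Ck_on_const: "Ck_on k S (\<lambda>_. c)"
  by (induction k arbitrary: c) auto

lemma Ck_on_bounded_linear:
  assumes "open S" "bounded_linear L" "Ck_on k S f"
  shows "Ck_on k S (\<lambda>x. L (f x))"
  using assms(3)
proof (induction k arbitrary: f)
  case 0 then show ?case using assms by (auto intro: bounded_linear.continuous_on)
next
  case (Suc k)
  have "Ck_on k S (\<lambda>x. der (\<lambda>x. L (f x)) x v)" for v
  proof -
    have "Ck_on k S (\<lambda>x. L (der f x v))" using Suc.prems by (intro Suc.IH) simp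
    then show ?thesis
      by (rule Ck_on_cong[THEN iffD1, OF assms(1), rotated])
        (use Suc.prems in \<open>simp add: der_bounded_linear[OF assms(2)]\<close>)
  qed
  then show ?case using Suc.prems assms(2) by (auto intro: bounded_linear_compose_differentiable)
qed

lemma Ck_on_add:
  assumes "open S" "Ck_on k S f" "Ck_on k S g"
  shows "Ck_on k S (\<lambda>x. f x + g x)"
  using assms(2,3)
proof (induction k arbitrary: f g)
  case 0 then show ?case by (simp add: continuous_on_add)
next
  case (Suc k)
  have "Ck_on k S (\<lambda>x. der (\<lambda>x. f x + g x) x v)" for v
  proof -
    have "Ck_on k S (\<lambda>x. der f x v + der g x v)"
      using Suc.prems by (intro Suc.IH) simp_all
    then show ?thesis
      by (rule Ck_on_cong[THEN iffD1, OF assms(1), rotated]) (use Suc.prems in \<open>simp add: der_add\<close>)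
  qed
  then show ?case using Suc.prems by simp
qed

lemma (in bounded_bilinear) Ck_on_prod:
  assumes "open S" "Ck_on k S f" "Ck_on k S g"
  shows "Ck_on k S (\<lambda>x. prod (f x) (g x))"
  using assms(2,3)
proof (induction k arbitrary: f g)
  case 0 then show ?case by (simp add: continuous_on)
next
  case (Suc k)
  have "Ck_on k S (\<lambda>x. der (\<lambda>x. prod (f x) (g x)) x v)" for v
  proof -
    have "Ck_on k S (\<lambda>x. prod (f x) (der g x v) + prod (der f x v) (g x))"
      using Suc.prems Ck_on_pred[OF Suc.prems(1)] Ck_on_pred[OF Suc.prems(2)]
      by (intro Ck_on_add assms(1) Suc.IH) simp_all
    then show ?thesis
      by (rule Ck_on_cong[THEN iffD1, OF assms(1), rotated]) (use Suc.prems in \<open>simp add: der_prod\<close>)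
  qed
  then show ?case using Suc.prems by (auto intro: differentiable_prod)
qed

lemma Ck_on_sum:
  assumes "open S" "finite I" "\<And>i. i \<in> I \<Longrightarrow> Ck_on k S (f i)"
  shows "Ck_on k S (\<lambda>x. \<Sum>i\<in>I. f i x)"
  using assms(2,3)
proof (induction I rule: finite_induct)
  case (insert i I)
  then have "Ck_on k S (\<lambda>x. f i x + (\<Sum>i\<in>I. f i x))" by (intro Ck_on_add[OF assms(1)]) simp_all
  then show ?case using insert by simp
qed (simp add: Ck_on_const)

text \<open>By the chain rule the derivative of \<open>g \<circ> f\<close> has direction \<open>der f x v\<close>, which varies with \<open>x\<close>; it is expanded in
  the basis, so that the induction hypothesis applies to the derivatives of \<open>g\<close> in constant directions.\<close>

lemma Ck_on_compose:
  fixes f :: "'a::real_normed_vector \<Rightarrow> 'b::euclidean_space"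
  assumes "open S" "open T" "Ck_on k S f" "Ck_on k T g" "f ` S \<subseteq> T"
  shows "Ck_on k S (\<lambda>x. g (f x))"
  using assms(3,4)
proof (induction k arbitrary: g)
  case 0 then show ?case using assms(5) by (auto intro: continuous_on_compose2)
next
  case (Suc k)
  have dg: "g differentiable (at (f x))" if "x \<in> S" for x using Suc.prems assms(5) that by auto
  have "Ck_on k S (\<lambda>x. der (\<lambda>x. g (f x)) x v)" for v
  proof -
    have "Ck_on k S (\<lambda>x. \<Sum>b\<in>Basis. (der f x v \<bullet> b) *\<^sub>R der g (f x) b)"
    proof (intro Ck_on_sum assms bounded_bilinear.Ck_on_prod[OF bounded_bilinear_scaleR])
      fix b :: 'b
      show "Ck_on k S (\<lambda>x. der f x v \<bullet> b)"
        using Suc.prems by (intro Ck_on_bounded_linear[OF assms(1) bounded_linear_inner_left]) auto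
      show "Ck_on k S (\<lambda>x. der g (f x) b)"
        using Suc.prems Ck_on_pred[OF Suc.prems(1)] by (intro Suc.IH) auto
    qed auto
    then show ?thesis
    proof (rule Ck_on_cong[THEN iffD1, OF assms(1), rotated])
      fix x assume x: "x \<in> S"
      have "der g (f x) (der f x v) = der g (f x) (\<Sum>b\<in>Basis. (der f x v \<bullet> b) *\<^sub>R b)"
        by (simp add: euclidean_representation)
      also have "\<dots> = (\<Sum>b\<in>Basis. (der f x v \<bullet> b) *\<^sub>R der g (f x) b)"
        using dg[OF x] by (simp add: der_sum_vec der_scaleR_vec)
      finally show "(\<Sum>b\<in>Basis. (der f x v \<bullet> b) *\<^sub>R der g (f x) b) = der (\<lambda>x. g (f x)) x v"
        using x Suc.prems dg[OF x] by (simp add: der_compose)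
    qed
  qed
  then show ?case using Suc.prems dg by (auto intro: differentiable_compose_at)
qed

lemma smooth_on_differentiable: "smooth_on S f \<Longrightarrow> x \<in> S \<Longrightarrow> f differentiable (at x)"
  unfolding smooth_on_def by (drule spec[of _ "Suc 0"]) simp

lemma smooth_on_continuous: "smooth_on S f \<Longrightarrow> continuous_on S f"
  unfolding smooth_on_def by (drule spec[of _ 0]) simp

lemma smooth_on_cong:
  "open S \<Longrightarrow> (\<And>x. x \<in> S \<Longrightarrow> f x = g x) \<Longrightarrow> smooth_on S f \<longleftrightarrow> smooth_on S g"
  unfolding smooth_on_def using Ck_on_cong[of S f g] by simp

lemma smooth_on_subset: "smooth_on S f \<Longrightarrow> T \<subseteq> S \<Longrightarrow> smooth_on T f"
  unfolding smooth_on_def using Ck_on_subset[of _ S f T] by simp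

lemma smooth_on_der: "smooth_on S f \<Longrightarrow> smooth_on S (\<lambda>x. der f x v)"
  unfolding smooth_on_def
proof
  fix k assume "\<forall>k. Ck_on k S f"
  then have "Ck_on (Suc k) S f" by blast
  then show "Ck_on k S (\<lambda>x. der f x v)" by simp
qed

lemma smooth_on_const: "smooth_on S (\<lambda>_. c)"
  by (simp add: smooth_on_def Ck_on_const)

lemma smooth_on_bounded_linear:
  "open S \<Longrightarrow> bounded_linear L \<Longrightarrow> smooth_on S f \<Longrightarrow> smooth_on S (\<lambda>x. L (f x))"
  by (simp add: smooth_on_def Ck_on_bounded_linear)

lemma smooth_on_linear: "open S \<Longrightarrow> bounded_linear L \<Longrightarrow> smooth_on S L"
  unfolding smooth_on_def
proof
  fix k assume L: "open S" "bounded_linear L"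
  show "Ck_on k S L"
    by (cases k) (auto simp: L der_linear Ck_on_const bounded_linear_differentiable
      intro: linear_continuous_on)
qed

lemma smooth_on_add: "open S \<Longrightarrow> smooth_on S f \<Longrightarrow> smooth_on S g \<Longrightarrow> smooth_on S (\<lambda>x. f x + g x)"
  by (simp add: smooth_on_def Ck_on_add)

lemma smooth_on_minus: "open S \<Longrightarrow> smooth_on S f \<Longrightarrow> smooth_on S (\<lambda>x. - f x)"
  by (rule smooth_on_bounded_linear[OF _ bounded_linear_minus[OF bounded_linear_ident]])

lemma smooth_on_diff: "open S \<Longrightarrow> smooth_on S f \<Longrightarrow> smooth_on S g \<Longrightarrow> smooth_on S (\<lambda>x. f x - g x)"
  using smooth_on_add[of S f "\<lambda>x. - g x"] smooth_on_minus[of S g] by simp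

lemma (in bounded_bilinear) smooth_on_prod:
  "open S \<Longrightarrow> smooth_on S f \<Longrightarrow> smooth_on S g \<Longrightarrow> smooth_on S (\<lambda>x. prod (f x) (g x))"
  by (simp add: smooth_on_def Ck_on_prod)

lemmas smooth_on_scaleR = bounded_bilinear.smooth_on_prod[OF bounded_bilinear_scaleR]
lemmas smooth_on_mult = bounded_bilinear.smooth_on_prod[OF bounded_bilinear_mult]
lemmas smooth_on_inner = bounded_bilinear.smooth_on_prod[OF bounded_bilinear_inner]

lemma smooth_on_sum:
  "open S \<Longrightarrow> finite I \<Longrightarrow> (\<And>i. i \<in> I \<Longrightarrow> smooth_on S (f i)) \<Longrightarrow> smooth_on S (\<lambda>x. \<Sum>i\<in>I. f i x)"
  by (simp add: smooth_on_def Ck_on_sum)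

lemma smooth_on_compose:
  fixes f :: "'a::real_normed_vector \<Rightarrow> 'b::euclidean_space"
  shows "open S \<Longrightarrow> open T \<Longrightarrow> smooth_on S f \<Longrightarrow> smooth_on T g \<Longrightarrow> f ` S \<subseteq> T \<Longrightarrow> smooth_on S (\<lambda>x. g (f x))"
  by (simp add: smooth_on_def Ck_on_compose)

lemma smooth_on_nth: "open S \<Longrightarrow> smooth_on S f \<Longrightarrow> smooth_on S (\<lambda>x. f x $ i)"
  by (rule smooth_on_bounded_linear[OF _ bounded_linear_vec_nth])

lemma vec_lambda_as_sum: "(\<chi> i. (f i :: 'b::real_vector)) = (\<Sum>i\<in>UNIV. axis i (f i))"
  by (simp add: vec_eq_iff axis_def sum.delta)

lemma bounded_linear_axis: "bounded_linear (axis i :: 'b::euclidean_space \<Rightarrow> 'b ^ 'n::finite)"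
  by (intro linear_conv_bounded_linear[THEN iffD1] linearI) (simp_all add: vec_eq_iff axis_def)

lemma smooth_on_vec_lambda:
  fixes f :: "'a::real_normed_vector \<Rightarrow> 'n::finite \<Rightarrow> 'b::euclidean_space"
  assumes "open S" "\<And>i. smooth_on S (\<lambda>x. f x i)"
  shows "smooth_on S (\<lambda>x. (\<chi> i. f x i))"
  unfolding vec_lambda_as_sum
  by (intro smooth_on_sum smooth_on_bounded_linear[OF _ bounded_linear_axis] assms) auto

lemma smooth_on_vec:
  fixes f :: "'a::real_normed_vector \<Rightarrow> 'b::euclidean_space ^ 'n::finite"
  assumes "open S" "\<And>i. smooth_on S (\<lambda>x. f x $ i)"
  shows "smooth_on S f"
  using smooth_on_vec_lambda[OF assms(1), of "\<lambda>x i. f x $ i"] assms(2) by simp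

lemma smooth_on_matrix_vector_mult:
  fixes A :: "'a::real_normed_vector \<Rightarrow> real ^ 'm::finite ^ 'n::finite"
  assumes "open S" "smooth_on S A" "smooth_on S X"
  shows "smooth_on S (\<lambda>x. A x *v X x)"
  unfolding matrix_vector_mult_def using assms
  by (intro smooth_on_vec_lambda smooth_on_sum smooth_on_mult smooth_on_nth) auto

text \<open>For \<open>inverse\<close>, \<open>sqrt\<close> and \<open>ln\<close> the derivative is an expression in the function itself or in one
  already known to be smooth, so that differentiability bootstraps to every order.\<close>

lemma smooth_on_real_bootstrap:
  fixes \<phi> \<phi>' :: "real \<Rightarrow> real"
  assumes "open S" and d: "\<And>x. x \<in> S \<Longrightarrow> (\<phi> has_real_derivative \<phi>' x) (at x)"
    and step: "\<And>k. Ck_on k S \<phi> \<Longrightarrow> Ck_on k S \<phi>'"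
  shows "smooth_on S \<phi>"
proof -
  have d': "(\<phi> has_derivative (\<lambda>v. \<phi>' x * v)) (at x)" if "x \<in> S" for x
    using d[OF that] by (simp add: has_field_derivative_def)
  have df: "\<phi> differentiable (at x)" if "x \<in> S" for x
    using d'[OF that] by (auto simp: differentiable_def)
  have "Ck_on k S \<phi>" for k
  proof (induction k)
    case 0
    show ?case using df by (auto intro!: continuous_at_imp_continuous_on differentiable_imp_continuous_within)
  next
    case (Suc k)
    have "Ck_on k S (\<lambda>x. der \<phi> x v)" for v
    proof -
      have "Ck_on k S (\<lambda>x. \<phi>' x * v)"
        by (rule bounded_bilinear.Ck_on_prod[OF bounded_bilinear_mult assms(1) step[OF Suc] Ck_on_const])
      then show ?thesis
        by (rule Ck_on_cong[THEN iffD1, OF assms(1), rotated]) (simp add: der_eq[OF d'])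
    qed
    then show ?case using df by simp
  qed
  then show ?thesis by (simp add: smooth_on_def)
qed

lemma smooth_on_inverse: "smooth_on {0<..} (inverse :: real \<Rightarrow> real)"
proof (rule smooth_on_real_bootstrap)
  show "(inverse has_real_derivative - (inverse x * inverse x)) (at x)" if "x \<in> {0<..}" for x :: real
    using that by (auto intro!: derivative_eq_intros)
  show "Ck_on k {0<..} (\<lambda>x. - (inverse x * inverse x) :: real)" if "Ck_on k {0<..} (inverse :: real \<Rightarrow> real)" for k
    by (intro Ck_on_bounded_linear[OF _ bounded_linear_minus[OF bounded_linear_ident]]
        bounded_bilinear.Ck_on_prod[OF bounded_bilinear_mult] that open_greaterThan)
qed simp

lemma smooth_on_sqrt: "smooth_on {0<..} sqrt"
proof (rule smooth_on_real_bootstrap)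
  show "(sqrt has_real_derivative inverse (sqrt x) / 2) (at x)" if "x \<in> {0<..}" for x
    using DERIV_real_sqrt that by simp
  show "Ck_on k {0<..} (\<lambda>x. inverse (sqrt x) / 2)" if "Ck_on k {0<..} sqrt" for k
    using smooth_on_inverse
    by (intro Ck_on_bounded_linear[OF _ bounded_linear_divide] Ck_on_compose[OF _ _ that, of "{0<..}"])
      (auto simp: smooth_on_def)
qed simp

lemma smooth_on_ln: "smooth_on {0<..} (ln :: real \<Rightarrow> real)"
proof (rule smooth_on_real_bootstrap)
  show "(ln has_real_derivative inverse x) (at x)" if "x \<in> {0<..}" for x :: real
    using DERIV_ln that by simp
  show "Ck_on k {0<..} (inverse :: real \<Rightarrow> real)" for k
    using smooth_on_inverse by (simp add: smooth_on_def)
qed simp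

lemma linear_family_expand:
  assumes "linear (F :: real ^ 'n::finite \<Rightarrow> 'b::real_vector)"
  shows "F v = (\<Sum>k\<in>UNIV. v $ k *\<^sub>R F (axis k 1))"
proof -
  have "F v = F (\<Sum>k\<in>UNIV. v $ k *\<^sub>R axis k 1)"
    using basis_expansion[of v] by (simp add: scalar_mult_eq_scaleR)
  then show ?thesis by (simp add: linear_sum[OF assms] linear_scale[OF assms])
qed

lemma smooth_on_linear_family:
  fixes F :: "'a::real_normed_vector \<Rightarrow> real ^ 'n::finite \<Rightarrow> 'b::real_normed_vector"
  assumes "open S" "\<And>x. x \<in> S \<Longrightarrow> linear (F x)" "\<And>k. smooth_on S (\<lambda>x. F x (axis k 1))" "smooth_on S X"
  shows "smooth_on S (\<lambda>x. F x (X x))"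
proof -
  have "smooth_on S (\<lambda>x. \<Sum>k\<in>UNIV. X x $ k *\<^sub>R F x (axis k 1))"
    by (intro smooth_on_sum smooth_on_scaleR smooth_on_nth assms) auto
  then show ?thesis
    by (rule smooth_on_cong[THEN iffD1, OF assms(1), rotated]) (simp add: linear_family_expand[OF assms(2)])
qed

lemma differentiable_nth: "X differentiable (at x) \<Longrightarrow> (\<lambda>x. X x $ k) differentiable (at x)"
  by (rule bounded_linear_compose_differentiable[OF bounded_linear_vec_nth])

text \<open>The product rule for the pairing of a family of linear maps with a vector. It is what separates the
  derivative of a coefficient from that of the field it is applied to, without choosing components.\<close>

lemma differentiable_linear_family:
  fixes F :: "'a::real_normed_vector \<Rightarrow> real ^ 'n::finite \<Rightarrow> 'b::real_normed_vector"
  assumes "open S" "x \<in> S" "\<And>x. x \<in> S \<Longrightarrow> linear (F x)"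
    and "\<And>k. (\<lambda>x. F x (axis k 1)) differentiable (at x)" "X differentiable (at x)"
  shows "(\<lambda>x. F x (X x)) differentiable (at x)"
    and "der (\<lambda>x. F x (X x)) x v = der (\<lambda>y. F y (X x)) x v + F x (der X x v)"
proof -
  have dk: "(\<lambda>x. X x $ k *\<^sub>R F x (axis k 1)) differentiable (at x)"
    "der (\<lambda>x. X x $ k *\<^sub>R F x (axis k 1)) x v
      = X x $ k *\<^sub>R der (\<lambda>x. F x (axis k 1)) x v + der X x v $ k *\<^sub>R F x (axis k 1)" for k
    using bounded_bilinear.differentiable_prod[OF bounded_bilinear_scaleR differentiable_nth[OF assms(5)] assms(4)]
      bounded_bilinear.der_prod[OF bounded_bilinear_scaleR differentiable_nth[OF assms(5)] assms(4)]
      der_bounded_linear[OF bounded_linear_vec_nth assms(5)]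
    by auto
  have ck: "(\<lambda>y. X x $ k *\<^sub>R F y (axis k 1)) differentiable (at x)"
    "der (\<lambda>y. X x $ k *\<^sub>R F y (axis k 1)) x v = X x $ k *\<^sub>R der (\<lambda>x. F x (axis k 1)) x v" for k
    using bounded_linear_compose_differentiable[OF bounded_linear_scaleR_right assms(4)]
      der_bounded_linear[OF bounded_linear_scaleR_right assms(4)] by auto
  have eq: "F y (X y) = (\<Sum>k\<in>UNIV. X y $ k *\<^sub>R F y (axis k 1))"
    "F y c = (\<Sum>k\<in>UNIV. c $ k *\<^sub>R F y (axis k 1))" if "y \<in> S" for y c
    using linear_family_expand[OF assms(3)[OF that]] by blast+
  have "(\<lambda>x. \<Sum>k\<in>UNIV. X x $ k *\<^sub>R F x (axis k 1)) differentiable (at x)" using dk(1) by simp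
  then show "(\<lambda>x. F x (X x)) differentiable (at x)"
    using differentiable_cong_open[OF assms(1,2) eq(1)] by simp
  have "der (\<lambda>x. F x (X x)) x v = der (\<lambda>x. \<Sum>k\<in>UNIV. X x $ k *\<^sub>R F x (axis k 1)) x v"
    using der_cong[OF assms(1,2) eq(1)] by simp
  also have "\<dots> = (\<Sum>k\<in>UNIV. X x $ k *\<^sub>R der (\<lambda>x. F x (axis k 1)) x v) + F x (der X x v)"
    by (simp add: der_sum dk sum.distrib eq(2)[OF assms(2), of "der X x v"])
  also have "(\<Sum>k\<in>UNIV. X x $ k *\<^sub>R der (\<lambda>x. F x (axis k 1)) x v) = der (\<lambda>y. F y (X x)) x v"
    using der_cong[OF assms(1,2) eq(2)[of _ "X x"]] by (simp add: der_sum ck)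
  finally show "der (\<lambda>x. F x (X x)) x v = der (\<lambda>y. F y (X x)) x v + F x (der X x v)" .
qed

lemma smooth_on_der_field:
  fixes f :: "real ^ 'n::finite \<Rightarrow> 'b::real_normed_vector"
  assumes "open S" "smooth_on S f" "smooth_on S X"
  shows "smooth_on S (\<lambda>x. der f x (X x))"
proof (rule smooth_on_linear_family[where F = "\<lambda>x. der f x", OF assms(1) _ _ assms(3)])
  show "linear (der f x)" if "x \<in> S" for x
    using that assms(2) by (intro linear_frechet_derivative smooth_on_differentiable)
  show "smooth_on S (\<lambda>x. der f x (axis k 1))" for k by (rule smooth_on_der[OF assms(2)])
qed

text \<open>Schwarz's theorem. Apply the mean value theorem twice to the second difference
  \<open>f(x + hv + hw) - f(x + hv) - f(x + hw) + f(x)\<close>: it is \<open>h\<^sup>2\<close> times a value of either mixed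
  derivative near \<open>x\<close>; then let \<open>h\<close> tend to 0.\<close>

lemma second_difference_mean_value:
  fixes f :: "'a::real_normed_vector \<Rightarrow> real"
  assumes h: "h > 0" and f: "smooth_on S f"
    and S: "\<And>s t. 0 \<le> s \<Longrightarrow> s \<le> h \<Longrightarrow> 0 \<le> t \<Longrightarrow> t \<le> h \<Longrightarrow> x + s *\<^sub>R v + t *\<^sub>R w \<in> S"
  shows "\<exists>s t. 0 < s \<and> s < h \<and> 0 < t \<and> t < h \<and>
    f (x + h *\<^sub>R v + h *\<^sub>R w) - f (x + h *\<^sub>R v) - f (x + h *\<^sub>R w) + f x
      = h * h * der (\<lambda>y. der f y v) (x + s *\<^sub>R v + t *\<^sub>R w) w"
proof -
  define G where "G s = f (x + s *\<^sub>R v + h *\<^sub>R w) - f (x + s *\<^sub>R v)" for s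
  have line: "((\<lambda>s. F (a + s *\<^sub>R u)) has_real_derivative der F (a + s *\<^sub>R u) u) (at s)"
    if "F differentiable (at (a + s *\<^sub>R u))" for F :: "'a \<Rightarrow> real" and a u s
  proof -
    have l: "((\<lambda>s. a + s *\<^sub>R u) has_derivative (\<lambda>t. t *\<^sub>R u)) (at s)"
      by (auto intro!: derivative_eq_intros)
    have "((\<lambda>s. F (a + s *\<^sub>R u)) has_derivative (\<lambda>t. der F (a + s *\<^sub>R u) (t *\<^sub>R u))) (at s)"
      using has_derivative_compose[OF l der_has_derivative[OF that]] .
    then show ?thesis
      unfolding has_field_derivative_def
      by (rule has_derivative_eq_rhs) (simp add: fun_eq_iff der_scaleR_vec[OF that])
  qed
  have "(G has_real_derivative
      (der f (x + s *\<^sub>R v + h *\<^sub>R w) v - der f (x + s *\<^sub>R v) v)) (at s)" if "0 \<le> s" "s \<le> h" for s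
  proof -
    have "x + s *\<^sub>R v + h *\<^sub>R w \<in> S" "x + s *\<^sub>R v \<in> S" using S[of s h] S[of s 0] that h by auto
    then have "f differentiable (at ((x + h *\<^sub>R w) + s *\<^sub>R v))" "f differentiable (at (x + s *\<^sub>R v))"
      using f by (auto simp: add_ac intro: smooth_on_differentiable)
    from DERIV_diff[OF line[OF this(1)] line[OF this(2)]] show ?thesis
      unfolding G_def by (simp add: add_ac)
  qed
  from MVT2[OF h this] obtain s where s: "0 < s" "s < h"
    and Gs: "G h - G 0 = (h - 0) * (der f (x + s *\<^sub>R v + h *\<^sub>R w) v - der f (x + s *\<^sub>R v) v)" by auto
  have "((\<lambda>t. der f ((x + s *\<^sub>R v) + t *\<^sub>R w) v) has_real_derivative
      der (\<lambda>y. der f y v) ((x + s *\<^sub>R v) + t *\<^sub>R w) w) (at t)" if "0 \<le> t" "t \<le> h" for t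
    using S[of s t] s that smooth_on_der[OF f] by (intro line) (auto intro: smooth_on_differentiable)
  from MVT2[OF h this] obtain t where t: "0 < t" "t < h"
    and "der f (x + s *\<^sub>R v + h *\<^sub>R w) v - der f (x + s *\<^sub>R v + 0 *\<^sub>R w) v
      = (h - 0) * der (\<lambda>y. der f y v) (x + s *\<^sub>R v + t *\<^sub>R w) w" by auto
  with Gs have "G h - G 0 = h * h * der (\<lambda>y. der f y v) (x + s *\<^sub>R v + t *\<^sub>R w) w" by simp
  then show ?thesis using s t unfolding G_def by (intro exI[of _ s] exI[of _ t]) auto
qed

lemma der_der_commute_real:
  fixes f :: "'a::real_normed_vector \<Rightarrow> real"
  assumes "open S" "x \<in> S" and f: "smooth_on S f"
  shows "der (\<lambda>y. der f y v) x w = der (\<lambda>y. der f y w) x v"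
proof (rule ccontr)
  let ?A = "\<lambda>z. der (\<lambda>y. der f y v) z w" and ?B = "\<lambda>z. der (\<lambda>y. der f y w) z v"
  assume ne: "?A x \<noteq> ?B x"
  define e where "e = \<bar>?A x - ?B x\<bar> / 2"
  have e: "e > 0" using ne by (simp add: e_def)
  have "isCont ?A x" "isCont ?B x"
    using smooth_on_continuous[OF smooth_on_der[OF smooth_on_der[OF f]]] assms
    by (auto simp: continuous_on_eq_continuous_at)
  then obtain r1 r2 where r: "r1 > 0" "\<And>z. dist z x < r1 \<Longrightarrow> dist (?A z) (?A x) < e"
    "r2 > 0" "\<And>z. dist z x < r2 \<Longrightarrow> dist (?B z) (?B x) < e"
    using e unfolding continuous_at_eps_delta by metis
  obtain r3 where r3: "r3 > 0" "ball x r3 \<subseteq> S" using assms by (auto simp: open_contains_ball)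
  define r where "r = min r1 (min r2 r3)"
  define h where "h = r / (2 * (norm v + norm w + 1))"
  have pos: "norm v + norm w + 1 > 0" by (simp add: add_nonneg_pos)
  have rp: "r > 0" using r r3 by (simp add: r_def)
  have h: "h > 0" using rp pos by (simp add: h_def)
  have near: "dist (x + s *\<^sub>R a + t *\<^sub>R b) x < r"
    if "0 \<le> s" "s \<le> h" "0 \<le> t" "t \<le> h" "{a, b} = {v, w}" for s t a b
  proof -
    have "norm (s *\<^sub>R a + t *\<^sub>R b) \<le> s * norm a + t * norm b"
      using norm_triangle_ineq[of "s *\<^sub>R a" "t *\<^sub>R b"] that by simp
    also have "\<dots> \<le> h * norm a + h * norm b"
      using that by (intro add_mono mult_right_mono) auto
    also have "\<dots> \<le> h * (norm v + norm w + 1)" using that h by (auto simp: doubleton_eq_iff algebra_simps)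
    also have "\<dots> = r / 2" using pos unfolding h_def by (simp add: field_simps del: divide_divide_eq_right)
    also have "\<dots> < r" using rp by simp
    finally show ?thesis by (simp add: dist_norm add.assoc)
  qed
  have inS: "x + s *\<^sub>R a + t *\<^sub>R b \<in> S" if "0 \<le> s" "s \<le> h" "0 \<le> t" "t \<le> h" "{a, b} = {v, w}" for s t a b
    using near[OF that] r3 by (auto simp: r_def ball_def dist_commute subset_iff)
  obtain s t where 1: "0 < s" "s < h" "0 < t" "t < h"
    "f (x + h *\<^sub>R v + h *\<^sub>R w) - f (x + h *\<^sub>R v) - f (x + h *\<^sub>R w) + f x = h * h * ?A (x + s *\<^sub>R v + t *\<^sub>R w)"
    using second_difference_mean_value[OF h f inS[of _ _ v w]] by auto
  obtain s' t' where 2: "0 < s'" "s' < h" "0 < t'" "t' < h"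
    "f (x + h *\<^sub>R w + h *\<^sub>R v) - f (x + h *\<^sub>R w) - f (x + h *\<^sub>R v) + f x = h * h * ?B (x + s' *\<^sub>R w + t' *\<^sub>R v)"
    using second_difference_mean_value[OF h f inS[of _ _ w v]] by (auto simp: insert_commute)
  have swap: "x + h *\<^sub>R w + h *\<^sub>R v = x + h *\<^sub>R v + h *\<^sub>R w" by (simp add: add_ac)
  have "h * h * ?A (x + s *\<^sub>R v + t *\<^sub>R w) = h * h * ?B (x + s' *\<^sub>R w + t' *\<^sub>R v)"
    using 1(5) 2(5) unfolding swap by linarith
  then have eq: "?A (x + s *\<^sub>R v + t *\<^sub>R w) = ?B (x + s' *\<^sub>R w + t' *\<^sub>R v)" using h by simp
  have "dist (?A (x + s *\<^sub>R v + t *\<^sub>R w)) (?A x) < e"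
    using near[of s t v w] 1 by (intro r) (auto simp: r_def)
  moreover have "dist (?B (x + s' *\<^sub>R w + t' *\<^sub>R v)) (?B x) < e"
    using near[of s' t' w v] 2 by (intro r) (auto simp: r_def)
  ultimately show False using eq unfolding e_def dist_real_def by (smt (verit) field_sum_of_halves)
qed

lemma der_der_commute:
  fixes f :: "'a::real_normed_vector \<Rightarrow> 'b::euclidean_space"
  assumes "open S" "x \<in> S" and f: "smooth_on S f"
  shows "der (\<lambda>y. der f y v) x w = der (\<lambda>y. der f y w) x v"
proof (rule euclidean_eqI)
  fix b :: 'b
  have fb: "smooth_on S (\<lambda>x. f x \<bullet> b)"
    by (rule smooth_on_bounded_linear[OF assms(1) bounded_linear_inner_left f])
  have *: "der (\<lambda>y. der (\<lambda>x. f x \<bullet> b) y v) x w = der (\<lambda>y. der f y v) x w \<bullet> b" for v w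
  proof -
    have "der (\<lambda>y. der (\<lambda>x. f x \<bullet> b) y v) x w = der (\<lambda>y. der f y v \<bullet> b) x w"
      using der_bounded_linear[OF bounded_linear_inner_left smooth_on_differentiable[OF f]]
      by (subst der_cong[OF assms(1,2)]) auto
    then show ?thesis
      using der_bounded_linear[OF bounded_linear_inner_left
        smooth_on_differentiable[OF smooth_on_der[OF f] assms(2)]] by simp
  qed
  show "der (\<lambda>y. der f y v) x w \<bullet> b = der (\<lambda>y. der f y w) x v \<bullet> b"
    using der_der_commute_real[OF assms(1,2) fb] by (simp add: *)
qed


section \<open>Positive definite forms and orthonormal bases\<close>

definition form :: "real ^ 'n::finite ^ 'n \<Rightarrow> real ^ 'n \<Rightarrow> real ^ 'n \<Rightarrow> real" where
  "form A u v = u \<bullet> (A *v v)"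

definition pos_form :: "real ^ 'n::finite ^ 'n \<Rightarrow> bool" where
  "pos_form A \<longleftrightarrow> (\<forall>u v. form A u v = form A v u) \<and> (\<forall>v. v \<noteq> 0 \<longrightarrow> form A v v > 0)"

definition onb :: "real ^ 'n::finite ^ 'n \<Rightarrow> ('n \<Rightarrow> real ^ 'n) \<Rightarrow> bool" where
  "onb A e \<longleftrightarrow> (\<forall>i j. form A (e i) (e j) = (if i = j then 1 else 0))"

lemma form_linear: "linear (form A u)" "linear (\<lambda>u. form A u v)"
  by (auto intro!: linearI simp: form_def inner_add_left inner_add_right matrix_vector_right_distrib
      matrix_vector_mult_scaleR)

lemma form_simps [simp]:
  "form A (u + u') v = form A u v + form A u' v"
  "form A u (v + v') = form A u v + form A u v'"
  "form A (u - u') v = form A u v - form A u' v"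
  "form A u (v - v') = form A u v - form A u v'"
  "form A (c *\<^sub>R u) v = c * form A u v"
  "form A u (c *\<^sub>R v) = c * form A u v"
  "form A (- u) v = - form A u v"
  "form A u (- v) = - form A u v"
  "form A 0 v = 0" "form A u 0 = 0"
  using form_linear[of A]
  by (simp_all add: linear_add linear_diff linear_scale linear_neg linear_0
      linear_add[OF form_linear(2)] linear_diff[OF form_linear(2)] linear_scale[OF form_linear(2)]
      linear_neg[OF form_linear(2)] linear_0[OF form_linear(2)])

lemma form_sum:
  "form A (\<Sum>i\<in>I. X i) v = (\<Sum>i\<in>I. form A (X i) v)"
  "form A v (\<Sum>i\<in>I. X i) = (\<Sum>i\<in>I. form A v (X i))"
  by (rule linear_sum[OF form_linear(2)], rule linear_sum[OF form_linear(1)])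

lemma form_matrix [simp]:
  "form (A + B) u v = form A u v + form B u v" "form (A - B) u v = form A u v - form B u v"
  "form (c *\<^sub>R A) u v = c * form A u v"
  by (simp_all add: form_def matrix_vector_mult_add_rdistrib matrix_vector_mult_diff_rdistrib
      inner_add_right inner_diff_right scaleR_matrix_vector_assoc[symmetric])

lemma form_axis: "form A (axis i 1) (axis j 1) = A $ i $ j"
  by (simp add: form_def inner_axis' matrix_vector_mul_component inner_axis)

lemma bounded_linear_form: "bounded_linear (\<lambda>A. form A u v)"
  by (intro linear_conv_bounded_linear[THEN iffD1] linearI) simp_all

lemma pos_form_commute: "pos_form A \<Longrightarrow> form A u v = form A v u"
  unfolding pos_form_def by blast

lemma pos_form_cancel:
  assumes "pos_form A" "\<And>v. form A u v = form A w v"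
  shows "u = w"
proof (rule ccontr)
  assume "u \<noteq> w"
  then have "form A (u - w) (u - w) > 0" using assms(1) unfolding pos_form_def by (metis right_minus_eq)
  moreover have "form A (u - w) (u - w) = form A u (u - w) - form A w (u - w)" by (rule form_simps)
  ultimately show False using assms(2) by simp
qed

lemma pos_form_inv:
  assumes "pos_form A"
  shows "matrix_inv A ** A = mat 1" "A ** matrix_inv A = mat 1"
proof -
  have "inj ((*v) A)"
  proof (rule injI)
    fix u w assume "A *v u = A *v w"
    then have "form A v (u - w) = 0" for v by (simp add: form_def matrix_vector_mult_diff_distrib)
    then show "u = w" using assms unfolding pos_form_def by (metis less_irrefl right_minus_eq)
  qed
  then have "invertible A" by (metis invertible_left_inverse matrix_left_invertible_injective)
  then show "matrix_inv A ** A = mat 1" "A ** matrix_inv A = mat 1"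
    unfolding invertible_def matrix_inv_def by (metis (mono_tags, lifting) someI_ex)+
qed

lemma pos_form_inv_form: "pos_form A \<Longrightarrow> form A (matrix_inv A *v u) v = u \<bullet> v"
  by (metis form_def inner_commute matrix_vector_mul_assoc matrix_vector_mul_lid pos_form_commute pos_form_inv(2))

text \<open>With \<open>E\<close> the matrix whose columns are the \<open>e i\<close>, orthonormality says that
  \<open>transpose E ** A\<close> is a left inverse of \<open>E\<close>; a left inverse is a right inverse.\<close>

lemma onb_matrix:
  assumes "onb A (e :: 'n::finite \<Rightarrow> real ^ 'n)"
  shows "(\<chi> a i. e i $ a) ** (transpose (\<chi> a i. e i $ a) ** A) = mat 1"
proof -
  let ?E = "(\<chi> a i. e i $ a) :: real ^ 'n ^ 'n"
  have col: "?E *v axis j 1 = e j" for j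
    by (simp add: vec_eq_iff matrix_vector_mult_basis column_def)
  have "((transpose ?E ** A) ** ?E) $ i $ j = (mat 1 :: real ^ 'n ^ 'n) $ i $ j" for i j
  proof -
    have "((transpose ?E ** A) ** ?E) $ i $ j = (((transpose ?E ** A) ** ?E) *v axis j 1) $ i"
      by (simp add: matrix_vector_mult_basis column_def)
    also have "\<dots> = (transpose ?E *v (A *v e j)) $ i"
      by (simp add: matrix_vector_mul_assoc[symmetric] col)
    also have "\<dots> = form A (e i) (e j)"
      unfolding matrix_vector_mult_def[of "transpose ?E"]
      by (simp add: form_def transpose_def inner_vec_def)
    finally show ?thesis using assms by (simp add: onb_def mat_def)
  qed
  then have "(transpose ?E ** A) ** ?E = mat 1" by (simp add: vec_eq_iff)
  then show ?thesis by (simp add: matrix_left_right_inverse)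
qed

lemma onb_expand:
  assumes "onb A (e :: 'n::finite \<Rightarrow> real ^ 'n)"
  shows "v = (\<Sum>i\<in>UNIV. form A (e i) v *\<^sub>R e i)"
proof -
  let ?E = "(\<chi> a i. e i $ a) :: real ^ 'n ^ 'n"
  have "v = ?E *v (transpose ?E *v (A *v v))"
    by (metis onb_matrix[OF assms] matrix_vector_mul_assoc matrix_vector_mul_lid)
  moreover have "(transpose ?E *v (A *v v)) $ i = form A (e i) v" for i
    by (simp add: form_def matrix_vector_mult_def transpose_def inner_vec_def)
  ultimately show ?thesis
    by (simp add: vec_eq_iff matrix_vector_mult_def[of ?E] mult.commute)
qed

lemma onb_inv:
  assumes "onb A (e :: 'n::finite \<Rightarrow> real ^ 'n)" "pos_form A"
  shows "matrix_inv A $ a $ b = (\<Sum>i\<in>UNIV. e i $ a * e i $ b)"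
proof -
  let ?E = "(\<chi> a i. e i $ a) :: real ^ 'n ^ 'n"
  have "matrix_inv A = ?E ** transpose ?E"
    using onb_matrix[OF assms(1)] pos_form_inv[OF assms(2)]
    by (metis matrix_mul_assoc matrix_mul_lid matrix_mul_rid)
  then show ?thesis by (simp add: matrix_matrix_mult_def transpose_def)
qed

text \<open>The coefficients of one orthonormal basis in the other form an orthogonal matrix, which cancels from
  the trace. All traces over frames, whose choice is arbitrary, are compared in this way.\<close>

lemma onb_trace_unique:
  fixes B :: "real ^ 'n::finite \<Rightarrow> real ^ 'n \<Rightarrow> 'b::real_vector"
  assumes e: "onb A e" and e': "onb A e'" and A: "pos_form A" and B: "bilinear B"
  shows "(\<Sum>a\<in>UNIV. B (e' a) (e' a)) = (\<Sum>i\<in>UNIV. B (e i) (e i))"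
proof -
  let ?c = "\<lambda>i a. form A (e i) (e' a)"
  have c: "(\<Sum>a\<in>UNIV. ?c i a * ?c j a) = (if i = j then 1 else 0)" for i j
  proof -
    have "form A (e i) (e j) = form A (e i) (\<Sum>a\<in>UNIV. form A (e' a) (e j) *\<^sub>R e' a)"
      using onb_expand[OF e', of "e j"] by simp
    also have "\<dots> = (\<Sum>a\<in>UNIV. ?c i a * ?c j a)"
      by (simp add: form_sum pos_form_commute[OF A, of _ "e j"] mult.commute)
    finally show ?thesis using e by (simp add: onb_def)
  qed
  have "B (e' a) (e' a) = (\<Sum>i\<in>UNIV. \<Sum>j\<in>UNIV. (?c i a * ?c j a) *\<^sub>R B (e i) (e j))" for a
  proof -
    have "B (e' a) (e' a) = B (\<Sum>i\<in>UNIV. ?c i a *\<^sub>R e i) (\<Sum>j\<in>UNIV. ?c j a *\<^sub>R e j)"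
      using onb_expand[OF e, of "e' a"] by simp
    also have "\<dots> = (\<Sum>(i, j)\<in>UNIV \<times> UNIV. B (?c i a *\<^sub>R e i) (?c j a *\<^sub>R e j))"
      by (rule bilinear_sum[OF B])
    finally show ?thesis by (simp add: sum.cartesian_product bilinear_lmul[OF B] bilinear_rmul[OF B]
        mult.commute)
  qed
  then have "(\<Sum>a\<in>UNIV. B (e' a) (e' a))
      = (\<Sum>a\<in>UNIV. \<Sum>i\<in>UNIV. \<Sum>j\<in>UNIV. (?c i a * ?c j a) *\<^sub>R B (e i) (e j))" by simp
  also have "\<dots> = (\<Sum>i\<in>UNIV. \<Sum>j\<in>UNIV. \<Sum>a\<in>UNIV. (?c i a * ?c j a) *\<^sub>R B (e i) (e j))"
    by (rule trans[OF sum.swap], rule sum.cong[OF refl], rule sum.swap)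
  also have "\<dots> = (\<Sum>i\<in>UNIV. \<Sum>j\<in>UNIV. (if i = j then 1 else 0) *\<^sub>R B (e i) (e j))"
    by (simp add: scaleR_sum_left[symmetric] c)
  also have "\<dots> = (\<Sum>i\<in>UNIV. B (e i) (e i))"
    by (simp add: if_distribR if_distrib[of "\<lambda>c. c *\<^sub>R _"] sum.delta cong: if_cong)
  finally show ?thesis .
qed

text \<open>Both sides are the trace of \<open>L\<close>; the right-hand side is the one that is easily differentiated.\<close>

lemma onb_trace_linear:
  assumes e: "onb A (e :: 'n::finite \<Rightarrow> real ^ 'n)" and A: "pos_form A" and L: "linear L"
  shows "(\<Sum>i\<in>UNIV. form A (L (e i)) (e i)) = (\<Sum>k\<in>UNIV. L (axis k 1) $ k)"
proof -
  have "(\<Sum>k\<in>UNIV. L (axis k 1) $ k) = (\<Sum>k\<in>UNIV. (\<Sum>i\<in>UNIV. form A (e i) (L (axis k 1)) *\<^sub>R e i) $ k)"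
    using onb_expand[OF e] by metis
  also have "\<dots> = (\<Sum>k\<in>UNIV. \<Sum>i\<in>UNIV. form A (e i) (L (axis k 1)) * e i $ k)"
    by simp
  also have "\<dots> = (\<Sum>i\<in>UNIV. \<Sum>k\<in>UNIV. form A (e i) (L (axis k 1)) * e i $ k)"
    by (rule sum.swap)
  also have "\<dots> = (\<Sum>i\<in>UNIV. form A (e i) (\<Sum>k\<in>UNIV. e i $ k *\<^sub>R L (axis k 1)))"
    by (simp add: form_sum mult.commute)
  also have "\<dots> = (\<Sum>i\<in>UNIV. form A (L (e i)) (e i))"
    by (simp add: linear_family_expand[OF L, symmetric] pos_form_commute[OF A, of "L _"])
  finally show ?thesis by simp
qed

lemma smooth_on_form:
  assumes "open S" "smooth_on S A" "smooth_on S X" "smooth_on S Y"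
  shows "smooth_on S (\<lambda>x. form (A x) (X x) (Y x))"
  unfolding form_def using assms by (intro smooth_on_inner smooth_on_matrix_vector_mult)

lemma bounded_bilinear_matrix_vector:
  "bounded_bilinear ((*v) :: real ^ 'n::finite ^ 'm::finite \<Rightarrow> _)"
  by (intro bilinear_conv_bounded_bilinear[THEN iffD1])
    (auto simp: bilinear_def matrix_vector_mult_add_rdistrib scaleR_matrix_vector_assoc[symmetric] intro!: linearI)

lemma der_form:
  assumes "A differentiable (at x)" "X differentiable (at x)" "Y differentiable (at x)"
  shows "(\<lambda>x. form (A x) (X x) (Y x)) differentiable (at x)"
    and "der (\<lambda>x. form (A x) (X x) (Y x)) x v
      = form (der A x v) (X x) (Y x) + form (A x) (der X x v) (Y x) + form (A x) (X x) (der Y x v)"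
proof -
  note mv = bounded_bilinear.differentiable_prod[OF bounded_bilinear_matrix_vector assms(1,3)]
    bounded_bilinear.der_prod[OF bounded_bilinear_matrix_vector assms(1,3)]
  show "(\<lambda>x. form (A x) (X x) (Y x)) differentiable (at x)"
    unfolding form_def by (rule bounded_bilinear.differentiable_prod[OF bounded_bilinear_inner assms(2) mv(1)])
  show "der (\<lambda>x. form (A x) (X x) (Y x)) x v
      = form (der A x v) (X x) (Y x) + form (A x) (der X x v) (Y x) + form (A x) (X x) (der Y x v)"
    unfolding form_def bounded_bilinear.der_prod[OF bounded_bilinear_inner assms(2) mv(1)] mv(2)
    by (simp add: inner_add_right)
qed

text \<open>Gram-Schmidt orthonormalisation of the coordinate fields; the normalising factors are smooth
  because the vectors that are normalised never vanish.\<close>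

lemma smooth_orthonormal_frame_exists:
  fixes A :: "'a::real_normed_vector \<Rightarrow> real ^ 'n::finite ^ 'n"
  assumes S: "open S" and A: "smooth_on S A" and pos: "\<And>x. x \<in> S \<Longrightarrow> pos_form (A x)"
  shows "\<exists>e. (\<forall>i. smooth_on S (e i)) \<and> (\<forall>x\<in>S. onb (A x) (\<lambda>i. e i x))"
proof -
  let ?b = "\<lambda>i. axis i 1 :: real ^ 'n"
  have "\<exists>e. (\<forall>i\<in>F. smooth_on S (e i)) \<and> (\<forall>x\<in>S. \<forall>i\<in>F. e i x \<in> span (?b ` F)) \<and>
      (\<forall>x\<in>S. \<forall>i\<in>F. \<forall>j\<in>F. form (A x) (e i x) (e j x) = (if i = j then 1 else 0))" for F :: "'n set"
  proof (induction F rule: finite_induct[OF finite])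
    case 1 then show ?case by simp
  next
    case (2 j F)
    then obtain e where sm: "\<And>i. i \<in> F \<Longrightarrow> smooth_on S (e i)"
      and sp: "\<And>x i. x \<in> S \<Longrightarrow> i \<in> F \<Longrightarrow> e i x \<in> span (?b ` F)"
      and on: "\<And>x i k. x \<in> S \<Longrightarrow> i \<in> F \<Longrightarrow> k \<in> F \<Longrightarrow> form (A x) (e i x) (e k x) = (if i = k then 1 else 0)"
      by metis
    define p where "p x = (\<Sum>i\<in>F. form (A x) (e i x) (?b j) *\<^sub>R e i x)" for x
    define u where "u x = ?b j - p x" for x
    define w where "w x = inverse (sqrt (form (A x) (u x) (u x))) *\<^sub>R u x" for x
    have p_span: "p x \<in> span (?b ` F)" if "x \<in> S" for x
      unfolding p_def using sp[OF that] by (intro span_sum span_scale)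
    have u0: "u x \<noteq> 0" if "x \<in> S" for x
    proof
      assume "u x = 0"
      then have "?b j \<in> span (?b ` F)" using p_span[OF that] by (simp add: u_def)
      then have "?b j $ j = 0"
      proof (rule span_induct)
        show "subspace {v :: real ^ 'n. v $ j = 0}" by (auto simp: subspace_def)
      next
        fix v assume "v \<in> ?b ` F"
        then show "v $ j = 0" using 2 by (auto simp: axis_def)
      qed
      then show False by (simp add: axis_def)
    qed
    have pos_u: "form (A x) (u x) (u x) > 0" if "x \<in> S" for x
      using pos[OF that] u0[OF that] by (simp add: pos_form_def)
    have sm_u: "smooth_on S u"
      unfolding u_def p_def
      by (intro smooth_on_diff smooth_on_sum smooth_on_scaleR smooth_on_form smooth_on_const S A sm 2)
    have sm_w: "smooth_on S w"
      unfolding w_def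
    proof (intro smooth_on_scaleR S sm_u)
      have "smooth_on S (\<lambda>x. form (A x) (u x) (u x))" by (intro smooth_on_form S A sm_u)
      then have "smooth_on S (\<lambda>x. sqrt (form (A x) (u x) (u x)))"
        using smooth_on_compose[OF S _ _ smooth_on_sqrt] pos_u by (auto simp: image_subset_iff)
      then show "smooth_on S (\<lambda>x. inverse (sqrt (form (A x) (u x) (u x))))"
        using smooth_on_compose[OF S _ _ smooth_on_inverse] pos_u by (auto simp: image_subset_iff)
    qed
    have eu: "form (A x) (e i x) (u x) = 0" if "x \<in> S" "i \<in> F" for x i
    proof -
      have "form (A x) (e i x) (p x) = (\<Sum>k\<in>F. form (A x) (e k x) (?b j) * (if i = k then 1 else 0))"
        unfolding p_def form_sum using on that by (intro sum.cong) auto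
      then show ?thesis using that 2 by (simp add: u_def if_distrib sum.delta cong: if_cong)
    qed
    have ew: "form (A x) (e i x) (w x) = 0" "form (A x) (w x) (e i x) = 0" if "x \<in> S" "i \<in> F" for x i
      using eu[OF that] pos_form_commute[OF pos[OF that(1)], of "u x" "e i x"] by (simp_all add: w_def)
    have ww: "form (A x) (w x) (w x) = 1" if "x \<in> S" for x
      using pos_u[OF that] by (simp add: w_def field_simps)
    have w_span: "w x \<in> span (?b ` insert j F)" if "x \<in> S" for x
      unfolding w_def u_def using p_span[OF that] span_mono[of "?b ` F" "?b ` insert j F"]
      by (intro span_scale span_diff) (auto intro: span_base)
    have mono: "span (?b ` F) \<subseteq> span (?b ` insert j F)" by (intro span_mono) auto
    show ?case
    proof (intro exI[of _ "e(j := w)"] conjI ballI)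
      show "smooth_on S ((e(j := w)) i)" if "i \<in> insert j F" for i using that sm sm_w by auto
      show "(e(j := w)) i x \<in> span (?b ` insert j F)" if "x \<in> S" "i \<in> insert j F" for x i
        using that sp w_span mono by auto
      show "form (A x) ((e(j := w)) i x) ((e(j := w)) k x) = (if i = k then 1 else 0)"
        if "x \<in> S" "i \<in> insert j F" "k \<in> insert j F" for x i k
        using that on ew ww 2 by auto
    qed
  qed
  from this[of UNIV] show ?thesis by (auto simp: onb_def)
qed

lemma smooth_on_matrix_inv:
  assumes S: "open S" and A: "smooth_on S A" and pos: "\<And>x. x \<in> S \<Longrightarrow> pos_form (A x)"
  shows "smooth_on S (\<lambda>x. matrix_inv (A x))"
proof -
  obtain e where e: "\<And>i. smooth_on S (e i)" "\<And>x. x \<in> S \<Longrightarrow> onb (A x) (\<lambda>i. e i x)"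
    using smooth_orthonormal_frame_exists[OF assms] by blast
  have "smooth_on S (\<lambda>x. matrix_inv (A x) $ a $ b)" for a b
  proof -
    have "smooth_on S (\<lambda>x. \<Sum>i\<in>UNIV. e i x $ a * e i x $ b)"
      by (intro smooth_on_sum smooth_on_mult smooth_on_nth S e finite)
    then show ?thesis
      by (rule smooth_on_cong[THEN iffD1, OF S, rotated]) (simp add: onb_inv[OF e(2) pos])
  qed
  then show ?thesis by (intro smooth_on_vec S)
qed

lemma onb_exists: "pos_form A \<Longrightarrow> \<exists>e. onb A e"
  using smooth_orthonormal_frame_exists[of "UNIV :: real set" "\<lambda>_. A"] smooth_on_const by auto


section \<open>Riemannian geometry in one coordinate system\<close>

definition koszul ::
  "(real ^ 'n::finite \<Rightarrow> real ^ 'n ^ 'n) \<Rightarrow> real ^ 'n \<Rightarrow> real ^ 'n \<Rightarrow> real ^ 'n \<Rightarrow> real ^ 'n \<Rightarrow> real" where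
  "koszul g x \<xi> \<eta> \<zeta> = form (der g x \<xi>) \<eta> \<zeta> + form (der g x \<eta>) \<xi> \<zeta> - form (der g x \<zeta>) \<xi> \<eta>"

text \<open>The Christoffel symbols applied to two vectors, without reference to components.\<close>

definition chr ::
  "(real ^ 'n::finite \<Rightarrow> real ^ 'n ^ 'n) \<Rightarrow> real ^ 'n \<Rightarrow> real ^ 'n \<Rightarrow> real ^ 'n \<Rightarrow> real ^ 'n" where
  "chr g x \<xi> \<eta> = (1/2) *\<^sub>R (matrix_inv (g x) *v (\<chi> l. koszul g x \<xi> \<eta> (axis l 1)))"

text \<open>The covariant derivative of the field \<open>X\<close> in the constant direction \<open>\<xi>\<close>, then its second covariant
  derivative and the curvature tensor. Constant directions commute, so no bracket term occurs.\<close>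

definition cd ::
  "(real ^ 'n::finite \<Rightarrow> real ^ 'n ^ 'n) \<Rightarrow> real ^ 'n \<Rightarrow> (real ^ 'n \<Rightarrow> real ^ 'n) \<Rightarrow> real ^ 'n \<Rightarrow> real ^ 'n" where
  "cd g \<xi> X x = der X x \<xi> + chr g x \<xi> (X x)"

definition cd2 ::
  "(real ^ 'n::finite \<Rightarrow> real ^ 'n ^ 'n) \<Rightarrow> (real ^ 'n \<Rightarrow> real ^ 'n) \<Rightarrow> real ^ 'n \<Rightarrow> real ^ 'n \<Rightarrow> real ^ 'n \<Rightarrow> real ^ 'n" where
  "cd2 g X x \<xi> \<eta> = cd g \<xi> (cd g \<eta> X) x - cd g (chr g x \<xi> \<eta>) X x"

definition Rm ::
  "(real ^ 'n::finite \<Rightarrow> real ^ 'n ^ 'n) \<Rightarrow> real ^ 'n \<Rightarrow> real ^ 'n \<Rightarrow> real ^ 'n \<Rightarrow> real ^ 'n \<Rightarrow> real ^ 'n" where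
  "Rm g x \<xi> \<eta> \<zeta> = cd g \<xi> (cd g \<eta> (\<lambda>_. \<zeta>)) x - cd g \<eta> (cd g \<xi> (\<lambda>_. \<zeta>)) x"

definition gradc ::
  "(real ^ 'n::finite \<Rightarrow> real ^ 'n ^ 'n) \<Rightarrow> (real ^ 'n \<Rightarrow> real) \<Rightarrow> real ^ 'n \<Rightarrow> real ^ 'n" where
  "gradc g h x = matrix_inv (g x) *v (\<chi> k. der h x (axis k 1))"

text \<open>The divergence as the trace of \<open>\<xi> \<mapsto> \<nabla>\<^sub>\<xi> X\<close>.\<close>

definition divc ::
  "(real ^ 'n::finite \<Rightarrow> real ^ 'n ^ 'n) \<Rightarrow> (real ^ 'n \<Rightarrow> real ^ 'n) \<Rightarrow> real ^ 'n \<Rightarrow> real" where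
  "divc g X x = (\<Sum>k\<in>UNIV. cd g (axis k 1) X x $ k)"

lemma linear_der_family:
  assumes "open S" "x \<in> S" "\<And>y. y \<in> S \<Longrightarrow> linear (F y)" "\<And>\<eta>. (\<lambda>y. F y \<eta>) differentiable (at x)"
  shows "linear (\<lambda>\<eta>. der (\<lambda>y. F y \<eta>) x v)"
proof (rule linearI)
  fix a b
  have "der (\<lambda>y. F y (a + b)) x v = der (\<lambda>y. F y a + F y b) x v"
    using der_cong[OF assms(1,2), of "\<lambda>y. F y (a + b)" "\<lambda>y. F y a + F y b"] linear_add[OF assms(3)] by simp
  then show "der (\<lambda>y. F y (a + b)) x v = der (\<lambda>y. F y a) x v + der (\<lambda>y. F y b) x v"
    by (simp add: der_add assms(4))
next
  fix c :: real and a
  have "der (\<lambda>y. F y (c *\<^sub>R a)) x v = der (\<lambda>y. c *\<^sub>R F y a) x v"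
    using der_cong[OF assms(1,2), of "\<lambda>y. F y (c *\<^sub>R a)" "\<lambda>y. c *\<^sub>R F y a"] linear_scale[OF assms(3)] by simp
  then show "der (\<lambda>y. F y (c *\<^sub>R a)) x v = c *\<^sub>R der (\<lambda>y. F y a) x v"
    using der_bounded_linear[OF bounded_linear_scaleR_right assms(4)] by simp
qed

lemma koszul_linear:
  assumes "g differentiable (at x)"
  shows "linear (\<lambda>\<xi>. koszul g x \<xi> \<eta> \<zeta>)" "linear (\<lambda>\<eta>. koszul g x \<xi> \<eta> \<zeta>)" "linear (koszul g x \<xi> \<eta>)"
  using assms
  by (auto intro!: linearI simp: koszul_def der_add_vec der_scaleR_vec algebra_simps)

lemma chr_bilinear:
  assumes "g differentiable (at x)"
  shows "bilinear (chr g x)"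
proof -
  note k = koszul_linear[OF assms]
  have v: "(\<chi> l. f l + f' l) = (\<chi> l. f l) + (\<chi> l. f' l)" "(\<chi> l. c * f l) = c *\<^sub>R (\<chi> l. f l)"
    for f f' :: "'a \<Rightarrow> real" and c by (simp_all add: vec_eq_iff)
  show ?thesis
    unfolding bilinear_def chr_def
    by (auto intro!: linearI simp: linear_add[OF k(1)] linear_add[OF k(2)] linear_scale[OF k(1)]
        linear_scale[OF k(2)] v matrix_vector_right_distrib matrix_vector_mult_scaleR scaleR_add_right)
qed

lemma christoffel_term_eq_chr:
  assumes "metric_matrix M c differentiable (at x)"
  shows "christoffel_term M c x \<xi> \<eta> = chr (metric_matrix M c) x \<xi> \<eta>"
proof -
  let ?g = "metric_matrix M c"
  note k = koszul_linear[OF assms]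
  have dg: "der (\<lambda>y. ?g y $ j $ l) x v = form (der ?g x v) (axis j 1) (axis l 1)" for j l v
    using der_bounded_linear[OF bounded_linear_form assms, of "axis j 1" "axis l 1" v]
    by (simp add: form_axis)
  have ch: "christoffel M c x i j k
      = (1/2) * (\<Sum>l\<in>UNIV. matrix_inv (?g x) $ k $ l * koszul ?g x (axis i 1) (axis j 1) (axis l 1))" for i j k
    by (simp add: christoffel_def koszul_def dg)
  have ko: "koszul ?g x \<xi> \<eta> \<zeta> = (\<Sum>i\<in>UNIV. \<Sum>j\<in>UNIV. \<xi> $ i * \<eta> $ j * koszul ?g x (axis i 1) (axis j 1) \<zeta>)" for \<zeta>
  proof -
    have "koszul ?g x \<xi> \<eta> \<zeta> = (\<Sum>i\<in>UNIV. \<xi> $ i *\<^sub>R koszul ?g x (axis i 1) \<eta> \<zeta>)"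
      by (rule linear_family_expand[OF k(1)])
    also have "\<dots> = (\<Sum>i\<in>UNIV. \<xi> $ i *\<^sub>R (\<Sum>j\<in>UNIV. \<eta> $ j *\<^sub>R koszul ?g x (axis i 1) (axis j 1) \<zeta>))"
      by (intro sum.cong refl arg_cong[where f = "\<lambda>t. _ *\<^sub>R t"] linear_family_expand[OF k(2)])
    finally show ?thesis by (simp add: sum_distrib_left mult.assoc)
  qed
  show ?thesis
  proof (rule vec_eq_iff[THEN iffD2, rule_format])
    fix k
    have "christoffel_term M c x \<xi> \<eta> $ k = (\<Sum>i\<in>UNIV. \<Sum>j\<in>UNIV. \<Sum>l\<in>UNIV.
        (1/2) * (matrix_inv (?g x) $ k $ l * (\<xi> $ i * \<eta> $ j * koszul ?g x (axis i 1) (axis j 1) (axis l 1))))"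
      by (simp add: christoffel_term_def ch sum_distrib_left sum_distrib_right mult_ac)
    also have "\<dots> = (\<Sum>i\<in>UNIV. \<Sum>l\<in>UNIV. \<Sum>j\<in>UNIV.
        (1/2) * (matrix_inv (?g x) $ k $ l * (\<xi> $ i * \<eta> $ j * koszul ?g x (axis i 1) (axis j 1) (axis l 1))))"
      by (rule sum.cong[OF refl], rule sum.swap)
    also have "\<dots> = (\<Sum>l\<in>UNIV. \<Sum>i\<in>UNIV. \<Sum>j\<in>UNIV.
        (1/2) * (matrix_inv (?g x) $ k $ l * (\<xi> $ i * \<eta> $ j * koszul ?g x (axis i 1) (axis j 1) (axis l 1))))"
      by (rule sum.swap)
    also have "\<dots> = chr ?g x \<xi> \<eta> $ k"
      by (simp add: chr_def matrix_vector_mult_def ko sum_distrib_left)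
    finally show "christoffel_term M c x \<xi> \<eta> $ k = chr ?g x \<xi> \<eta> $ k" .
  qed
qed

lemma trace_mult_commute:
  assumes A: "linear (A :: real ^ 'n::finite \<Rightarrow> real ^ 'n)" and B: "linear (B :: real ^ 'n \<Rightarrow> real ^ 'n)"
  shows "(\<Sum>k\<in>UNIV. A (B (axis k 1)) $ k) = (\<Sum>k\<in>UNIV. B (A (axis k 1)) $ k)"
proof -
  have *: "(\<Sum>k\<in>UNIV. A (B (axis k 1)) $ k) = (\<Sum>k\<in>UNIV. \<Sum>l\<in>UNIV. B (axis k 1) $ l * A (axis l 1) $ k)"
    if "linear A" for A B :: "real ^ 'n \<Rightarrow> real ^ 'n"
    by (intro sum.cong refl) (simp add: linear_family_expand[OF that, of "B _"])
  show ?thesis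
    unfolding *[OF A] *[OF B] by (subst sum.swap) (simp add: mult.commute)
qed

locale coord_metric =
  fixes S :: "(real ^ 'n::finite) set" and g :: "real ^ 'n \<Rightarrow> real ^ 'n ^ 'n"
  assumes open_S: "open S" and smooth_g: "smooth_on S g" and pos: "x \<in> S \<Longrightarrow> pos_form (g x)"
begin

lemma diff_g: "x \<in> S \<Longrightarrow> g differentiable (at x)"
  by (rule smooth_on_differentiable[OF smooth_g])

lemmas chr_bil = chr_bilinear[OF diff_g]

lemma chr_linear: "x \<in> S \<Longrightarrow> linear (chr g x \<xi>)" "x \<in> S \<Longrightarrow> linear (\<lambda>\<xi>. chr g x \<xi> \<eta>)"
  using chr_bil unfolding bilinear_def by blast+

lemma chr_simps:
  assumes "x \<in> S"
  shows "chr g x (a + b) c = chr g x a c + chr g x b c" "chr g x c (a + b) = chr g x c a + chr g x c b"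
    "chr g x (a - b) c = chr g x a c - chr g x b c" "chr g x c (a - b) = chr g x c a - chr g x c b"
    "chr g x (r *\<^sub>R a) c = r *\<^sub>R chr g x a c" "chr g x c (r *\<^sub>R a) = r *\<^sub>R chr g x c a"
    "chr g x (- a) c = - chr g x a c" "chr g x c (- a) = - chr g x c a"
    "chr g x 0 c = 0" "chr g x c 0 = 0"
  using chr_linear[OF assms]
  by (simp_all add: linear_add linear_diff linear_scale linear_neg linear_0
      linear_add[OF chr_linear(2)[OF assms]] linear_diff[OF chr_linear(2)[OF assms]]
      linear_scale[OF chr_linear(2)[OF assms]] linear_neg[OF chr_linear(2)[OF assms]]
      linear_0[OF chr_linear(2)[OF assms]])

lemma form_commute: "x \<in> S \<Longrightarrow> form (g x) u v = form (g x) v u"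
  by (rule pos_form_commute[OF pos])

lemma form_cancel: "x \<in> S \<Longrightarrow> (\<And>v. form (g x) u v = form (g x) w v) \<Longrightarrow> u = w"
  by (rule pos_form_cancel[OF pos])

lemma form_der_commute:
  assumes "x \<in> S"
  shows "form (der g x \<xi>) u v = form (der g x \<xi>) v u"
proof -
  have "der (\<lambda>y. form (g y) u v) x = der (\<lambda>y. form (g y) v u) x"
    using assms form_commute by (intro der_cong[OF open_S]) auto
  from fun_cong[OF this, of \<xi>] show ?thesis
    by (simp only: der_bounded_linear[OF bounded_linear_form diff_g[OF assms]])
qed

lemma chr_koszul:
  assumes "x \<in> S"
  shows "2 * form (g x) (chr g x \<xi> \<eta>) \<zeta> = koszul g x \<xi> \<eta> \<zeta>"
  using linear_family_expand[OF koszul_linear(3)[OF diff_g[OF assms]], of \<xi> \<eta> \<zeta>]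
  by (simp add: chr_def pos_form_inv_form[OF pos[OF assms]] inner_vec_def mult.commute)

lemma chr_commute:
  assumes "x \<in> S"
  shows "chr g x \<xi> \<eta> = chr g x \<eta> \<xi>"
proof (rule form_cancel[OF assms])
  fix \<zeta>
  have "2 * form (g x) (chr g x \<xi> \<eta>) \<zeta> = 2 * form (g x) (chr g x \<eta> \<xi>) \<zeta>"
    by (simp add: chr_koszul[OF assms] koszul_def form_der_commute[OF assms, of \<zeta> \<eta> \<xi>])
  then show "form (g x) (chr g x \<xi> \<eta>) \<zeta> = form (g x) (chr g x \<eta> \<xi>) \<zeta>" by simp
qed

lemma metric_compatible:
  assumes "x \<in> S"
  shows "form (der g x \<xi>) \<eta> \<zeta> = form (g x) (chr g x \<xi> \<eta>) \<zeta> + form (g x) \<eta> (chr g x \<xi> \<zeta>)"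
proof -
  have "2 * form (g x) (chr g x \<xi> \<eta>) \<zeta> + 2 * form (g x) (chr g x \<xi> \<zeta>) \<eta> = 2 * form (der g x \<xi>) \<eta> \<zeta>"
    unfolding chr_koszul[OF assms] koszul_def
    using form_der_commute[OF assms, of \<xi> \<eta> \<zeta>] form_der_commute[OF assms, of \<eta> \<xi> \<zeta>]
      form_der_commute[OF assms, of \<zeta> \<xi> \<eta>] by simp
  then show ?thesis using form_commute[OF assms, of "chr g x \<xi> \<zeta>" \<eta>] by simp
qed

lemma smooth_chr:
  assumes "smooth_on S X" "smooth_on S Y"
  shows "smooth_on S (\<lambda>x. chr g x (X x) (Y x))"
proof -
  have der: "smooth_on S (\<lambda>x. der g x (Z x))" if "smooth_on S Z" for Z
    by (rule smooth_on_der_field[OF open_S smooth_g that])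
  have "smooth_on S (\<lambda>x. koszul g x (X x) (Y x) (axis l 1))" for l
    unfolding koszul_def
    by (intro smooth_on_diff smooth_on_add smooth_on_form open_S der assms smooth_on_const)
  then show ?thesis
    unfolding chr_def
    by (intro smooth_on_scaleR smooth_on_const smooth_on_matrix_vector_mult smooth_on_vec_lambda
        smooth_on_matrix_inv open_S smooth_g pos)
qed

lemma chr_differentiable: "x \<in> S \<Longrightarrow> (\<lambda>y. chr g y \<xi> \<eta>) differentiable (at x)"
  by (rule smooth_on_differentiable[OF smooth_chr]) (auto intro: smooth_on_const)

lemma der_chr_linear:
  assumes "x \<in> S"
  shows "linear (\<lambda>\<xi>. der (\<lambda>y. chr g y \<xi> \<eta>) x v)" "linear (\<lambda>\<eta>. der (\<lambda>y. chr g y \<xi> \<eta>) x v)"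
  using linear_der_family[OF open_S assms, of "\<lambda>y \<xi>. chr g y \<xi> \<eta>"]
    linear_der_family[OF open_S assms, of "\<lambda>y \<eta>. chr g y \<xi> \<eta>"] chr_linear chr_differentiable[OF assms]
  by auto

lemma smooth_cd:
  assumes "smooth_on S X" "smooth_on S Y"
  shows "smooth_on S (\<lambda>x. cd g (Y x) X x)"
  unfolding cd_def
  by (intro smooth_on_add open_S smooth_on_der_field smooth_chr assms)

lemma smooth_cd_const: "smooth_on S X \<Longrightarrow> smooth_on S (cd g \<xi> X)"
  using smooth_cd[OF _ smooth_on_const] by simp

lemma cd_linear: "x \<in> S \<Longrightarrow> X differentiable (at x) \<Longrightarrow> linear (\<lambda>\<xi>. cd g \<xi> X x)"
  unfolding cd_def by (intro linear_compose_add linear_frechet_derivative chr_linear)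

lemma der_form_cd:
  assumes "x \<in> S" "X differentiable (at x)" "Y differentiable (at x)"
  shows "der (\<lambda>y. form (g y) (X y) (Y y)) x \<xi> = form (g x) (cd g \<xi> X x) (Y x) + form (g x) (X x) (cd g \<xi> Y x)"
  by (simp add: der_form[OF diff_g[OF assms(1)] assms(2,3)] metric_compatible[OF assms(1)] cd_def)

text \<open>Differentiating along a field instead of a constant direction adds the derivative of that field.\<close>

lemma cd_along_field:
  assumes x: "x \<in> S" and Z: "smooth_on S Z" and Y: "Y differentiable (at x)"
  shows "(\<lambda>y. cd g (Y y) Z y) differentiable (at x)"
    and "cd g \<xi> (\<lambda>y. cd g (Y y) Z y) x = cd g \<xi> (cd g (Y x) Z) x + cd g (der Y x \<xi>) Z x"
proof -
  have lin: "linear (\<lambda>\<eta>. cd g \<eta> Z y)" if "y \<in> S" for y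
    by (rule cd_linear[OF that smooth_on_differentiable[OF Z that]])
  note * = differentiable_linear_family[OF open_S x, of "\<lambda>y \<eta>. cd g \<eta> Z y", OF lin _ Y]
  have d: "(\<lambda>y. cd g (axis k 1) Z y) differentiable (at x)" for k
    by (rule smooth_on_differentiable[OF smooth_cd_const[OF Z] x])
  show "(\<lambda>y. cd g (Y y) Z y) differentiable (at x)" by (rule *(1)[OF _ d])
  have "der (\<lambda>y. cd g (Y y) Z y) x \<xi> = der (\<lambda>y. cd g (Y x) Z y) x \<xi> + cd g (der Y x \<xi>) Z x"
    by (rule *(2)[OF _ d])
  then show "cd g \<xi> (\<lambda>y. cd g (Y y) Z y) x = cd g \<xi> (cd g (Y x) Z) x + cd g (der Y x \<xi>) Z x"
    unfolding cd_def[of _ _ "\<lambda>y. cd g (Y y) Z y"] cd_def[of _ _ "cd g (Y x) Z"] by simp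
qed

lemma cd_cd:
  assumes x: "x \<in> S" and X: "smooth_on S X"
  shows "cd g \<xi> (cd g \<eta> X) x = der (\<lambda>y. der X y \<eta>) x \<xi> + der (\<lambda>y. chr g y \<eta> (X x)) x \<xi>
     + chr g x \<eta> (der X x \<xi>) + chr g x \<xi> (der X x \<eta>) + chr g x \<xi> (chr g x \<eta> (X x))"
proof -
  have dX: "X differentiable (at x)" by (rule smooth_on_differentiable[OF X x])
  note * = differentiable_linear_family[OF open_S x, of "\<lambda>y. chr g y \<eta>", OF chr_linear(1) _ dX]
  have "der (cd g \<eta> X) x \<xi> = der (\<lambda>y. der X y \<eta> + chr g y \<eta> (X y)) x \<xi>"
    by (simp add: cd_def[abs_def])
  also have "\<dots> = der (\<lambda>y. der X y \<eta>) x \<xi> + der (\<lambda>y. chr g y \<eta> (X y)) x \<xi>"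
    by (intro der_add *(1) chr_differentiable x smooth_on_differentiable[OF smooth_on_der[OF X]])
  also have "der (\<lambda>y. chr g y \<eta> (X y)) x \<xi> = der (\<lambda>y. chr g y \<eta> (X x)) x \<xi> + chr g x \<eta> (der X x \<xi>)"
    by (intro *(2) chr_differentiable x)
  finally have E: "der (cd g \<eta> X) x \<xi> = der (\<lambda>y. der X y \<eta>) x \<xi>
      + (der (\<lambda>y. chr g y \<eta> (X x)) x \<xi> + chr g x \<eta> (der X x \<xi>))" .
  show ?thesis
    unfolding cd_def[of g \<xi> "cd g \<eta> X" x] E by (simp add: cd_def chr_simps[OF x])
qed

lemma Rm_eq:
  assumes x: "x \<in> S"
  shows "Rm g x \<xi> \<eta> \<zeta> = der (\<lambda>y. chr g y \<eta> \<zeta>) x \<xi> + chr g x \<xi> (chr g x \<eta> \<zeta>)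
     - der (\<lambda>y. chr g y \<xi> \<zeta>) x \<eta> - chr g x \<eta> (chr g x \<xi> \<zeta>)"
  unfolding Rm_def cd_cd[OF x smooth_on_const] by (simp add: chr_simps[OF x])

text \<open>The second derivatives of \<open>X\<close> cancel by Schwarz's theorem and the first derivatives cancel in
  pairs, which leaves an expression in the value of \<open>X\<close> at \<open>x\<close>.\<close>

lemma cd_commutator:
  assumes x: "x \<in> S" and X: "smooth_on S X"
  shows "cd g \<xi> (cd g \<eta> X) x - cd g \<eta> (cd g \<xi> X) x = Rm g x \<xi> \<eta> (X x)"
  unfolding cd_cd[OF assms] Rm_eq[OF x] using der_der_commute[OF open_S x X, of \<xi> \<eta>] by simp

lemma Rm_linear:
  assumes x: "x \<in> S"
  shows "linear (Rm g x \<xi> \<eta>)" "linear (\<lambda>\<eta>. Rm g x \<xi> \<eta> \<zeta>)" "linear (\<lambda>\<xi>. Rm g x \<xi> \<eta> \<zeta>)"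
  unfolding Rm_eq[OF x]
  by (auto intro!: linearI simp: chr_simps[OF x] linear_add[OF der_chr_linear(1)[OF x]]
      linear_add[OF der_chr_linear(2)[OF x]] linear_scale[OF der_chr_linear(1)[OF x]]
      linear_scale[OF der_chr_linear(2)[OF x]] der_add_vec[OF chr_differentiable[OF x]]
      der_scaleR_vec[OF chr_differentiable[OF x]] algebra_simps)

lemma Rm_antisym: "Rm g x \<xi> \<eta> \<zeta> = - Rm g x \<eta> \<xi> \<zeta>"
  by (simp add: Rm_def)

text \<open>Both mixed second derivatives of \<open>g(\<zeta>, \<omega>)\<close>, computed with the metric connection, agree.\<close>

lemma Rm_skew:
  assumes x: "x \<in> S"
  shows "form (g x) (Rm g x \<xi> \<eta> \<zeta>) \<omega> = - form (g x) (Rm g x \<xi> \<eta> \<omega>) \<zeta>"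
proof -
  have sc: "smooth_on S (\<lambda>_. c)" for c :: "real ^ 'n" by (rule smooth_on_const)
  have dc: "(\<lambda>_. c) differentiable (at y)" for c :: "real ^ 'n" and y :: "real ^ 'n" by simp
  let ?c = "\<lambda>\<eta> \<zeta>. cd g \<eta> (\<lambda>_. \<zeta>)"
  have dcd: "?c \<eta> \<zeta> differentiable (at x)" for \<eta> \<zeta>
    by (rule smooth_on_differentiable[OF smooth_cd_const[OF sc] x])
  have dform: "(\<lambda>y. form (g y) (X y) (Y y)) differentiable (at x)"
    if "X differentiable (at x)" "Y differentiable (at x)" for X Y
    by (rule der_form(1)[OF diff_g[OF x] that])
  have "der (\<lambda>y. der (\<lambda>y. form (g y) \<zeta> \<omega>) y \<eta>) x \<xi>
      = form (g x) (cd g \<xi> (?c \<eta> \<zeta>) x) \<omega> + form (g x) (?c \<eta> \<zeta> x) (?c \<xi> \<omega> x)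
      + (form (g x) (?c \<xi> \<zeta> x) (?c \<eta> \<omega> x) + form (g x) \<zeta> (cd g \<xi> (?c \<eta> \<omega>) x))" for \<xi> \<eta>
  proof -
    have "der (\<lambda>y. der (\<lambda>y. form (g y) \<zeta> \<omega>) y \<eta>) x
        = der (\<lambda>y. form (g y) (?c \<eta> \<zeta> y) \<omega> + form (g y) \<zeta> (?c \<eta> \<omega> y)) x"
      by (rule der_cong[OF open_S x]) (rule der_form_cd[OF _ dc dc])
    then show ?thesis
      by (simp only: der_add[OF dform[OF dcd dc] dform[OF dc dcd]] der_form_cd[OF x dcd dc] der_form_cd[OF x dc dcd])
  qed
  moreover have "der (\<lambda>y. der (\<lambda>y. form (g y) \<zeta> \<omega>) y \<eta>) x \<xi> = der (\<lambda>y. der (\<lambda>y. form (g y) \<zeta> \<omega>) y \<xi>) x \<eta>"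
    by (intro der_der_commute[OF open_S x] smooth_on_form open_S smooth_g smooth_on_const)
  ultimately show ?thesis
    using form_commute[OF x, of "Rm g x \<xi> \<eta> \<omega>" \<zeta>] by (simp add: Rm_def)
qed

lemma Rm_Bianchi:
  assumes x: "x \<in> S"
  shows "Rm g x \<xi> \<eta> \<zeta> + Rm g x \<eta> \<zeta> \<xi> + Rm g x \<zeta> \<xi> \<eta> = 0"
proof -
  have "der (\<lambda>y. chr g y a b) x v = der (\<lambda>y. chr g y b a) x v" for a b v
    using der_cong[OF open_S x, of "\<lambda>y. chr g y a b" "\<lambda>y. chr g y b a"] chr_commute by simp
  from this[of \<xi> \<eta>] this[of \<eta> \<zeta>] this[of \<zeta> \<xi>] show ?thesis
    unfolding Rm_eq[OF x] using chr_commute[OF x, of \<xi> \<eta>] chr_commute[OF x, of \<eta> \<zeta>] chr_commute[OF x, of \<zeta> \<xi>]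
    by simp
qed

text \<open>The sum of the Bianchi identities for the four cyclic rotations of \<open>(a, b, c, d)\<close>, reduced by the two
  antisymmetries.\<close>

lemma Rm_pair_symmetric:
  assumes x: "x \<in> S"
  shows "form (g x) (Rm g x a b c) d = form (g x) (Rm g x c d a) b"
proof -
  let ?r = "\<lambda>a b c d. form (g x) (Rm g x a b c) d"
  have 1: "?r a b c d = - ?r b a c d" for a b c d by (subst Rm_antisym) simp
  have 2: "?r a b c d = - ?r a b d c" for a b c d by (rule Rm_skew[OF x])
  have 3: "?r a b c d + ?r b c a d + ?r c a b d = 0" for a b c d
    using arg_cong[OF Rm_Bianchi[OF x, of a b c], of "\<lambda>v. form (g x) v d"] by simp
  show ?thesis
    using 3[of a b c d] 3[of b c d a] 3[of c d a b] 3[of d a b c]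
      1[of c a b d] 1[of d b c a] 1[of a c d b] 1[of b d a c]
      2[of a b c d] 2[of b c a d] 2[of c a b d] 2[of c d a b] 2[of d a b c] 2[of b d a c] 2[of d b c a] 2[of a c d b]
      2[of b c d a] 2[of c d b a] 2[of d a c b] 2[of a b d c] 1[of d a b c] 1[of a d b c] 1[of d b a c] 1[of a c b d]
    by linarith
qed

lemma gradc_form: "x \<in> S \<Longrightarrow> h differentiable (at x) \<Longrightarrow> form (g x) (gradc g h x) \<zeta> = der h x \<zeta>"
  using linear_family_expand[OF linear_frechet_derivative, of h "at x" \<zeta>]
  by (simp add: gradc_def pos_form_inv_form[OF pos] inner_vec_def mult.commute)

lemma smooth_gradc: "smooth_on S h \<Longrightarrow> smooth_on S (gradc g h)"
  unfolding gradc_def[abs_def]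
  by (intro smooth_on_matrix_vector_mult smooth_on_vec_lambda smooth_on_matrix_inv open_S smooth_g pos smooth_on_der)

lemma smooth_divc: "smooth_on S X \<Longrightarrow> smooth_on S (divc g X)"
  unfolding divc_def[abs_def]
  by (intro smooth_on_sum smooth_on_nth open_S smooth_cd smooth_on_const finite)

lemma divc_onb:
  assumes "x \<in> S" "X differentiable (at x)" "onb (g x) e"
  shows "(\<Sum>i\<in>UNIV. form (g x) (cd g (e i) X x) (e i)) = divc g X x"
  unfolding divc_def by (rule onb_trace_linear[OF assms(3) pos[OF assms(1)] cd_linear[OF assms(1,2)]])

lemma cd2_bilinear:
  assumes x: "x \<in> S" and X: "smooth_on S X"
  shows "bilinear (cd2 g X x)"
proof -
  have d: "X differentiable (at y)" if "y \<in> S" for y by (rule smooth_on_differentiable[OF X that])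
  have dc: "cd g \<eta> X differentiable (at x)" for \<eta>
    by (rule smooth_on_differentiable[OF smooth_cd_const[OF X] x])
  have l: "linear (\<lambda>\<eta>. cd g \<eta> X y)" if "y \<in> S" for y by (rule cd_linear[OF that d[OF that]])
  have l2: "linear (\<lambda>\<eta>. cd g \<xi> (cd g \<eta> X) x)" for \<xi>
    unfolding cd_def[of _ _ "cd g _ X"]
    using linear_compose[OF l[OF x] chr_linear(1)[OF x]]
    by (intro linear_compose_add linear_der_family[OF open_S x, of "\<lambda>y \<eta>. cd g \<eta> X y"] l dc) (auto simp: o_def)
  have l3: "linear (\<lambda>\<eta>. cd g (chr g x \<xi> \<eta>) X x)" "linear (\<lambda>\<xi>. cd g (chr g x \<xi> \<eta>) X x)" for \<xi> \<eta>
    using linear_compose[OF chr_linear(1)[OF x] l[OF x]] linear_compose[OF chr_linear(2)[OF x] l[OF x]]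
    by (auto simp: o_def)
  show ?thesis
    unfolding bilinear_def cd2_def by (intro allI conjI linear_compose_sub l2 l3 cd_linear[OF x dc])
qed

context
  fixes h :: "real ^ 'n \<Rightarrow> real" and V
  assumes h: "smooth_on S h" and V: "smooth_on S V"
    and grad: "\<And>x \<zeta>. x \<in> S \<Longrightarrow> form (g x) (V x) \<zeta> = der h x \<zeta>"
begin

text \<open>Up to the symmetric Christoffel term both sides are a mixed second derivative of \<open>h\<close>.\<close>

lemma hessian_symmetric:
  assumes x: "x \<in> S"
  shows "form (g x) (cd g \<xi> V x) \<eta> = form (g x) (cd g \<eta> V x) \<xi>"
proof -
  have "form (g x) (cd g \<xi> V x) \<eta> + form (g x) (V x) (chr g x \<xi> \<eta>) = der (\<lambda>y. der h y \<eta>) x \<xi>" for \<xi> \<eta>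
  proof -
    have "der (\<lambda>y. der h y \<eta>) x = der (\<lambda>y. form (g y) (V y) \<eta>) x"
      by (rule der_cong[OF open_S x]) (simp add: grad)
    then show ?thesis
      using der_form_cd[OF x smooth_on_differentiable[OF V x], of "\<lambda>_. \<eta>" \<xi>] by (simp add: cd_def)
  qed
  from this[of \<xi> \<eta>] this[of \<eta> \<xi>] show ?thesis
    using der_der_commute[OF open_S x h, of \<xi> \<eta>] chr_commute[OF x, of \<xi> \<eta>] by simp
qed

lemma cd2_grad_symmetric:
  assumes x: "x \<in> S"
  shows "form (g x) (cd2 g V x \<xi> \<eta>) \<zeta> = form (g x) (cd2 g V x \<xi> \<zeta>) \<eta>"
proof -
  have dcd: "cd g \<eta> V differentiable (at x)" for \<eta>
    by (rule smooth_on_differentiable[OF smooth_cd_const[OF V] x])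
  have A: "der (\<lambda>y. form (g y) (cd g \<eta> V y) \<zeta>) x \<xi>
      = form (g x) (cd g \<xi> (cd g \<eta> V) x) \<zeta> + form (g x) (cd g \<eta> V x) (chr g x \<xi> \<zeta>)" for \<eta> \<zeta>
    using der_form_cd[OF x dcd, of "\<lambda>_. \<zeta>" \<eta> \<xi>] by (simp add: cd_def[of _ _ "\<lambda>_. \<zeta>"])
  have B: "der (\<lambda>y. form (g y) (cd g \<eta> V y) \<zeta>) x = der (\<lambda>y. form (g y) (cd g \<zeta> V y) \<eta>) x"
    by (rule der_cong[OF open_S x]) (rule hessian_symmetric)
  have "form (g x) (cd g \<xi> (cd g \<eta> V) x) \<zeta> + form (g x) (cd g \<eta> V x) (chr g x \<xi> \<zeta>)
      = form (g x) (cd g \<xi> (cd g \<zeta> V) x) \<eta> + form (g x) (cd g \<zeta> V x) (chr g x \<xi> \<eta>)"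
    using A[of \<eta> \<zeta>] A[of \<zeta> \<eta>] fun_cong[OF B, of \<xi>] by linarith
  then show ?thesis
    unfolding cd2_def
    by (simp add: hessian_symmetric[OF x, of \<eta> "chr g x \<xi> \<zeta>"] hessian_symmetric[OF x, of \<zeta> "chr g x \<xi> \<eta>"])
qed

text \<open>Bochner's formula: the rough Laplacian of a gradient field \<open>V\<close> is \<open>grad (div V) + Ricci V\<close>.
  By the symmetry of the second covariant derivative of a gradient the trace is moved to the last
  two slots at the price of one commutation, which produces the curvature.\<close>

lemma rough_laplacian_grad:
  assumes x: "x \<in> S" and e: "onb (g x) e"
  shows "form (g x) (\<Sum>i\<in>UNIV. cd2 g V x (e i) (e i)) \<zeta>
    = der (divc g V) x \<zeta> + form (g x) (\<Sum>i\<in>UNIV. Rm g x (V x) (e i) (e i)) \<zeta>"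
proof -
  have bil: "linear (cd2 g V x \<zeta>)" using cd2_bilinear[OF x V] by (simp add: bilinear_def)
  have dV: "V differentiable (at x)" by (rule smooth_on_differentiable[OF V x])
  have dcd: "cd g \<eta> V differentiable (at x)" for \<eta>
    by (rule smooth_on_differentiable[OF smooth_cd_const[OF V] x])
  have comm: "cd2 g V x \<xi> \<eta> = cd2 g V x \<eta> \<xi> + Rm g x \<xi> \<eta> (V x)" for \<xi> \<eta>
    using cd_commutator[OF x V, of \<xi> \<eta>] chr_commute[OF x, of \<xi> \<eta>] by (simp add: cd2_def algebra_simps)
  have "form (g x) (cd2 g V x (e i) (e i)) \<zeta>
      = form (g x) (cd2 g V x \<zeta> (e i)) (e i) + form (g x) (Rm g x (V x) (e i) (e i)) \<zeta>" for i
    using cd2_grad_symmetric[OF x, of "e i" "e i" \<zeta>] comm[of "e i" \<zeta>]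
      Rm_pair_symmetric[OF x, of "e i" \<zeta> "V x" "e i"] by simp
  then have "form (g x) (\<Sum>i\<in>UNIV. cd2 g V x (e i) (e i)) \<zeta>
      = (\<Sum>i\<in>UNIV. form (g x) (cd2 g V x \<zeta> (e i)) (e i)) + form (g x) (\<Sum>i\<in>UNIV. Rm g x (V x) (e i) (e i)) \<zeta>"
    by (simp add: form_sum sum.distrib)
  also have "(\<Sum>i\<in>UNIV. form (g x) (cd2 g V x \<zeta> (e i)) (e i)) = (\<Sum>k\<in>UNIV. cd2 g V x \<zeta> (axis k 1) $ k)"
    by (rule onb_trace_linear[OF e pos[OF x] bil])
  also have "\<dots> = (\<Sum>k\<in>UNIV. der (cd g (axis k 1) V) x \<zeta> $ k)
      + (\<Sum>k\<in>UNIV. chr g x \<zeta> (cd g (axis k 1) V x) $ k) - (\<Sum>k\<in>UNIV. cd g (chr g x \<zeta> (axis k 1)) V x $ k)"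
    by (simp add: cd2_def cd_def[of _ _ "cd g _ V"] sum.distrib sum_subtractf)
  also have "(\<Sum>k\<in>UNIV. chr g x \<zeta> (cd g (axis k 1) V x) $ k) = (\<Sum>k\<in>UNIV. cd g (chr g x \<zeta> (axis k 1)) V x $ k)"
    by (rule trace_mult_commute[OF chr_linear(1)[OF x] cd_linear[OF x dV]])
  also have "(\<Sum>k\<in>UNIV. der (cd g (axis k 1) V) x \<zeta> $ k) = der (divc g V) x \<zeta>"
    unfolding divc_def[abs_def]
    by (simp add: der_sum differentiable_nth dcd der_bounded_linear[OF bounded_linear_vec_nth dcd])
  finally show ?thesis by simp
qed

text \<open>By the symmetry of the Hessian, \<open>g(\<nabla>\<^sub>\<zeta> V, V) = g(\<nabla>\<^sub>V V, \<zeta>)\<close>.\<close>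

lemma der_grad_norm:
  assumes x: "x \<in> S"
  shows "der (\<lambda>y. form (g y) (V y) (V y)) x \<zeta> = 2 * form (g x) (cd g (V x) V x) \<zeta>"
  using der_form_cd[OF x smooth_on_differentiable[OF V x] smooth_on_differentiable[OF V x], of \<zeta>]
    hessian_symmetric[OF x, of \<zeta> "V x"] form_commute[OF x, of "V x"] by simp

end

end


text \<open>The transformation law of the Christoffel symbols. Both sides are compared with all vectors
  \<open>der \<psi> x \<zeta>\<close> by means of the Koszul formula, using the derivative of the isometry equation.\<close>

lemma isometry_chr:
  assumes S: "coord_metric S g" and T: "coord_metric T g'" and U: "open U" "U \<subseteq> S"
    and \<psi>: "smooth_on U \<psi>" "\<psi> ` U \<subseteq> T"
    and iso: "\<And>y \<xi> \<eta>. y \<in> U \<Longrightarrow> form (g y) \<xi> \<eta> = form (g' (\<psi> y)) (der \<psi> y \<xi>) (der \<psi> y \<eta>)"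
    and x: "x \<in> U" and surj: "surj (der \<psi> x)"
  shows "der \<psi> x (chr g x \<xi> \<eta>)
    = der (\<lambda>y. der \<psi> y \<eta>) x \<xi> + chr g' (\<psi> x) (der \<psi> x \<xi>) (der \<psi> x \<eta>)"
proof -
  interpret S: coord_metric S g by fact
  interpret T: coord_metric T g' by fact
  have xS: "x \<in> S" and xT: "\<psi> x \<in> T" using x U \<psi> by auto
  have d\<psi>: "\<psi> differentiable (at x)" by (rule smooth_on_differentiable[OF \<psi>(1) x])
  have dd: "(\<lambda>y. der \<psi> y \<xi>) differentiable (at x)" for \<xi>
    by (rule smooth_on_differentiable[OF smooth_on_der[OF \<psi>(1)] x])
  have dg: "(\<lambda>y. g' (\<psi> y)) differentiable (at x)"
    by (rule differentiable_compose_at[OF d\<psi> T.diff_g[OF xT]])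
  let ?D = "der \<psi> x" and ?H = "\<lambda>\<xi> \<zeta>. der (\<lambda>y. der \<psi> y \<xi>) x \<zeta>" and ?G = "g' (\<psi> x)"
  have H: "?H \<xi> \<zeta> = ?H \<zeta> \<xi>" for \<xi> \<zeta> by (rule der_der_commute[OF U(1) x \<psi>(1)])
  have fc: "form ?G a b = form ?G b a" for a b by (rule T.form_commute[OF xT])
  have dform: "form (der g x \<zeta>) \<xi> \<eta> = form (der g' (\<psi> x) (?D \<zeta>)) (?D \<xi>) (?D \<eta>)
      + form ?G (?H \<xi> \<zeta>) (?D \<eta>) + form ?G (?D \<xi>) (?H \<eta> \<zeta>)" for \<xi> \<eta> \<zeta>
  proof -
    have "der (\<lambda>y. form (g y) \<xi> \<eta>) x = der (\<lambda>y. form (g' (\<psi> y)) (der \<psi> y \<xi>) (der \<psi> y \<eta>)) x"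
      by (rule der_cong[OF U(1) x iso])
    from fun_cong[OF this, of \<zeta>] show ?thesis
      by (simp only: der_bounded_linear[OF bounded_linear_form S.diff_g[OF xS]] der_form(2)[OF dg dd dd]
          der_compose[OF d\<psi> T.diff_g[OF xT]])
  qed
  show ?thesis
  proof (rule T.form_cancel[OF xT])
    fix v
    obtain \<zeta> where v: "v = ?D \<zeta>" using surj by (metis surjD)
    have "2 * form ?G (?D (chr g x \<xi> \<eta>)) v = koszul g x \<xi> \<eta> \<zeta>"
      unfolding v iso[OF x, symmetric] by (rule S.chr_koszul[OF xS])
    also have "\<dots> = koszul g' (\<psi> x) (?D \<xi>) (?D \<eta>) v + 2 * form ?G (?H \<eta> \<xi>) v"
      unfolding koszul_def dform v
      using H[of \<xi> \<eta>] H[of \<xi> \<zeta>] H[of \<eta> \<zeta>] fc[of "?H \<eta> \<zeta>" "?D \<xi>"] fc[of "?H \<xi> \<zeta>" "?D \<eta>"] by simp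
    also have "\<dots> = 2 * form ?G (?H \<eta> \<xi> + chr g' (\<psi> x) (?D \<xi>) (?D \<eta>)) v"
      using T.chr_koszul[OF xT, of "?D \<xi>" "?D \<eta>" v] by simp
    finally show "form ?G (?D (chr g x \<xi> \<eta>)) v = form ?G (?H \<eta> \<xi> + chr g' (\<psi> x) (?D \<xi>) (?D \<eta>)) v"
      by simp
  qed
qed


section \<open>Tangent vectors and fields in charts\<close>

abbreviation img :: "('a, 'n::finite) chart \<Rightarrow> (real ^ 'n) set" where
  "img c \<equiv> cmap c ` cdom c"

abbreviation overlap :: "('a, 'n::finite) chart \<Rightarrow> ('a, 'n) chart \<Rightarrow> (real ^ 'n) set" where
  "overlap c d \<equiv> cmap c ` (cdom c \<inter> cdom d)"

abbreviation transition :: "('a, 'n::finite) chart \<Rightarrow> ('a, 'n) chart \<Rightarrow> real ^ 'n \<Rightarrow> real ^ 'n" where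
  "transition c d \<equiv> \<lambda>x. cmap d (cinv c x)"

text \<open>The part of the structure that the local calculus uses; it is shared by a manifold and its
  tangent bundle.\<close>

locale smooth_atlas =
  fixes M :: "('a, 'n::finite, 'z) smooth_mfd_scheme"
  assumes chart_open: "c \<in> atlas M \<Longrightarrow> openin (topo M) (cdom c)"
    and chart_inj: "c \<in> atlas M \<Longrightarrow> inj_on (cmap c) (cdom c)"
    and chart_image_open: "c \<in> atlas M \<Longrightarrow> openin (topo M) U \<Longrightarrow> open (cmap c ` (U \<inter> cdom c))"
    and chart_cover: "(\<Union>c\<in>atlas M. cdom c) = points M"
    and transition_smooth: "c \<in> atlas M \<Longrightarrow> d \<in> atlas M \<Longrightarrow> smooth_on (overlap c d) (transition c d)"
begin

lemma chart_at: "p \<in> points M \<Longrightarrow> chart_at M p \<in> charts_at M p"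
proof -
  assume "p \<in> points M"
  then obtain c where "c \<in> charts_at M p" using chart_cover unfolding charts_at_def by blast
  then show ?thesis unfolding chart_at_def by (rule someI)
qed

lemma charts_atD: "c \<in> charts_at M p \<Longrightarrow> c \<in> atlas M" "c \<in> charts_at M p \<Longrightarrow> p \<in> cdom c"
  by (auto simp: charts_at_def)

lemma charts_at_points: "c \<in> charts_at M p \<Longrightarrow> p \<in> points M"
  using chart_cover by (auto simp: charts_at_def)

lemma cinv_cmap: "c \<in> atlas M \<Longrightarrow> p \<in> cdom c \<Longrightarrow> cinv c (cmap c p) = p"
  by (simp add: cinv_def chart_inj inv_into_f_f)

lemma cmap_cinv: "x \<in> img c \<Longrightarrow> cmap c (cinv c x) = x" "x \<in> img c \<Longrightarrow> cinv c x \<in> cdom c"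
  by (simp_all add: cinv_def f_inv_into_f inv_into_into)

lemma charts_at_cinv: "c \<in> atlas M \<Longrightarrow> x \<in> img c \<Longrightarrow> c \<in> charts_at M (cinv c x)"
  by (simp add: charts_at_def cmap_cinv)

lemma open_img: "c \<in> atlas M \<Longrightarrow> open (img c)"
  using chart_image_open[OF _ chart_open] by fastforce

lemma open_overlap: "c \<in> atlas M \<Longrightarrow> d \<in> atlas M \<Longrightarrow> open (overlap c d)"
  using chart_image_open[OF _ chart_open, of c d] by (simp add: Int_commute)

lemma in_overlap: "c \<in> charts_at M p \<Longrightarrow> d \<in> charts_at M p \<Longrightarrow> cmap c p \<in> overlap c d"
  by (auto simp: charts_at_def)

lemma in_img: "c \<in> charts_at M p \<Longrightarrow> cmap c p \<in> img c"
  by (auto simp: charts_at_def)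

lemma cinv_cmap_at: "c \<in> charts_at M p \<Longrightarrow> cinv c (cmap c p) = p"
  by (simp add: charts_at_def cinv_cmap)

lemma transition_differentiable:
  "c \<in> charts_at M p \<Longrightarrow> d \<in> charts_at M p \<Longrightarrow> transition c d differentiable (at (cmap c p))"
  using smooth_on_differentiable[OF transition_smooth in_overlap] by (auto simp: charts_at_def)

lemma transition_overlap:
  assumes "c \<in> atlas M" "d \<in> atlas M" "x \<in> overlap c d"
  shows "transition c d x \<in> overlap d c" "cinv d (transition c d x) = cinv c x" "cinv c x \<in> cdom c \<inter> cdom d"
  using assms by (auto simp: cinv_cmap)

lemma chart_change_near:
  assumes "c \<in> charts_at M p" "d \<in> charts_at M p"
  shows "der (\<lambda>x. h (cinv c x)) (cmap c p) = der (\<lambda>x. h (cinv d (transition c d x))) (cmap c p)"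
    and "(\<lambda>x. h (cinv c x)) differentiable (at (cmap c p))
      \<longleftrightarrow> (\<lambda>x. h (cinv d (transition c d x))) differentiable (at (cmap c p))"
proof -
  have o: "open (overlap c d)" and i: "cmap c p \<in> overlap c d"
    using assms open_overlap in_overlap by (auto simp: charts_at_def)
  have e: "h (cinv c x) = h (cinv d (transition c d x))" if "x \<in> overlap c d" for x
    using that assms by (auto simp: charts_at_def cinv_cmap)
  show "der (\<lambda>x. h (cinv c x)) (cmap c p) = der (\<lambda>x. h (cinv d (transition c d x))) (cmap c p)"
    using e by (rule der_cong[OF o i])
  show "(\<lambda>x. h (cinv c x)) differentiable (at (cmap c p))
      \<longleftrightarrow> (\<lambda>x. h (cinv d (transition c d x))) differentiable (at (cmap c p))"
    using e by (rule differentiable_cong_open[OF o i])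
qed

lemma chart_change_der:
  assumes "c \<in> charts_at M p" "d \<in> charts_at M p" "(\<lambda>y. h (cinv d y)) differentiable (at (cmap d p))"
  shows "(\<lambda>x. h (cinv c x)) differentiable (at (cmap c p))"
    and "der (\<lambda>x. h (cinv c x)) (cmap c p) \<xi>
      = der (\<lambda>y. h (cinv d y)) (cmap d p) (der (transition c d) (cmap c p) \<xi>)"
proof -
  have t: "transition c d differentiable (at (cmap c p))" by (rule transition_differentiable[OF assms(1,2)])
  have h: "(\<lambda>y. h (cinv d y)) differentiable (at (transition c d (cmap c p)))"
    using assms(3) by (simp add: cinv_cmap_at[OF assms(1)])
  show "(\<lambda>x. h (cinv c x)) differentiable (at (cmap c p))"
    unfolding chart_change_near(2)[OF assms(1,2)] by (rule differentiable_compose_at[OF t h])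
  show "der (\<lambda>x. h (cinv c x)) (cmap c p) \<xi>
      = der (\<lambda>y. h (cinv d y)) (cmap d p) (der (transition c d) (cmap c p) \<xi>)"
    unfolding chart_change_near(1)[OF assms(1,2)] der_compose[OF t h] by (simp add: cinv_cmap_at[OF assms(1)])
qed

lemma transition_chain:
  assumes "c \<in> charts_at M p" "d \<in> charts_at M p" "e \<in> charts_at M p"
  shows "der (transition d e) (cmap d p) (der (transition c d) (cmap c p) \<xi>) = der (transition c e) (cmap c p) \<xi>"
  using chart_change_der(2)[OF assms(1,2), of "cmap e"] transition_differentiable[OF assms(2,3)] by simp

lemma transition_self:
  assumes "c \<in> charts_at M p"
  shows "der (transition c c) (cmap c p) \<xi> = \<xi>"
proof -
  have "der (transition c c) (cmap c p) = der (\<lambda>x. x) (cmap c p)"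
    using open_img[OF charts_atD(1)[OF assms]] in_img[OF assms] by (rule der_cong) (rule cmap_cinv(1))
  then show ?thesis by simp
qed

lemma transition_surj:
  assumes "c \<in> charts_at M p" "d \<in> charts_at M p"
  shows "surj (der (transition c d) (cmap c p))"
proof (rule surjI)
  show "der (transition c d) (cmap c p) (der (transition d c) (cmap d p) \<xi>) = \<xi>" for \<xi>
    using transition_chain[OF assms(2,1,2)] transition_self[OF assms(2)] by simp
qed

lemma tangent_change:
  "v \<in> tangent_space M p \<Longrightarrow> c \<in> charts_at M p \<Longrightarrow> d \<in> charts_at M p \<Longrightarrow>
    der (transition c d) (cmap c p) (v c) = v d"
  unfolding tangent_space_def by (drule CollectD, drule conjunct1, drule bspec, assumption, drule bspec, assumption) (rule sym)

lemma tangent_outside: "v \<in> tangent_space M p \<Longrightarrow> d \<notin> charts_at M p \<Longrightarrow> v d = 0"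
  unfolding tangent_space_def by blast

lemma tangent_of_at: "c \<in> charts_at M p \<Longrightarrow> tangent_of M p c \<xi> c = \<xi>"
  by (simp add: tangent_of_def transition_self)

lemma tangent_of_other:
  "d \<in> charts_at M p \<Longrightarrow> tangent_of M p c \<xi> d = der (transition c d) (cmap c p) \<xi>"
  by (simp add: tangent_of_def)

lemma tangent_of_tangent: "c \<in> charts_at M p \<Longrightarrow> tangent_of M p c \<xi> \<in> tangent_space M p"
  by (auto simp: tangent_space_def tangent_of_def transition_chain)

lemma tangent_of_component: "v \<in> tangent_space M p \<Longrightarrow> c \<in> charts_at M p \<Longrightarrow> tangent_of M p c (v c) = v"
proof (rule ext)
  fix d assume v: "v \<in> tangent_space M p" and c: "c \<in> charts_at M p"
  show "tangent_of M p c (v c) d = v d"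
  proof (cases "d \<in> charts_at M p")
    case True
    show ?thesis unfolding tangent_of_other[OF True] by (rule tangent_change[OF v c True])
  next
    case False
    then show ?thesis using tangent_outside[OF v False] by (simp add: tangent_of_def)
  qed
qed

lemma tangent_eqI:
  assumes "u \<in> tangent_space M p" "v \<in> tangent_space M p" "c \<in> charts_at M p" "u c = v c"
  shows "u = v"
  by (metis tangent_of_component[OF assms(1,3)] tangent_of_component[OF assms(2,3)] assms(4))

lemma tangent_of_combination:
  assumes "c \<in> charts_at M p"
  shows "tangent_of M p c (\<xi> + a *\<^sub>R \<eta>) = (\<lambda>d. tangent_of M p c \<xi> d + a *\<^sub>R tangent_of M p c \<eta> d)"
proof (rule ext)
  show "tangent_of M p c (\<xi> + a *\<^sub>R \<eta>) d = tangent_of M p c \<xi> d + a *\<^sub>R tangent_of M p c \<eta> d" for d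
    by (cases "d \<in> charts_at M p")
      (simp_all add: tangent_of_def der_add_vec der_scaleR_vec transition_differentiable[OF assms])
qed

lemma tangent_zero: "(\<lambda>_. 0) \<in> tangent_space M p"
  unfolding tangent_space_def
  by (intro CollectI conjI ballI allI impI refl der_zero_vec[symmetric] transition_differentiable)

lemma tangent_combination:
  assumes "u \<in> tangent_space M p" "v \<in> tangent_space M p"
  shows "(\<lambda>d. u d + a *\<^sub>R v d) \<in> tangent_space M p"
proof (cases "charts_at M p = {}")
  case True
  then have "(\<lambda>d. u d + a *\<^sub>R v d) = (\<lambda>_. 0)" using assms[THEN tangent_outside] by auto
  then show ?thesis using tangent_zero by simp
next
  case False
  then obtain c where c: "c \<in> charts_at M p" by auto
  show ?thesis
    using tangent_of_tangent[OF c, of "u c + a *\<^sub>R v c"]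
    unfolding tangent_of_combination[OF c] tangent_of_component[OF assms(1) c] tangent_of_component[OF assms(2) c] .
qed

text \<open>The chain rule: the derivative of the transition map that changes the components of \<open>v\<close> is the one
  that appears when \<open>h\<close> is rewritten in the other coordinates.\<close>

lemma dir_chart:
  assumes c: "c \<in> charts_at M p" and v: "v \<in> tangent_space M p"
    and h: "(\<lambda>x. h (cinv c x)) differentiable (at (cmap c p))"
  shows "dir M p v h = der (\<lambda>x. h (cinv c x)) (cmap c p) (v c)"
proof -
  have c0: "chart_at M p \<in> charts_at M p" by (rule chart_at[OF charts_at_points[OF c]])
  show ?thesis
    unfolding dir_def Let_def chart_change_der(2)[OF c0 c h] tangent_change[OF v c0 c] ..
qed

lemma smooth_field_at:
  assumes U: "smooth_field_on M U X" "openin (topo M) U" "p \<in> U" and c: "c \<in> charts_at M p"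
  shows "(\<lambda>x. X (cinv c x) c) differentiable (at (cmap c p))"
proof -
  have "smooth_on (cmap c ` (U \<inter> cdom c)) (\<lambda>x. X (cinv c x) c)"
    using U(1) charts_atD(1)[OF c] by (simp add: smooth_field_on_def)
  then show ?thesis by (rule smooth_on_differentiable) (use U(3) charts_atD(2)[OF c] in auto)
qed

text \<open>A field with smooth components in one chart is smooth, as its components in another chart arise by
  the derivative of the smooth transition map.\<close>

lemma smooth_field_of_components:
  assumes c: "c \<in> atlas M" and F: "smooth_on (img c) F"
  shows "smooth_field_on M (cdom c) (\<lambda>q. tangent_of M q c (F (cmap c q)))"
  unfolding smooth_field_on_def
proof (intro conjI ballI)
  show "tangent_of M q c (F (cmap c q)) \<in> tangent_space M q" if "q \<in> cdom c" for q
    using that c by (intro tangent_of_tangent) (simp add: charts_at_def)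
  fix d assume d: "d \<in> atlas M"
  have o: "open (overlap c d)" "open (overlap d c)" using open_overlap c d by auto
  have "smooth_on (overlap c d) (\<lambda>z. der (transition c d) z (F z))"
    using transition_smooth[OF c d] smooth_on_subset[OF F, of "overlap c d"]
    by (intro smooth_on_der_field o) auto
  then have "smooth_on (overlap d c) (\<lambda>y. der (transition c d) (transition d c y) (F (transition d c y)))"
    using transition_overlap(1)[OF d c] by (intro smooth_on_compose[OF o(2,1) transition_smooth[OF d c]]) auto
  then have "smooth_on (overlap d c) (\<lambda>y. tangent_of M (cinv d y) c (F (cmap c (cinv d y))) d)"
    by (rule smooth_on_cong[THEN iffD1, OF o(2), rotated])
      (use d in \<open>auto simp: tangent_of_other charts_at_def cinv_cmap\<close>)
  then show "smooth_on (cmap d ` (cdom c \<inter> cdom d)) (\<lambda>x. tangent_of M (cinv d x) c (F (cmap c (cinv d x))) d)"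
    by (simp add: Int_commute)
qed

end


section \<open>The Levi-Civita connection in charts\<close>

locale riem_atlas = smooth_atlas M for M :: "('a, 'n::finite, 'z) riem_mfd_scheme" +
  assumes riem_bilinear: "p \<in> points M \<Longrightarrow> tangent_bilinear M p (riem M p)"
    and riem_symmetric: "p \<in> points M \<Longrightarrow> tangent_symmetric M p (riem M p)"
    and riem_pos: "p \<in> points M \<Longrightarrow> v \<in> tangent_space M p \<Longrightarrow> v \<noteq> (\<lambda>_. 0) \<Longrightarrow> riem M p v v > 0"
    and smooth_metric: "c \<in> atlas M \<Longrightarrow> smooth_on (img c) (metric_matrix M c)"
begin

lemma riem_tangent_of:
  assumes c: "c \<in> charts_at M p"
  shows "riem M p (tangent_of M p c \<xi>) (tangent_of M p c \<eta>) = form (metric_matrix M c (cmap c p)) \<xi> \<eta>"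
proof -
  let ?T = "tangent_of M p c"
  have B: "riem M p (?T (\<xi> + a *\<^sub>R \<eta>)) (?T \<zeta>) = riem M p (?T \<xi>) (?T \<zeta>) + a * riem M p (?T \<eta>) (?T \<zeta>)"
    "riem M p (?T \<zeta>) (?T (\<xi> + a *\<^sub>R \<eta>)) = riem M p (?T \<zeta>) (?T \<xi>) + a * riem M p (?T \<zeta>) (?T \<eta>)" for \<xi> \<eta> \<zeta> a
    using riem_bilinear[OF charts_at_points[OF c]] tangent_of_tangent[OF c]
    unfolding tangent_bilinear_def tangent_of_combination[OF c] by blast+
  have z: "riem M p (?T 0) (?T \<zeta>) = 0" "riem M p (?T \<zeta>) (?T 0) = 0" for \<zeta>
    using B(1)[of 0 1 0 \<zeta>] B(2)[of \<zeta> 0 1 0] by simp_all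
  have l: "linear (\<lambda>\<xi>. riem M p (?T \<xi>) (?T \<eta>))" "linear (\<lambda>\<eta>. riem M p (?T \<xi>) (?T \<eta>))" for \<xi> \<eta>
    using B(1)[of _ 1] B(2)[of _ _ 1] B(1)[of 0] B(2)[of _ 0] z by (auto intro!: linearI)
  have ax: "riem M p (?T (axis i 1)) (?T (axis j 1)) = form (metric_matrix M c (cmap c p)) (axis i 1) (axis j 1)" for i j
    by (simp add: form_axis metric_matrix_def cinv_cmap_at[OF c])
  show ?thesis
    unfolding linear_family_expand[OF l(1), of \<xi>] linear_family_expand[OF form_linear(2), of _ \<xi>]
    unfolding linear_family_expand[OF l(2), of _ \<eta>] linear_family_expand[OF form_linear(1), of _ _ \<eta>] ax ..
qed

lemma riem_chart:
  assumes "c \<in> charts_at M p" "u \<in> tangent_space M p" "v \<in> tangent_space M p"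
  shows "riem M p u v = form (metric_matrix M c (cmap c p)) (u c) (v c)"
  using riem_tangent_of[OF assms(1), of "u c" "v c"]
  unfolding tangent_of_component[OF assms(2,1)] tangent_of_component[OF assms(3,1)] .

lemma coord_metric_chart:
  assumes c: "c \<in> atlas M"
  shows "coord_metric (img c) (metric_matrix M c)"
proof
  show "open (img c)" "smooth_on (img c) (metric_matrix M c)" using c by (auto intro: open_img smooth_metric)
  fix x assume x: "x \<in> img c"
  let ?p = "cinv c x"
  have cp: "c \<in> charts_at M ?p" and cx: "cmap c ?p = x" using c x by (auto simp: charts_at_cinv cmap_cinv)
  note P = charts_at_points[OF cp] and T = tangent_of_tangent[OF cp] and R = riem_tangent_of[OF cp, unfolded cx]
  show "pos_form (metric_matrix M c x)"
    unfolding pos_form_def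
  proof (intro conjI allI impI)
    show "form (metric_matrix M c x) u v = form (metric_matrix M c x) v u" for u v
      using riem_symmetric[OF P] T unfolding R[symmetric] tangent_symmetric_def by blast
    fix v :: "real ^ 'n" assume "v \<noteq> 0"
    then have "tangent_of M ?p c v \<noteq> (\<lambda>_. 0)" using tangent_of_at[OF cp, of v] by metis
    then show "form (metric_matrix M c x) v v > 0" using riem_pos[OF P T] by (simp add: R)
  qed
qed

lemma metric_transition:
  assumes c: "c \<in> atlas M" and d: "d \<in> atlas M" and x: "x \<in> overlap c d"
  shows "form (metric_matrix M c x) \<xi> \<eta>
    = form (metric_matrix M d (transition c d x)) (der (transition c d) x \<xi>) (der (transition c d) x \<eta>)"
proof -
  let ?p = "cinv c x"
  have cp: "c \<in> charts_at M ?p" "d \<in> charts_at M ?p" and cx: "cmap c ?p = x"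
    using c d x by (auto simp: charts_at_def cinv_cmap)
  show ?thesis
    using riem_tangent_of[OF cp(1), of \<xi> \<eta>]
      riem_chart[OF cp(2) tangent_of_tangent[OF cp(1)] tangent_of_tangent[OF cp(1)], of \<xi> \<eta>]
    by (simp add: cx tangent_of_other[OF cp(2)])
qed

lemma chr_transition:
  assumes c: "c \<in> charts_at M p" and d: "d \<in> charts_at M p"
  shows "der (transition c d) (cmap c p) (chr (metric_matrix M c) (cmap c p) \<xi> \<eta>)
    = der (\<lambda>y. der (transition c d) y \<eta>) (cmap c p) \<xi>
      + chr (metric_matrix M d) (cmap d p) (der (transition c d) (cmap c p) \<xi>) (der (transition c d) (cmap c p) \<eta>)"
proof -
  have a: "c \<in> atlas M" "d \<in> atlas M" using c d by (auto simp: charts_at_def)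
  have "transition c d ` overlap c d \<subseteq> img d" using transition_overlap(1)[OF a] by blast
  from isometry_chr[OF coord_metric_chart[OF a(1)] coord_metric_chart[OF a(2)] open_overlap[OF a] _
      transition_smooth[OF a] this metric_transition[OF a] in_overlap[OF c d] transition_surj[OF c d]]
  show ?thesis by (simp add: cinv_cmap_at[OF c] image_mono)
qed

lemma christoffel_term_chart:
  "c \<in> charts_at M p \<Longrightarrow> christoffel_term M c (cmap c p) \<xi> \<eta> = chr (metric_matrix M c) (cmap c p) \<xi> \<eta>"
  using smooth_on_differentiable[OF smooth_metric in_img] by (intro christoffel_term_eq_chr) (auto simp: charts_at_def)

lemma cov_chart:
  assumes c: "c \<in> charts_at M p" and v: "v \<in> tangent_space M p"
    and Y: "(\<lambda>x. Y (cinv c x) c) differentiable (at (cmap c p))"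
  shows "cov M p v Y c = cd (metric_matrix M c) (v c) (\<lambda>x. Y (cinv c x) c) (cmap c p)"
  using c dir_chart[OF c v, of "\<lambda>q. Y q c"] Y
  by (simp add: cov_def cd_def christoffel_term_chart cinv_cmap_at)

text \<open>Differentiating the transformation rule of \<open>Y\<close> produces a second derivative of the transition map,
  which the transformation law of the Christoffel symbols cancels.\<close>

lemma cov_tangent:
  assumes v: "v \<in> tangent_space M p" and U: "openin (topo M) U" "p \<in> U" and Y: "smooth_field_on M U Y"
  shows "cov M p v Y \<in> tangent_space M p"
  unfolding tangent_space_def
proof (intro CollectI conjI allI impI ballI)
  show "cov M p v Y d = 0" if "d \<notin> charts_at M p" for d using that by (simp add: cov_def)
next
  fix c d assume c: "c \<in> charts_at M p" and d: "d \<in> charts_at M p"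
  let ?\<psi> = "transition c d" and ?x = "cmap c p"
  let ?Yc = "\<lambda>x. Y (cinv c x) c" and ?Yd = "\<lambda>x. Y (cinv d x) d"
  note cd = charts_atD(1)[OF c] charts_atD(1)[OF d]
  have dY: "?Yc differentiable (at ?x)" "?Yd differentiable (at (cmap d p))"
    using smooth_field_at[OF Y U] c d by blast+
  have d\<psi>: "?\<psi> differentiable (at ?x)" by (rule transition_differentiable[OF c d])
  let ?W = "cmap c ` (U \<inter> cdom d \<inter> cdom c)"
  have W: "open ?W" "?x \<in> ?W"
    using chart_image_open[OF cd(1), of "U \<inter> cdom d"] chart_open[OF cd(2)] U c d by (auto simp: charts_at_def)
  have lin: "linear (der ?\<psi> x)" if "x \<in> ?W" for x
    using that by (intro linear_frechet_derivative smooth_on_differentiable[OF transition_smooth[OF cd]]) auto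
  have dd: "(\<lambda>x. der ?\<psi> x \<xi>) differentiable (at ?x)" for \<xi>
    by (rule smooth_on_differentiable[OF smooth_on_der[OF transition_smooth[OF cd]] in_overlap[OF c d]])
  have "der (\<lambda>x. ?Yd (?\<psi> x)) ?x = der (\<lambda>x. der ?\<psi> x (?Yc x)) ?x"
  proof (rule der_cong[OF W])
    fix x assume x: "x \<in> ?W"
    then have q: "cinv c x \<in> U" "c \<in> charts_at M (cinv c x)" "d \<in> charts_at M (cinv c x)" "cmap c (cinv c x) = x"
      using cd by (auto simp: charts_at_def cinv_cmap)
    have "Y (cinv c x) \<in> tangent_space M (cinv c x)" using Y q by (simp add: smooth_field_on_def)
    from tangent_change[OF this q(2,3)] show "?Yd (?\<psi> x) = der ?\<psi> x (?Yc x)"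
      by (simp add: q(4) cinv_cmap_at[OF q(3)])
  qed
  from fun_cong[OF this, of "v c"]
  have "der ?Yd (cmap d p) (der ?\<psi> ?x (v c)) = der (\<lambda>x. der ?\<psi> x (?Yc x)) ?x (v c)"
    using der_compose[of ?\<psi> ?x ?Yd "v c"] d\<psi> dY(2) by (simp add: cinv_cmap_at[OF c])
  also have "\<dots> = der (\<lambda>x. der ?\<psi> x (?Yc ?x)) ?x (v c) + der ?\<psi> ?x (der ?Yc ?x (v c))"
    by (rule differentiable_linear_family(2)[OF W lin dd dY(1)])
  finally have 1: "der ?Yd (cmap d p) (v d) = der (\<lambda>x. der ?\<psi> x (Y p c)) ?x (v c) + der ?\<psi> ?x (der ?Yc ?x (v c))"
    by (simp add: tangent_change[OF v c d] cinv_cmap_at[OF c])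
  have Yp: "Y p \<in> tangent_space M p" using Y U by (simp add: smooth_field_on_def)
  show "cov M p v Y d = der ?\<psi> ?x (cov M p v Y c)"
    unfolding cov_chart[OF c v, of Y, OF dY(1)] cov_chart[OF d v, of Y, OF dY(2)] cd_def der_add_vec[OF d\<psi>] 1
    using chr_transition[OF c d, of "v c" "Y p c"]
    by (simp add: cinv_cmap_at[OF c] cinv_cmap_at[OF d] tangent_change[OF v c d] tangent_change[OF Yp c d])
qed

lemma frame_at:
  assumes "p \<in> points M"
  shows "orthonormal_frame M p (frame_at M p)"
proof -
  obtain c where c: "c \<in> charts_at M p" using chart_at[OF assms] by blast
  interpret coord_metric "img c" "metric_matrix M c" by (rule coord_metric_chart[OF charts_atD(1)[OF c]])
  obtain e where e: "\<And>i. smooth_on (img c) (e i)" "\<And>x. x \<in> img c \<Longrightarrow> onb (metric_matrix M c x) (\<lambda>i. e i x)"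
    using smooth_orthonormal_frame_exists[OF open_S smooth_g pos] by blast
  let ?E = "\<lambda>i q. tangent_of M q c (e i (cmap c q))"
  have "orthonormal_frame M p ?E"
    unfolding orthonormal_frame_def
  proof (intro exI[of _ "cdom c"] conjI allI ballI)
    show "openin (topo M) (cdom c)" "p \<in> cdom c" using chart_open charts_atD[OF c] by auto
    show "smooth_field_on M (cdom c) (?E i)" for i by (rule smooth_field_of_components[OF charts_atD(1)[OF c] e(1)])
    fix q i j assume "q \<in> cdom c"
    then have "c \<in> charts_at M q" using charts_atD(1)[OF c] by (simp add: charts_at_def)
    from riem_tangent_of[OF this] e(2)[OF in_img[OF this]]
    show "riem M q (?E i q) (?E j q) = (if i = j then 1 else 0)" by (simp add: onb_def)
  qed
  then show ?thesis unfolding frame_at_def by (rule someI[of "orthonormal_frame M p"])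
qed

lemma orthonormal_frameE:
  assumes "orthonormal_frame M p e"
  obtains U where "openin (topo M) U" "p \<in> U" "\<And>i. smooth_field_on M U (e i)"
    "\<And>q i. q \<in> U \<Longrightarrow> e i q \<in> tangent_space M q"
    "\<And>q c. q \<in> U \<Longrightarrow> c \<in> charts_at M q \<Longrightarrow> onb (metric_matrix M c (cmap c q)) (\<lambda>i. e i q c)"
proof -
  obtain U where U: "openin (topo M) U" "p \<in> U" "\<And>i. smooth_field_on M U (e i)"
    "\<And>q i j. q \<in> U \<Longrightarrow> riem M q (e i q) (e j q) = (if i = j then 1 else 0)"
    using assms unfolding orthonormal_frame_def by blast
  have t: "e i q \<in> tangent_space M q" if "q \<in> U" for q i
    using U(3) that by (simp add: smooth_field_on_def)
  show ?thesis
  proof (rule that[OF U(1-3) t])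
    show "onb (metric_matrix M c (cmap c q)) (\<lambda>i. e i q c)" if "q \<in> U" "c \<in> charts_at M q" for q c
      unfolding onb_def using U(4)[OF that(1)] riem_chart[OF that(2) t t] that(1) by metis
  qed
qed

end


section \<open>Gradient, Laplacian and Ricci curvature in charts\<close>

lemma cd_cong:
  assumes "open S" "x \<in> S" "\<And>y. y \<in> S \<Longrightarrow> X y = Y y"
  shows "cd g \<xi> X x = cd g \<xi> Y x"
  using der_cong[OF assms(1-3)] assms(2,3) by (simp add: cd_def)

lemma gradc_cong:
  assumes "open S" "x \<in> S" "\<And>y. y \<in> S \<Longrightarrow> h y = k y"
  shows "gradc g h x = gradc g k x"
  using der_cong[OF assms] by (simp add: gradc_def)

lemma (in coord_metric) coord_metric_subset:
  assumes "open T" "T \<subseteq> S"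
  shows "coord_metric T g"
  by standard (use assms smooth_on_subset[OF smooth_g] pos in auto)

lemma (in coord_metric) Rm_bilinear: "x \<in> S \<Longrightarrow> bilinear (Rm g x \<xi>)"
  by (simp add: bilinear_def Rm_linear)

text \<open>For the gradient \<open>V\<close> of half of \<open>h\<close>: Bochner's formula turns the rough Laplacian of \<open>V\<close> into
  a Ricci and a Laplacian term, and \<open>\<nabla>\<^sub>V V\<close> is half the gradient of the squared norm of \<open>V\<close>.\<close>

lemma (in coord_metric) half_grad_identity:
  assumes x: "x \<in> S" and b: "onb (g x) b" and h: "smooth_on S h"
  defines "W \<equiv> gradc g h"
  defines "V \<equiv> \<lambda>y. (1/2) *\<^sub>R W y"
  shows "(\<Sum>i\<in>UNIV. Rm g x (V x) (b i) (b i)) + (\<Sum>i\<in>UNIV. cd2 g V x (b i) (b i)) + cd g (V x) V x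
    = (\<Sum>i\<in>UNIV. Rm g x (W x) (b i) (b i)) + (1/2) *\<^sub>R gradc g (divc g W) x
      + (1/8) *\<^sub>R gradc g (\<lambda>y. form (g y) (W y) (W y)) x" (is "?L = ?R")
proof (rule form_cancel[OF x])
  fix \<zeta>
  let ?h = "\<lambda>y. (1/2) *\<^sub>R h y"
  have sW: "smooth_on S W" unfolding W_def by (rule smooth_gradc[OF h])
  have sV: "smooth_on S V" unfolding V_def by (intro smooth_on_scaleR smooth_on_const open_S sW)
  have sh: "smooth_on S ?h" by (intro smooth_on_scaleR smooth_on_const open_S h)
  have V: "form (g y) (V y) \<zeta> = der ?h y \<zeta>" if "y \<in> S" for y \<zeta>
    using gradc_form[OF that smooth_on_differentiable[OF h that], of \<zeta>]
      der_bounded_linear[OF bounded_linear_scaleR_right smooth_on_differentiable[OF h that], of "1/2" \<zeta>]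
    by (simp add: V_def W_def)
  have dW: "W differentiable (at y)" if "y \<in> S" for y by (rule smooth_on_differentiable[OF sW that])
  have cdV: "cd g \<xi> V y = (1/2) *\<^sub>R cd g \<xi> W y" if "y \<in> S" for \<xi> y
    using der_bounded_linear[OF bounded_linear_scaleR_right dW[OF that], of "1/2" \<xi>]
    by (simp add: cd_def V_def chr_simps[OF that] scaleR_add_right)
  have sdW: "smooth_on S (divc g W)" by (rule smooth_divc[OF sW])
  have "der (divc g V) x = der (\<lambda>y. (1/2) *\<^sub>R divc g W y) x"
    by (rule der_cong[OF open_S x]) (simp add: divc_def cdV sum_divide_distrib)
  then have divV: "der (divc g V) x \<zeta> = (1/2) * der (divc g W) x \<zeta>"
    using der_bounded_linear[OF bounded_linear_scaleR_right smooth_on_differentiable[OF sdW x], of "1/2" \<zeta>]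
    by simp
  have sn: "smooth_on S (\<lambda>y. form (g y) (W y) (W y))" by (intro smooth_on_form open_S smooth_g sW)
  have "der (\<lambda>y. form (g y) (V y) (V y)) x \<zeta> = der (\<lambda>y. (1/4) *\<^sub>R form (g y) (W y) (W y)) x \<zeta>"
    by (simp add: V_def)
  also have "\<dots> = (1/4) * der (\<lambda>y. form (g y) (W y) (W y)) x \<zeta>"
    using der_bounded_linear[OF bounded_linear_scaleR_right smooth_on_differentiable[OF sn x], of "1/4" \<zeta>] by simp
  finally have nV: "form (g x) (cd g (V x) V x) \<zeta> = (1/8) * der (\<lambda>y. form (g y) (W y) (W y)) x \<zeta>"
    using der_grad_norm[OF sh sV V x, of \<zeta>] by simp
  have RW: "(\<Sum>i\<in>UNIV. Rm g x (W x) (b i) (b i)) = 2 *\<^sub>R (\<Sum>i\<in>UNIV. Rm g x (V x) (b i) (b i))"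
    by (simp add: V_def linear_scale[OF Rm_linear(3)[OF x]] scaleR_sum_right)
  show "form (g x) ?L \<zeta> = form (g x) ?R \<zeta>"
    unfolding RW
    using rough_laplacian_grad[OF sh sV V x b, of \<zeta>] divV nV
      gradc_form[OF x smooth_on_differentiable[OF sdW x], of \<zeta>]
      gradc_form[OF x smooth_on_differentiable[OF sn x], of \<zeta>]
    by simp
qed

context riem_atlas
begin

lemma chart_of_points:
  assumes "p \<in> points M"
  obtains c where "c \<in> charts_at M p"
  using chart_at[OF assms] by blast

lemma grad_chart:
  assumes c: "c \<in> charts_at M p" and h: "(\<lambda>x. h (cinv c x)) differentiable (at (cmap c p))"
  shows "grad M h p \<in> tangent_space M p"
    and "grad M h p c = gradc (metric_matrix M c) (\<lambda>x. h (cinv c x)) (cmap c p)"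
proof -
  interpret c: coord_metric "img c" "metric_matrix M c" by (rule coord_metric_chart[OF charts_atD(1)[OF c]])
  let ?w = "gradc (metric_matrix M c) (\<lambda>x. h (cinv c x)) (cmap c p)"
  let ?u = "tangent_of M p c ?w"
  have u: "?u \<in> tangent_space M p" by (rule tangent_of_tangent[OF c])
  have dir: "dir M p v h = form (metric_matrix M c (cmap c p)) ?w (v c)" if "v \<in> tangent_space M p" for v
    unfolding dir_chart[OF c that h] c.gradc_form[OF in_img[OF c] h] ..
  have "grad M h p = ?u"
    unfolding grad_def
  proof (rule the_equality)
    show "?u \<in> tangent_space M p \<and> (\<forall>v\<in>tangent_space M p. riem M p ?u v = dir M p v h)"
      using u riem_chart[OF c u] dir tangent_of_at[OF c] by simp
    fix w assume w: "w \<in> tangent_space M p \<and> (\<forall>v\<in>tangent_space M p. riem M p w v = dir M p v h)"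
    have "w c = ?w"
    proof (rule c.form_cancel[OF in_img[OF c]])
      fix \<zeta>
      have t: "tangent_of M p c \<zeta> \<in> tangent_space M p" by (rule tangent_of_tangent[OF c])
      show "form (metric_matrix M c (cmap c p)) (w c) \<zeta> = form (metric_matrix M c (cmap c p)) ?w \<zeta>"
        using w t riem_chart[OF c _ t, of w] dir[OF t] tangent_of_at[OF c, of \<zeta>] by simp
    qed
    then show "w = ?u" using tangent_eqI[OF _ u c] w tangent_of_at[OF c] by simp
  qed
  then show "grad M h p \<in> tangent_space M p" "grad M h p c = ?w" using u tangent_of_at[OF c] by simp_all
qed

lemma smooth_function_differentiable:
  "smooth_function M h \<Longrightarrow> c \<in> charts_at M p \<Longrightarrow> (\<lambda>x. h (cinv c x)) differentiable (at (cmap c p))"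
  unfolding smooth_function_def
  by (rule smooth_on_differentiable[OF _ in_img]) (auto dest: charts_atD(1))

lemma grad_components:
  assumes h: "smooth_function M h" and c: "c \<in> atlas M" and x: "x \<in> img c"
  shows "grad M h (cinv c x) c = gradc (metric_matrix M c) (\<lambda>x. h (cinv c x)) x"
  using grad_chart(2)[OF charts_at_cinv[OF c x] smooth_function_differentiable[OF h charts_at_cinv[OF c x]]]
  by (simp add: cmap_cinv(1)[OF x])

lemma smooth_grad:
  assumes h: "smooth_function M h"
  shows "smooth_field_on M (points M) (grad M h)"
  unfolding smooth_field_on_def
proof (intro conjI ballI)
  fix q assume "q \<in> points M"
  then obtain c where "c \<in> charts_at M q" by (rule chart_of_points)
  then show "grad M h q \<in> tangent_space M q" using grad_chart(1) smooth_function_differentiable[OF h] by blast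
next
  fix c assume c: "c \<in> atlas M"
  interpret c: coord_metric "img c" "metric_matrix M c" by (rule coord_metric_chart[OF c])
  have "points M \<inter> cdom c = cdom c" using chart_cover c by auto
  moreover have "smooth_on (img c) (\<lambda>x. h (cinv c x))" using h c by (simp add: smooth_function_def)
  from c.smooth_gradc[OF this] have "smooth_on (img c) (\<lambda>x. grad M h (cinv c x) c)"
    by (rule smooth_on_cong[THEN iffD1, OF c.open_S, rotated]) (simp add: grad_components[OF h c])
  ultimately show "smooth_on (cmap c ` (points M \<inter> cdom c)) (\<lambda>x. grad M h (cinv c x) c)" by simp
qed

lemma divergence_chart:
  assumes X: "smooth_field_on M U X" "openin (topo M) U" "p \<in> U" and c: "c \<in> charts_at M p"
  shows "divergence M X p = divc (metric_matrix M c) (\<lambda>x. X (cinv c x) c) (cmap c p)"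
proof -
  interpret c: coord_metric "img c" "metric_matrix M c" by (rule coord_metric_chart[OF charts_atD(1)[OF c]])
  let ?e = "frame_at M p"
  obtain W where W: "p \<in> W" "\<And>q i. q \<in> W \<Longrightarrow> ?e i q \<in> tangent_space M q"
    "\<And>q c. q \<in> W \<Longrightarrow> c \<in> charts_at M q \<Longrightarrow> onb (metric_matrix M c (cmap c q)) (\<lambda>i. ?e i q c)"
    using orthonormal_frameE[OF frame_at[OF charts_at_points[OF c]]] by metis
  have d: "(\<lambda>x. X (cinv c x) c) differentiable (at (cmap c p))" by (rule smooth_field_at[OF X c])
  have "riem M p (cov M p (?e i p) X) (?e i p) = form (metric_matrix M c (cmap c p))
      (cd (metric_matrix M c) (?e i p c) (\<lambda>x. X (cinv c x) c) (cmap c p)) (?e i p c)" for i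
    using riem_chart[OF c cov_tangent[OF W(2)[OF W(1)] X(2,3,1)] W(2)[OF W(1)], of i i]
      cov_chart[OF c W(2)[OF W(1)], of X i] d by simp
  then show ?thesis
    unfolding divergence_def Let_def using c.divc_onb[OF in_img[OF c] d W(3)[OF W(1) c]] by simp
qed

lemma laplacian_chart:
  assumes h: "smooth_function M h" and c: "c \<in> charts_at M p"
  shows "laplacian M h p
    = divc (metric_matrix M c) (gradc (metric_matrix M c) (\<lambda>x. h (cinv c x))) (cmap c p)"
proof -
  have "cd (metric_matrix M c) \<xi> (\<lambda>x. grad M h (cinv c x) c) (cmap c p)
      = cd (metric_matrix M c) \<xi> (gradc (metric_matrix M c) (\<lambda>x. h (cinv c x))) (cmap c p)" for \<xi>
    using open_img[OF charts_atD(1)[OF c]] in_img[OF c]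
    by (rule cd_cong) (rule grad_components[OF h charts_atD(1)[OF c]])
  then show ?thesis
    unfolding laplacian_def
    using divergence_chart[OF smooth_grad[OF h] openin_topspace charts_at_points[OF c] c]
    by (simp add: divc_def)
qed

text \<open>Fields with constant components in one chart commute, by Schwarz's theorem.\<close>

lemma lie_bracket_extend:
  assumes p: "p \<in> points M" and u: "u \<in> tangent_space M p" and v: "v \<in> tangent_space M p"
  shows "lie_bracket M (extend_tvec M p u) (extend_tvec M p v) p = (\<lambda>_. 0)"
proof (rule ext)
  fix d
  let ?c = "chart_at M p" and ?x = "cmap (chart_at M p) p"
  have c: "?c \<in> charts_at M p" by (rule chart_at[OF p])
  show "lie_bracket M (extend_tvec M p u) (extend_tvec M p v) p d = 0"
  proof (cases "d \<in> charts_at M p")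
    case False then show ?thesis by (simp add: lie_bracket_def)
  next
    case d: True
    note cd = charts_atD(1)[OF c] charts_atD(1)[OF d]
    have e: "extend_tvec M p w p = w" if "w \<in> tangent_space M p" for w
      unfolding extend_tvec_def by (rule tangent_of_component[OF that c])
    have "der (\<lambda>x. extend_tvec M p w (cinv ?c x) d) ?x = der (\<lambda>x. der (transition ?c d) x (w ?c)) ?x" for w
    proof (rule der_cong[OF open_overlap[OF cd] in_overlap[OF c d]])
      fix x assume x: "x \<in> overlap ?c d"
      then have "d \<in> charts_at M (cinv ?c x)" "cmap ?c (cinv ?c x) = x"
        using cd by (auto simp: charts_at_def cinv_cmap)
      then show "extend_tvec M p w (cinv ?c x) d = der (transition ?c d) x (w ?c)"
        by (simp add: extend_tvec_def tangent_of_other)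
    qed
    then have "dir M p w (\<lambda>q. extend_tvec M p w' q d) = der (\<lambda>x. der (transition ?c d) x (w' ?c)) ?x (w ?c)" for w w'
      by (simp add: dir_def Let_def)
    then show ?thesis
      using d der_der_commute[OF open_overlap[OF cd] in_overlap[OF c d] transition_smooth[OF cd], of "v ?c" "u ?c"]
      by (simp add: lie_bracket_def e[OF u] e[OF v])
  qed
qed

text \<open>The extensions with constant components in the preferred chart have variable components in \<open>c\<close>, so
  this is tensoriality: their derivatives enter only through the bracket, which vanishes.\<close>

lemma curvature_chart:
  assumes c: "c \<in> charts_at M p" and u: "u \<in> tangent_space M p" and v: "v \<in> tangent_space M p"
    and w: "w \<in> tangent_space M p"
  shows "curvature M p u v w c = Rm (metric_matrix M c) (cmap c p) (u c) (v c) (w c)"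
proof -
  let ?c0 = "chart_at M p" and ?x = "cmap c p" and ?g = "metric_matrix M c"
  have p: "p \<in> points M" by (rule charts_at_points[OF c])
  have c0: "?c0 \<in> charts_at M p" by (rule chart_at[OF p])
  note cd = charts_atD(1)[OF c] charts_atD(1)[OF c0]
  let ?S = "overlap c ?c0"
  interpret c: coord_metric "img c" ?g by (rule coord_metric_chart[OF cd(1)])
  interpret S: coord_metric ?S ?g by (rule c.coord_metric_subset[OF open_overlap[OF cd]]) auto
  have x: "?x \<in> ?S" by (rule in_overlap[OF c c0])
  define E where "E u = extend_tvec M p u" for u
  define C where "C u = (\<lambda>x. E u (cinv c x) c)" for u
  have E: "smooth_field_on M (cdom ?c0) (E u)" for u
    unfolding E_def extend_tvec_def by (rule smooth_field_of_components[OF cd(2) smooth_on_const])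
  have Ep: "E u p = u" if "u \<in> tangent_space M p" for u
    unfolding E_def extend_tvec_def by (rule tangent_of_component[OF that c0])
  have C: "smooth_on ?S (C u)" for u
    using E[of u] cd(1) unfolding smooth_field_on_def C_def by (simp add: Int_commute)
  have Cx: "C u ?x = u c" if "u \<in> tangent_space M p" for u
    by (simp add: C_def cinv_cmap_at[OF c] Ep[OF that])
  have dC: "C u differentiable (at ?x)" for u by (rule smooth_on_differentiable[OF C x])
  have inner: "cov M (cinv c y) (E u (cinv c y)) (E w) c = cd ?g (C u y) (C w) y" if "y \<in> ?S" for u w y
  proof -
    have q: "c \<in> charts_at M (cinv c y)" "cmap c (cinv c y) = y" "cinv c y \<in> cdom ?c0"
      using that cd by (auto simp: charts_at_def cinv_cmap)
    have t: "E u (cinv c y) \<in> tangent_space M (cinv c y)" using E[of u] q(3) by (simp add: smooth_field_on_def)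
    have d: "(\<lambda>x. E w (cinv c x) c) differentiable (at (cmap c (cinv c y)))"
      using smooth_on_differentiable[OF C that, of w] by (simp add: q(2) C_def)
    show ?thesis using cov_chart[OF q(1) t, of "E w", OF d] by (simp add: q(2) C_def)
  qed
  have outer: "cov M p (E u p) (\<lambda>q. cov M q (E v q) (E w)) c
      = cd ?g (u c) (cd ?g (v c) (C w)) ?x + cd ?g (der (C v) ?x (u c)) (C w) ?x"
    if u: "u \<in> tangent_space M p" and v: "v \<in> tangent_space M p" for u v
  proof -
    note A = S.cd_along_field[OF x C[of w] dC[of v]]
    have d: "(\<lambda>y. cov M (cinv c y) (E v (cinv c y)) (E w) c) differentiable (at ?x)"
      using A(1) differentiable_cong_open[OF S.open_S x inner[where u = v and w = w]] by simp
    have "cd ?g (u c) (\<lambda>x. cov M (cinv c x) (E v (cinv c x)) (E w) c) ?x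
        = cd ?g (u c) (\<lambda>x. cd ?g (C v x) (C w) x) ?x"
      by (rule cd_cong[OF S.open_S x]) (rule inner)
    then show ?thesis
      unfolding Ep[OF u] cov_chart[OF c u, of "\<lambda>q. cov M q (E v q) (E w)", OF d] A(2) Cx[OF v] .
  qed
  have "lie_bracket M (E u) (E v) p = (\<lambda>_. 0)" unfolding E_def by (rule lie_bracket_extend[OF p u v])
  note lie = this
  have dir: "dir M p u (\<lambda>q. E v q c) = der (C v) ?x (u c)" if "u \<in> tangent_space M p" for u v
    unfolding C_def by (rule dir_chart[OF c that]) (use dC[of v] in \<open>simp add: C_def\<close>)
  have comm: "der (C v) ?x (u c) = der (C u) ?x (v c)"
    using fun_cong[OF lie, of c] c by (simp add: lie_bracket_def Ep[OF u] Ep[OF v] dir[OF u] dir[OF v])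
  have z: "cov M p (\<lambda>_. 0) (E w) c = 0"
  proof -
    have d: "(\<lambda>x. E w (cinv c x) c) differentiable (at ?x)" using dC[of w] by (simp add: C_def)
    show ?thesis
      using cov_chart[OF c tangent_zero, of "E w", OF d] d by (simp add: cd_def S.chr_simps(9)[OF x])
  qed
  show ?thesis
    unfolding curvature_def E_def[symmetric] curvature_field_def lie z outer[OF u v] outer[OF v u] comm
    using S.cd_commutator[OF x C[of w], of "u c" "v c"] Cx[OF w] by simp
qed

lemma ricci_chart:
  assumes c: "c \<in> charts_at M p" and v: "v \<in> tangent_space M p" and b: "onb (metric_matrix M c (cmap c p)) b"
  shows "ricci M p v c = (\<Sum>i\<in>UNIV. Rm (metric_matrix M c) (cmap c p) (v c) (b i) (b i))"
proof -
  interpret c: coord_metric "img c" "metric_matrix M c" by (rule coord_metric_chart[OF charts_atD(1)[OF c]])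
  let ?e = "frame_at M p"
  obtain W where W: "p \<in> W" "\<And>q i. q \<in> W \<Longrightarrow> ?e i q \<in> tangent_space M q"
    "\<And>q c. q \<in> W \<Longrightarrow> c \<in> charts_at M q \<Longrightarrow> onb (metric_matrix M c (cmap c q)) (\<lambda>i. ?e i q c)"
    using orthonormal_frameE[OF frame_at[OF charts_at_points[OF c]]] by metis
  have t: "?e i p \<in> tangent_space M p" for i by (rule W(2)[OF W(1)])
  show ?thesis
    unfolding ricci_def Let_def curvature_chart[OF c v t t]
    by (rule onb_trace_unique[OF b W(3)[OF W(1) c] c.pos[OF in_img[OF c]] c.Rm_bilinear[OF in_img[OF c]]])
qed

lemma tangent_norm_square:
  assumes c: "c \<in> charts_at M p" and v: "v \<in> tangent_space M p"
  shows "(tangent_norm M p v)\<^sup>2 = form (metric_matrix M c (cmap c p)) (v c) (v c)"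
proof -
  have "riem M p v v \<ge> 0"
  proof (cases "v = (\<lambda>_. 0)")
    case True then show ?thesis using riem_chart[OF c v v] by simp
  next
    case False then show ?thesis using riem_pos[OF charts_at_points[OF c] v] by simp
  qed
  then show ?thesis using riem_chart[OF c v v] by (simp add: tangent_norm_def)
qed

text \<open>This brings the curvature equation into the form that the bitension field has in a chart.\<close>

lemma ricci_grad_equation_chart:
  assumes c: "c \<in> charts_at M p" and h: "smooth_function M h" and b: "onb (metric_matrix M c (cmap c p)) b"
  defines "g \<equiv> metric_matrix M c" and "x \<equiv> cmap c p"
  defines "V \<equiv> \<lambda>y. (1/2) *\<^sub>R gradc g (\<lambda>x. h (cinv c x)) y"
  shows "ricci M p (grad M h p) c + (1/2) *\<^sub>R grad M (laplacian M h) p c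
      + (1/8) *\<^sub>R grad M (\<lambda>q. (tangent_norm M q (grad M h q))\<^sup>2) p c
    = (\<Sum>i\<in>UNIV. Rm g x (V x) (b i) (b i)) + (\<Sum>i\<in>UNIV. cd2 g V x (b i) (b i)) + cd g (V x) V x"
    and "grad M (laplacian M h) p \<in> tangent_space M p"
    and "grad M (\<lambda>q. (tangent_norm M q (grad M h q))\<^sup>2) p \<in> tangent_space M p"
proof -
  have ca: "c \<in> atlas M" by (rule charts_atD(1)[OF c])
  interpret c: coord_metric "img c" g unfolding g_def by (rule coord_metric_chart[OF ca])
  have x: "x \<in> img c" unfolding x_def by (rule in_img[OF c])
  define k where "k = (\<lambda>x. h (cinv c x))"
  have k: "smooth_on (img c) k" using h ca by (simp add: smooth_function_def k_def)
  define W where "W = gradc g k"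
  have sW: "smooth_on (img c) W" unfolding W_def by (rule c.smooth_gradc[OF k])
  have 1: "grad M h p c = W x" "grad M h p \<in> tangent_space M p"
    using grad_chart[OF c smooth_function_differentiable[OF h c]] by (simp_all add: W_def k_def g_def x_def)
  have L: "laplacian M h (cinv c y) = divc g W y" if "y \<in> img c" for y
    using laplacian_chart[OF h charts_at_cinv[OF ca that]] by (simp add: cmap_cinv(1)[OF that] W_def k_def g_def)
  have N: "(tangent_norm M (cinv c y) (grad M h (cinv c y)))\<^sup>2 = form (g y) (W y) (W y)" if "y \<in> img c" for y
    using tangent_norm_square[OF charts_at_cinv[OF ca that] grad_chart(1)[OF charts_at_cinv[OF ca that]
        smooth_function_differentiable[OF h charts_at_cinv[OF ca that]]]] grad_components[OF h ca that]
    by (simp add: cmap_cinv(1)[OF that] W_def k_def g_def)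
  have dL: "(\<lambda>x. laplacian M h (cinv c x)) differentiable (at (cmap c p))"
    using differentiable_cong_open[OF c.open_S x L] smooth_on_differentiable[OF c.smooth_divc[OF sW] x]
    by (simp add: x_def)
  have sN: "smooth_on (img c) (\<lambda>y. form (g y) (W y) (W y))" by (intro smooth_on_form c.open_S c.smooth_g sW)
  have dN: "(\<lambda>x. (tangent_norm M (cinv c x) (grad M h (cinv c x)))\<^sup>2) differentiable (at (cmap c p))"
    using differentiable_cong_open[OF c.open_S x N] smooth_on_differentiable[OF sN x] by (simp add: x_def)
  show "grad M (laplacian M h) p \<in> tangent_space M p" by (rule grad_chart(1)[OF c dL])
  show "grad M (\<lambda>q. (tangent_norm M q (grad M h q))\<^sup>2) p \<in> tangent_space M p" by (rule grad_chart(1)[OF c dN])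
  have 2: "grad M (laplacian M h) p c = gradc g (divc g W) x"
    unfolding grad_chart(2)[OF c dL] g_def[symmetric] x_def[symmetric] by (rule gradc_cong[OF c.open_S x L])
  have 3: "grad M (\<lambda>q. (tangent_norm M q (grad M h q))\<^sup>2) p c = gradc g (\<lambda>y. form (g y) (W y) (W y)) x"
    unfolding grad_chart(2)[OF c dN] g_def[symmetric] x_def[symmetric] by (rule gradc_cong[OF c.open_S x N])
  show "ricci M p (grad M h p) c + (1/2) *\<^sub>R grad M (laplacian M h) p c
      + (1/8) *\<^sub>R grad M (\<lambda>q. (tangent_norm M q (grad M h q))\<^sup>2) p c
    = (\<Sum>i\<in>UNIV. Rm g x (V x) (b i) (b i)) + (\<Sum>i\<in>UNIV. cd2 g V x (b i) (b i)) + cd g (V x) V x"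
    unfolding ricci_chart[OF c 1(2) b] 1(1) 2 3 g_def[symmetric] x_def[symmetric]
    using c.half_grad_identity[OF x b[folded g_def x_def] k] by (simp add: V_def W_def k_def)
qed

end


section \<open>The tangent bundle\<close>

lemma riem_atlas_of_riemannian_manifold:
  fixes M :: "('a, 'n::finite, 'z) riem_mfd_scheme"
  assumes "riemannian_manifold M"
  shows "riem_atlas M"
proof -
  have sm: "smooth_manifold M" using assms by (simp add: riemannian_manifold_def)
  have op: "openin (topo M) (cdom c)" "open (img c)"
    and hom: "homeomorphic_map (subtopology (topo M) (cdom c)) (top_of_set (img c)) (cmap c)"
    if "c \<in> atlas M" for c using sm that by (auto simp: smooth_manifold_def)
  have ts: "topspace (subtopology (topo M) (cdom c)) = cdom c" if "c \<in> atlas M" for c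
    using openin_subset[OF op(1)[OF that]] by auto
  show ?thesis
  proof
    fix c assume c: "c \<in> atlas M"
    show "openin (topo M) (cdom c)" by (rule op[OF c])
    show "inj_on (cmap c) (cdom c)" using homeomorphic_imp_injective_map[OF hom[OF c]] by (simp only: ts[OF c])
    show "smooth_on (img c) (metric_matrix M c)" using assms c by (simp add: riemannian_manifold_def)
    fix U assume "openin (topo M) U"
    then have "openin (subtopology (topo M) (cdom c)) (U \<inter> cdom c)" by (rule openin_subtopology_Int)
    then have "openin (top_of_set (img c)) (cmap c ` (U \<inter> cdom c))"
      using homeomorphic_imp_open_map[OF hom[OF c]] by (simp add: open_map_def)
    then show "open (cmap c ` (U \<inter> cdom c))" using op(2)[OF c] by (simp add: openin_open_eq)
  next
    show "(\<Union>c\<in>atlas M. cdom c) = points M" using sm by (simp add: smooth_manifold_def)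
    show "smooth_on (overlap c d) (transition c d)" if "c \<in> atlas M" "d \<in> atlas M" for c d
      using sm that by (simp add: smooth_manifold_def)
  next
    fix p assume "p \<in> points M"
    with assms show "tangent_bilinear M p (riem M p)" "tangent_symmetric M p (riem M p)"
      "\<And>v. v \<in> tangent_space M p \<Longrightarrow> v \<noteq> (\<lambda>_. 0) \<Longrightarrow> 0 < riem M p v v"
      by (auto simp: riemannian_manifold_def)
  qed
qed

definition base_part :: "real ^ ('m::finite + 'n::finite) \<Rightarrow> real ^ 'm" where
  "base_part w = (\<chi> i. w $ Inl i)"

definition fibre_part :: "real ^ ('m::finite + 'n::finite) \<Rightarrow> real ^ 'n" where
  "fibre_part w = (\<chi> i. w $ Inr i)"

lemma join_parts [simp]:
  "base_part (join a b) = a" "fibre_part (join a b) = b" "join (base_part w) (fibre_part w) = w"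
  by (auto simp: base_part_def fibre_part_def join_def vec_eq_iff split: sum.split)

lemma parts_eqI: "base_part v = base_part w \<Longrightarrow> fibre_part v = fibre_part w \<Longrightarrow> v = w"
  by (metis join_parts(3))

lemma bounded_linear_parts: "bounded_linear base_part" "bounded_linear fibre_part"
  by (auto intro!: linear_conv_bounded_linear[THEN iffD1] linearI simp: base_part_def fibre_part_def vec_eq_iff)

lemma parts_simps [simp]:
  "base_part (v + w) = base_part v + base_part w" "fibre_part (v + w) = fibre_part v + fibre_part w"
  "base_part (v - w) = base_part v - base_part w" "fibre_part (v - w) = fibre_part v - fibre_part w"
  "base_part (c *\<^sub>R w) = c *\<^sub>R base_part w" "fibre_part (c *\<^sub>R w) = c *\<^sub>R fibre_part w"
  "base_part 0 = 0" "fibre_part 0 = 0"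
  by (simp_all add: base_part_def fibre_part_def vec_eq_iff)

lemma join_eq_sum: "join a b = join a 0 + join 0 b"
  by (rule parts_eqI) simp_all

lemma bounded_linear_join: "bounded_linear (\<lambda>a. join a 0)" "bounded_linear (\<lambda>b. join 0 b)"
  by (auto intro!: linear_conv_bounded_linear[THEN iffD1] linearI parts_eqI)

lemma der_join:
  assumes "f differentiable (at x)" "h differentiable (at x)"
  shows "der (\<lambda>x. join (f x) (h x)) x v = join (der f x v) (der h x v)"
    and "(\<lambda>x. join (f x) (h x)) differentiable (at x)"
proof -
  note d = bounded_linear_compose_differentiable[OF bounded_linear_join(1) assms(1)]
    bounded_linear_compose_differentiable[OF bounded_linear_join(2) assms(2)]
  have e: "(\<lambda>x. join (f x) (h x)) = (\<lambda>x. join (f x) 0 + join 0 (h x))"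
    by (rule ext) (rule join_eq_sum)
  have "der (\<lambda>x. join (f x) (h x)) x v = join (der f x v) 0 + join 0 (der h x v)"
    unfolding e der_add[OF d] der_bounded_linear[OF bounded_linear_join(1) assms(1)]
      der_bounded_linear[OF bounded_linear_join(2) assms(2)] ..
  then show "der (\<lambda>x. join (f x) (h x)) x v = join (der f x v) (der h x v)"
    using join_eq_sum[of "der f x v" "der h x v"] by (rule trans[OF _ sym])
  show "(\<lambda>x. join (f x) (h x)) differentiable (at x)"
    unfolding e using d by (rule differentiable_add)
qed

lemma smooth_on_join:
  assumes "open S" "smooth_on S f" "smooth_on S h"
  shows "smooth_on S (\<lambda>x. join (f x) (h x))"
proof -
  have "(\<lambda>x. join (f x) (h x)) = (\<lambda>x. join (f x) 0 + join 0 (h x))"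
    by (rule ext) (rule join_eq_sum)
  then show ?thesis
    using smooth_on_add[OF assms(1) smooth_on_bounded_linear[OF assms(1) bounded_linear_join(1) assms(2)]
        smooth_on_bounded_linear[OF assms(1) bounded_linear_join(2) assms(3)]] by simp
qed

lemma smooth_on_base:
  fixes F :: "real ^ 'm::finite \<Rightarrow> 'b::real_normed_vector"
  assumes "open S" "smooth_on S F"
  shows "smooth_on {w :: real ^ ('m + 'n::finite). base_part w \<in> S} (\<lambda>w. F (base_part w))"
    and "open {w :: real ^ ('m + 'n). base_part w \<in> S}"
proof -
  have c: "continuous_on UNIV (base_part :: real ^ ('m + 'n) \<Rightarrow> _)"
    by (rule linear_continuous_on[OF bounded_linear_parts(1)])
  have eq: "{w :: real ^ ('m + 'n). base_part w \<in> S} = base_part -` S" by auto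
  show o: "open {w :: real ^ ('m + 'n). base_part w \<in> S}"
    unfolding eq by (rule open_vimage[OF assms(1) c])
  show "smooth_on {w :: real ^ ('m + 'n). base_part w \<in> S} (\<lambda>w. F (base_part w))"
    by (rule smooth_on_compose[OF o assms(1) smooth_on_linear[OF o bounded_linear_parts(1)] assms(2)]) auto
qed

lemma der_base_compose:
  assumes "F differentiable (at (base_part w))"
  shows "der (\<lambda>w. F (base_part w)) w v = der F (base_part w) (base_part v)"
    and "(\<lambda>w. F (base_part w)) differentiable (at w)"
  using der_compose[OF bounded_linear_differentiable[OF bounded_linear_parts(1)] assms]
    differentiable_compose_at[OF bounded_linear_differentiable[OF bounded_linear_parts(1)] assms]
  by (simp_all add: der_linear[OF bounded_linear_parts(1)])

context smooth_atlas
begin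

lemma induced_chart_cdom: "z \<in> cdom (induced_chart M c) \<longleftrightarrow> fst z \<in> cdom c \<and> snd z \<in> tangent_space M (fst z)"
  by (cases z) (simp add: induced_chart_def)

lemma induced_chart_cmap: "cmap (induced_chart M c) z = join (cmap c (fst z)) (snd z c)"
  by (cases z) (simp add: induced_chart_def)

lemma induced_chart_img:
  assumes c: "c \<in> atlas M"
  shows "img (induced_chart M c) = {w. base_part w \<in> img c}"
    and "cmap (induced_chart M c) ` (cdom (induced_chart M c) \<inter> cdom (induced_chart M d)) = {w. base_part w \<in> overlap c d}"
proof -
  have *: "cmap (induced_chart M c) ` {z. fst z \<in> A \<and> snd z \<in> tangent_space M (fst z)} = {w. base_part w \<in> cmap c ` A}"
    (is "?L = ?R") if A: "A \<subseteq> cdom c" for A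
  proof
    show "?L \<subseteq> ?R" by (auto simp: induced_chart_cmap)
    show "?R \<subseteq> ?L"
    proof
      fix w :: "real ^ ('n + 'n)" assume "w \<in> ?R"
      then obtain p where p: "p \<in> A" "base_part w = cmap c p" by auto
      then have cp: "c \<in> charts_at M p" using A c by (auto simp: charts_at_def)
      have "w = cmap (induced_chart M c) (p, tangent_of M p c (fibre_part w))"
        using p tangent_of_at[OF cp] by (intro parts_eqI) (simp_all add: induced_chart_cmap)
      then show "w \<in> ?L" using p tangent_of_tangent[OF cp] by (intro image_eqI) auto
    qed
  qed
  have "cdom (induced_chart M c) = {z. fst z \<in> cdom c \<and> snd z \<in> tangent_space M (fst z)}"
    by (auto simp: induced_chart_cdom)
  then show "img (induced_chart M c) = {w. base_part w \<in> img c}" using *[of "cdom c"] by simp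
  have "cdom (induced_chart M c) \<inter> cdom (induced_chart M d)
      = {z. fst z \<in> cdom c \<inter> cdom d \<and> snd z \<in> tangent_space M (fst z)}"
    by (auto simp: induced_chart_cdom)
  then show "cmap (induced_chart M c) ` (cdom (induced_chart M c) \<inter> cdom (induced_chart M d)) = {w. base_part w \<in> overlap c d}"
    using *[of "cdom c \<inter> cdom d"] by simp
qed

lemma induced_chart_inj:
  assumes c: "c \<in> atlas M"
  shows "inj_on (cmap (induced_chart M c)) (cdom (induced_chart M c))"
proof (rule inj_onI)
  fix y z assume yz: "y \<in> cdom (induced_chart M c)" "z \<in> cdom (induced_chart M c)"
    "cmap (induced_chart M c) y = cmap (induced_chart M c) z"
  then have "cmap c (fst y) = cmap c (fst z)" "snd y c = snd z c"
    unfolding induced_chart_cmap by (metis join_parts(1), metis join_parts(2))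
  moreover from this(1) have f: "fst y = fst z"
    using yz inj_onD[OF chart_inj[OF c]] by (simp add: induced_chart_cdom)
  ultimately have "snd y = snd z"
    using yz c by (intro tangent_eqI[of _ "fst y" _ c]) (auto simp: induced_chart_cdom charts_at_def)
  with f show "y = z" by (rule prod_eqI)
qed

lemma induced_chart_cinv:
  assumes c: "c \<in> atlas M" and w: "base_part w \<in> img c"
  shows "cinv (induced_chart M c) w
    = (cinv c (base_part w), tangent_of M (cinv c (base_part w)) c (fibre_part w))"
proof -
  let ?z = "(cinv c (base_part w), tangent_of M (cinv c (base_part w)) c (fibre_part w))"
  have cp: "c \<in> charts_at M (cinv c (base_part w))" by (rule charts_at_cinv[OF c w])
  have "?z \<in> cdom (induced_chart M c)"
    using tangent_of_tangent[OF cp] cmap_cinv(2)[OF w] by (simp add: induced_chart_cdom)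
  moreover have "cmap (induced_chart M c) ?z = w"
    using cmap_cinv(1)[OF w] tangent_of_at[OF cp] by (intro parts_eqI) (simp_all add: induced_chart_cmap)
  ultimately show ?thesis
    unfolding cinv_def using inv_into_f_f[OF induced_chart_inj[OF c]] by metis
qed

lemma induced_transition:
  assumes c: "c \<in> atlas M" and d: "d \<in> atlas M" and w: "base_part w \<in> overlap c d"
  shows "transition (induced_chart M c) (induced_chart M d) w
    = join (transition c d (base_part w)) (der (transition c d) (base_part w) (fibre_part w))"
proof -
  have w': "base_part w \<in> img c" using w by auto
  have "d \<in> charts_at M (cinv c (base_part w))" using w c d by (auto simp: charts_at_def cinv_cmap)
  then show ?thesis
    by (simp add: induced_chart_cinv[OF c w'] induced_chart_cmap tangent_of_other cmap_cinv(1)[OF w'])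
qed

lemma smooth_induced_transition:
  assumes c: "c \<in> atlas M" and d: "d \<in> atlas M"
  shows "smooth_on (overlap (induced_chart M c) (induced_chart M d)) (transition (induced_chart M c) (induced_chart M d))"
    and "open (overlap (induced_chart M c) (induced_chart M d))"
proof -
  let ?O = "{w :: real ^ ('n + 'n). base_part w \<in> overlap c d}"
  note o = open_overlap[OF c d]
  have oO: "open ?O" by (rule smooth_on_base(2)[OF o transition_smooth[OF c d]])
  have "smooth_on ?O (\<lambda>w. der (transition c d) (base_part w) (fibre_part w))"
  proof (rule smooth_on_linear_family[where F = "\<lambda>w. der (transition c d) (base_part w)", OF oO])
    show "linear (der (transition c d) (base_part w))" if "w \<in> ?O" for w
      using that by (intro linear_frechet_derivative smooth_on_differentiable[OF transition_smooth[OF c d]]) simp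
    show "smooth_on ?O (\<lambda>w. der (transition c d) (base_part w) (axis k 1))" for k
      by (rule smooth_on_base(1)[OF o smooth_on_der[OF transition_smooth[OF c d]]])
    show "smooth_on ?O fibre_part" by (rule smooth_on_linear[OF oO bounded_linear_parts(2)])
  qed
  then have "smooth_on ?O (\<lambda>w. join (transition c d (base_part w)) (der (transition c d) (base_part w) (fibre_part w)))"
    by (intro smooth_on_join oO smooth_on_base(1)[OF o transition_smooth[OF c d]])
  then have "smooth_on ?O (transition (induced_chart M c) (induced_chart M d))"
    by (rule smooth_on_cong[THEN iffD1, OF oO, rotated]) (simp add: induced_transition[OF c d])
  then show "smooth_on (overlap (induced_chart M c) (induced_chart M d)) (transition (induced_chart M c) (induced_chart M d))"
    unfolding induced_chart_img(2)[OF c] .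
  show "open (overlap (induced_chart M c) (induced_chart M d))"
    unfolding induced_chart_img(2)[OF c] by (rule oO)
qed

lemma atlas_tangent_bundle: "atlas (tangent_bundle M) = induced_chart M ` atlas M"
  by (simp add: tangent_bundle_def Let_def)

lemma topo_tangent_bundle:
  "topo (tangent_bundle M) = topology_generated_by
     {{z \<in> cdom C. cmap C z \<in> W} | C W. C \<in> induced_chart M ` atlas M \<and> open W}"
  by (simp add: tangent_bundle_def Let_def)

lemma open_tangent_bundle_basic:
  "c \<in> atlas M \<Longrightarrow> open W \<Longrightarrow>
    openin (topo (tangent_bundle M)) {z \<in> cdom (induced_chart M c). cmap (induced_chart M c) z \<in> W}"
  unfolding topo_tangent_bundle by (rule topology_generated_by_Basis) blast

lemma points_tangent_bundle:
  "z \<in> points (tangent_bundle M) \<longleftrightarrow> fst z \<in> points M \<and> snd z \<in> tangent_space M (fst z)"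
proof -
  have "z \<in> points (tangent_bundle M) \<longleftrightarrow> (\<exists>c\<in>atlas M. z \<in> cdom (induced_chart M c))"
  proof
    assume "z \<in> points (tangent_bundle M)"
    then show "\<exists>c\<in>atlas M. z \<in> cdom (induced_chart M c)" unfolding topo_tangent_bundle topology_generated_by_topspace by blast
  next
    assume "\<exists>c\<in>atlas M. z \<in> cdom (induced_chart M c)"
    then obtain c where "c \<in> atlas M" "z \<in> cdom (induced_chart M c)" by blast
    then show "z \<in> points (tangent_bundle M)"
      using openin_subset[OF open_tangent_bundle_basic[of c UNIV]] by auto
  qed
  then show ?thesis unfolding induced_chart_cdom using chart_cover by blast
qed

text \<open>For the topology generated by the charts, it suffices that the image of a basic open set under a
  chart is the preimage of an open set under a continuous transition map.\<close>

lemma smooth_atlas_tangent_bundle: "smooth_atlas (tangent_bundle M)"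
proof
  fix C assume "C \<in> atlas (tangent_bundle M)"
  then obtain c where c: "c \<in> atlas M" and C: "C = induced_chart M c" by (auto simp: atlas_tangent_bundle)
  show "openin (topo (tangent_bundle M)) (cdom C)" using open_tangent_bundle_basic[OF c, of UNIV] by (simp add: C)
  show "inj_on (cmap C) (cdom C)" unfolding C by (rule induced_chart_inj[OF c])
  have cC: "cinv C (cmap C z) = z" if "z \<in> cdom C" for z
    using that induced_chart_inj[OF c] by (simp add: C cinv_def inv_into_f_f)
  have eq: "cmap C ` (U \<inter> cdom C) = {w \<in> img C. cinv C w \<in> U}" for U
    using cC by (auto simp: image_iff)
  fix U assume "openin (topo (tangent_bundle M)) U"
  then have "generate_topology_on {{z \<in> cdom C. cmap C z \<in> W} | C W. C \<in> induced_chart M ` atlas M \<and> open W} U"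
    unfolding topo_tangent_bundle openin_topology_generated_by_iff .
  then show "open (cmap C ` (U \<inter> cdom C))"
    unfolding eq
  proof (induction rule: generate_topology_on.induct)
    case Empty then show ?case by simp
  next
    case (Int a b)
    have "{w \<in> img C. cinv C w \<in> a \<inter> b} = {w \<in> img C. cinv C w \<in> a} \<inter> {w \<in> img C. cinv C w \<in> b}" by auto
    then show ?case using open_Int[OF Int.IH] by (simp only:)
  next
    case (UN K)
    have "{w \<in> img C. cinv C w \<in> \<Union>K} = (\<Union>k\<in>K. {w \<in> img C. cinv C w \<in> k})" by auto
    then show ?case using open_UN[of K "\<lambda>k. {w \<in> img C. cinv C w \<in> k}"] UN.IH by (simp only:) blast
  next
    case (Basis s)
    then obtain d W where d: "d \<in> atlas M" and W: "open W"
      and s: "s = {z \<in> cdom (induced_chart M d). cmap (induced_chart M d) z \<in> W}" by blast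
    let ?D = "induced_chart M d"
    have "{w \<in> img C. cinv C w \<in> s} = overlap C ?D \<inter> transition C ?D -` W"
      unfolding s using cC by (auto simp: image_iff)
    then show ?case
      using continuous_open_preimage[OF smooth_on_continuous[OF smooth_induced_transition(1)[OF c d]]
          smooth_induced_transition(2)[OF c d] W] by (simp add: C)
  qed
next
  show "(\<Union>C\<in>atlas (tangent_bundle M). cdom C) = points (tangent_bundle M)"
    by (rule set_eqI) (simp add: atlas_tangent_bundle induced_chart_cdom points_tangent_bundle chart_cover[symmetric])
next
  show "smooth_on (overlap C D) (transition C D)"
    if "C \<in> atlas (tangent_bundle M)" "D \<in> atlas (tangent_bundle M)" for C D
    using that smooth_induced_transition(1) by (auto simp: atlas_tangent_bundle)
qed

lemma induced_charts_at:
  assumes "z \<in> points (tangent_bundle M)" "c \<in> charts_at M (fst z)"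
  shows "induced_chart M c \<in> charts_at (tangent_bundle M) z"
  using assms by (auto simp: charts_at_def atlas_tangent_bundle induced_chart_cdom points_tangent_bundle)

text \<open>The transition map of the bundle is \<open>(x, y) \<mapsto> (\<psi> x, d\<psi>\<^sub>x y)\<close>; its derivative contains the second
  derivative of \<open>\<psi>\<close>, as in the transformation law of the Christoffel symbols.\<close>

lemma der_induced_transition:
  assumes z: "z \<in> points (tangent_bundle M)" and c: "c \<in> charts_at M (fst z)" and d: "d \<in> charts_at M (fst z)"
  shows "der (transition (induced_chart M c) (induced_chart M d)) (cmap (induced_chart M c) z) v
    = join (der (transition c d) (cmap c (fst z)) (base_part v))
        (der (\<lambda>x. der (transition c d) x (snd z c)) (cmap c (fst z)) (base_part v)
          + der (transition c d) (cmap c (fst z)) (fibre_part v))"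
proof -
  note cd = charts_atD(1)[OF c] charts_atD(1)[OF d]
  let ?\<psi> = "transition c d" and ?x = "cmap c (fst z)" and ?w = "cmap (induced_chart M c) z"
  let ?O = "{w :: real ^ ('n + 'n). base_part w \<in> overlap c d}"
  have bw: "base_part ?w = ?x" "fibre_part ?w = snd z c" by (simp_all add: induced_chart_cmap)
  have x: "?x \<in> overlap c d" by (rule in_overlap[OF c d])
  have oO: "open ?O" by (rule smooth_on_base(2)[OF open_overlap[OF cd] transition_smooth[OF cd]])
  have wO: "?w \<in> ?O" using x by (simp add: bw)
  have d\<psi>: "?\<psi> differentiable (at y)" if "y \<in> overlap c d" for y
    by (rule smooth_on_differentiable[OF transition_smooth[OF cd] that])
  have dd: "(\<lambda>x. der ?\<psi> x \<xi>) differentiable (at ?x)" for \<xi>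
    by (rule smooth_on_differentiable[OF smooth_on_der[OF transition_smooth[OF cd]] x])
  have lin: "linear (der ?\<psi> (base_part w))" if "w \<in> ?O" for w
    using that d\<psi> by (intro linear_frechet_derivative) simp
  have db: "(\<lambda>w. der ?\<psi> (base_part w) \<xi>) differentiable (at ?w)" for \<xi>
    by (rule der_base_compose(2)) (use dd in \<open>simp add: bw\<close>)
  note lf = differentiable_linear_family[where F = "\<lambda>w. der ?\<psi> (base_part w)", OF oO wO lin db bounded_linear_differentiable[OF bounded_linear_parts(2)]]
  have d1: "(\<lambda>w. ?\<psi> (base_part w)) differentiable (at ?w)"
    by (rule der_base_compose(2)) (use d\<psi>[OF x] in \<open>simp add: bw\<close>)
  have "der (transition (induced_chart M c) (induced_chart M d)) ?w
      = der (\<lambda>w. join (?\<psi> (base_part w)) (der ?\<psi> (base_part w) (fibre_part w))) ?w"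
    by (rule der_cong[OF oO wO]) (simp add: induced_transition[OF cd])
  then have "der (transition (induced_chart M c) (induced_chart M d)) ?w v
      = join (der (\<lambda>w. ?\<psi> (base_part w)) ?w v) (der (\<lambda>w. der ?\<psi> (base_part w) (fibre_part w)) ?w v)"
    by (simp only: der_join(1)[OF d1 lf(1)])
  also have "der (\<lambda>w. ?\<psi> (base_part w)) ?w v = der ?\<psi> ?x (base_part v)"
    using der_base_compose(1)[of ?\<psi> ?w v] d\<psi>[OF x] by (simp add: bw)
  also have "der (\<lambda>w. der ?\<psi> (base_part w) (fibre_part w)) ?w v
      = der (\<lambda>w. der ?\<psi> (base_part w) (snd z c)) ?w v + der ?\<psi> ?x (fibre_part v)"
    using lf(2)[of v] by (simp add: bw der_linear[OF bounded_linear_parts(2)])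
  also have "der (\<lambda>w. der ?\<psi> (base_part w) (snd z c)) ?w v = der (\<lambda>x. der ?\<psi> x (snd z c)) ?x (base_part v)"
    using der_base_compose(1)[of "\<lambda>x. der ?\<psi> x (snd z c)" ?w v] dd by (simp add: bw)
  finally show ?thesis .
qed

end


section \<open>The Mus-Gradient metric in induced coordinates\<close>

text \<open>The connection map of the Levi-Civita connection: the vertical component of the tangent vector \<open>A\<close>
  at the point of the bundle with coordinates \<open>w\<close>. It vanishes on horizontal lifts.\<close>

definition vertical_part ::
  "(real ^ 'n::finite \<Rightarrow> real ^ 'n ^ 'n) \<Rightarrow> real ^ ('n + 'n) \<Rightarrow> real ^ ('n + 'n) \<Rightarrow> real ^ 'n" where
  "vertical_part g w A = fibre_part A + chr g (base_part w) (base_part A) (fibre_part w)"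

definition horizontal ::
  "(real ^ 'n::finite \<Rightarrow> real ^ 'n ^ 'n) \<Rightarrow> real ^ ('n + 'n) \<Rightarrow> real ^ 'n \<Rightarrow> real ^ ('n + 'n)" where
  "horizontal g w \<xi> = join \<xi> (- chr g (base_part w) \<xi> (fibre_part w))"

definition mus_form ::
  "(real ^ 'n::finite \<Rightarrow> real ^ 'n ^ 'n) \<Rightarrow> (real ^ 'n \<Rightarrow> real) \<Rightarrow> real ^ ('n + 'n) \<Rightarrow>
   real ^ ('n + 'n) \<Rightarrow> real ^ ('n + 'n) \<Rightarrow> real" where
  "mus_form g \<phi> w A B = form (g (base_part w)) (base_part A) (base_part B)
     + form (g (base_part w)) (vertical_part g w A) (vertical_part g w B)
     + der \<phi> (base_part w) (vertical_part g w A) * der \<phi> (base_part w) (vertical_part g w B)"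

lemma horizontal_simps [simp]:
  "base_part (horizontal g w \<xi>) = \<xi>" "vertical_part g w (horizontal g w \<xi>) = 0"
  by (simp_all add: horizontal_def vertical_part_def)

text \<open>A basis orthonormal for \<open>A\<close> is turned into one orthonormal for \<open>A + F\<^sup>\<flat> \<otimes> F\<^sup>\<flat>\<close> by shrinking the
  component along \<open>F\<close> by the factor \<open>r = \<surd>(1 + \<parallel>F\<parallel>\<^sup>2)\<close>. Writing the coefficient as \<open>1 / (r (1 + r))\<close> avoids
  dividing by \<open>\<parallel>F\<parallel>\<close>.\<close>

lemma shrunk_basis:
  fixes F :: "real ^ 'n::finite"
  assumes A: "pos_form A" and b: "onb A b"
  defines "r \<equiv> sqrt (1 + form A F F)"
  defines "c \<equiv> \<lambda>i. b i - (form A F (b i) / (r * (1 + r))) *\<^sub>R F"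
  shows "form A (c i) (c j) + form A F (c i) * form A F (c j) = (if i = j then 1 else 0)"
    and "(\<Sum>i\<in>UNIV. form A F (c i) * form A Z (c i)) = form A F Z / (1 + form A F F)"
proof -
  define s where "s = form A F F"
  define k where "k = 1 / (r * (1 + r))"
  have s0: "s \<ge> 0" using A unfolding s_def pos_form_def by (cases "F = 0") (auto intro: less_imp_le)
  have r: "r > 0" and r2: "r * r = 1 + s" using s0 by (simp_all add: r_def s_def[symmetric])
  have s: "s = (r - 1) * (r + 1)" using r2 by (simp add: algebra_simps)
  have k1: "k * (r * (1 + r)) = 1" using r by (simp add: k_def add_pos_pos)
  have "r * (1 - k * s) = r - k * (r * (1 + r)) * (r - 1)" unfolding s by (simp add: algebra_simps)
  then have ks: "1 - k * s = 1 / r" using r unfolding k1 by (simp add: field_simps)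
  have c: "c i = b i - (k * form A F (b i)) *\<^sub>R F" for i by (simp add: c_def k_def)
  have com: "form A u v = form A v u" for u v by (rule pos_form_commute[OF A])
  have Fc: "form A F (c i) = form A F (b i) / r" for i
  proof -
    have "form A F (c i) = form A F (b i) * (1 - k * s)" by (simp add: c s_def algebra_simps)
    then show ?thesis by (simp add: ks)
  qed
  have kk: "k * k * s - 2 * k + 1 / (r * r) = 0"
  proof -
    have "k * k * s - 2 * k = - k - k * (1 - k * s)" by (simp add: algebra_simps)
    also have "\<dots> = - (k * (r * (1 + r)) / (r * r))" unfolding ks using r by (simp add: field_simps)
    also have "\<dots> = - (1 / (r * r))" unfolding k1 ..
    finally show ?thesis by simp
  qed
  have "form A (c i) (c j) + form A F (c i) * form A F (c j)
      = form A (b i) (b j) + form A F (b i) * form A F (b j) * (k * k * s - 2 * k + 1 / (r * r))"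
    unfolding Fc by (simp add: c s_def[symmetric] com[of "b i" F] algebra_simps)
  then show "form A (c i) (c j) + form A F (c i) * form A F (c j) = (if i = j then 1 else 0)"
    using b unfolding kk by (simp add: onb_def)
  have sum: "(\<Sum>i\<in>UNIV. form A F (b i) * form A Z (b i)) = form A F Z" for Z
  proof -
    have "form A F Z = form A F (\<Sum>i\<in>UNIV. form A (b i) Z *\<^sub>R b i)" using onb_expand[OF b, of Z] by simp
    then show ?thesis by (simp add: form_sum com[of Z] mult.commute)
  qed
  have "form A F (c i) * form A Z (c i)
      = (1 / r) * (form A F (b i) * form A Z (b i)) - (k * form A Z F / r) * (form A F (b i) * form A F (b i))" for i
    unfolding Fc by (simp add: c algebra_simps)
  then have "(\<Sum>i\<in>UNIV. form A F (c i) * form A Z (c i)) = (1 / r) * form A F Z - (k * form A Z F / r) * s"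
    by (simp only: sum_subtractf sum_distrib_left[symmetric] sum s_def)
  also have "\<dots> = form A F Z * (1 - k * s) / r" by (simp add: com[of Z] algebra_simps diff_divide_distrib)
  also have "\<dots> = form A F Z / (1 + form A F F)" unfolding ks by (simp add: s_def[symmetric] r2[symmetric])
  finally show "(\<Sum>i\<in>UNIV. form A F (c i) * form A Z (c i)) = form A F Z / (1 + form A F F)" .
qed

lemma sum_UNIV_sum_type:
  fixes k :: "'a::finite + 'b::finite \<Rightarrow> 'c::comm_monoid_add"
  shows "sum k UNIV = (\<Sum>i\<in>UNIV. k (Inl i)) + (\<Sum>j\<in>UNIV. k (Inr j))"
  using sum.Plus[of UNIV UNIV k] by (simp add: UNIV_Plus_UNIV)

locale coord_mus = coord_metric S g for S and g :: "real ^ 'n::finite \<Rightarrow> real ^ 'n ^ 'n" +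
  fixes \<phi> :: "real ^ 'n \<Rightarrow> real"
  assumes smooth_\<phi>: "smooth_on S \<phi>"
begin

abbreviation total :: "(real ^ ('n + 'n)) set" where
  "total \<equiv> {w. base_part w \<in> S}"

lemma open_total: "open total"
  by (rule smooth_on_base(2)[OF open_S smooth_g])

lemma vertical_part_linear: "w \<in> total \<Longrightarrow> linear (vertical_part g w)"
  unfolding vertical_part_def[abs_def]
  by (auto intro!: linearI simp: chr_simps scaleR_add_right)

lemma vertical_part_join [simp]: "w \<in> total \<Longrightarrow> vertical_part g w (join 0 c) = c"
  by (simp add: vertical_part_def chr_simps)

lemma der_\<phi>_linear: "x \<in> S \<Longrightarrow> linear (der \<phi> x)"
  by (intro linear_frechet_derivative smooth_on_differentiable[OF smooth_\<phi>])

lemma smooth_vertical_part: "smooth_on total (\<lambda>w. vertical_part g w A)"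
  unfolding vertical_part_def
proof (intro smooth_on_add smooth_on_const open_total)
  show "smooth_on total (\<lambda>w. chr g (base_part w) (base_part A) (fibre_part w))"
  proof (rule smooth_on_linear_family[where F = "\<lambda>w. chr g (base_part w) (base_part A)", OF open_total])
    show "linear (chr g (base_part w) (base_part A))" if "w \<in> total" for w using that by (simp add: chr_linear)
    show "smooth_on total (\<lambda>w. chr g (base_part w) (base_part A) (axis k 1))" for k
      by (rule smooth_on_base(1)[OF open_S smooth_chr[OF smooth_on_const smooth_on_const]])
    show "smooth_on total fibre_part" by (rule smooth_on_linear[OF open_total bounded_linear_parts(2)])
  qed
qed

lemma smooth_der_vertical: "smooth_on total (\<lambda>w. der \<phi> (base_part w) (vertical_part g w A))"
proof (rule smooth_on_linear_family[where F = "\<lambda>w. der \<phi> (base_part w)", OF open_total])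
  show "linear (der \<phi> (base_part w))" if "w \<in> total" for w using that by (simp add: der_\<phi>_linear)
  show "smooth_on total (\<lambda>w. der \<phi> (base_part w) (axis k 1))" for k
    by (rule smooth_on_base(1)[OF open_S smooth_on_der[OF smooth_\<phi>]])
qed (rule smooth_vertical_part)

lemma smooth_mus_form: "smooth_on total (\<lambda>w. mus_form g \<phi> w A B)"
  unfolding mus_form_def
  by (intro smooth_on_add smooth_on_form smooth_on_mult smooth_der_vertical smooth_vertical_part
      smooth_on_base(1)[OF open_S smooth_g] smooth_on_const open_total)

lemma mus_form_bilinear:
  assumes w: "w \<in> total"
  shows "bilinear (mus_form g \<phi> w)"
  unfolding bilinear_def mus_form_def using w
  by (auto intro!: linearI simp: linear_add[OF vertical_part_linear] linear_scale[OF vertical_part_linear]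
      linear_add[OF der_\<phi>_linear] linear_scale[OF der_\<phi>_linear] algebra_simps)

lemma mus_form_commute: "w \<in> total \<Longrightarrow> mus_form g \<phi> w A B = mus_form g \<phi> w B A"
  by (simp add: mus_form_def form_commute[of _ "base_part A"] form_commute[of _ "vertical_part g w A"] mult.commute)

lemma mus_form_pos:
  assumes w: "w \<in> total" and A: "A \<noteq> 0"
  shows "mus_form g \<phi> w A A > 0"
proof -
  have p: "form (g (base_part w)) u u \<ge> 0" "u \<noteq> 0 \<Longrightarrow> form (g (base_part w)) u u > 0" for u
    using pos[of "base_part w"] w unfolding pos_form_def by (cases "u = 0", auto intro: less_imp_le)
  show ?thesis
  proof (cases "base_part A = 0")
    case False
    then show ?thesis
      using p(2)[of "base_part A"] p(1)[of "vertical_part g w A"] by (simp add: mus_form_def add_pos_nonneg)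
  next
    case True
    then have "fibre_part A \<noteq> 0" using A parts_eqI[of A 0] by auto
    moreover have "vertical_part g w A = fibre_part A" using True w by (simp add: vertical_part_def chr_simps)
    ultimately show ?thesis
      using p(2)[of "fibre_part A"] p(1)[of "base_part A"]
      by (simp add: mus_form_def add_nonneg_pos add_pos_nonneg)
  qed
qed

lemma der_vertical_part:
  assumes w: "w \<in> total"
  shows "der (\<lambda>w. vertical_part g w A) w C = der (\<lambda>x. chr g x (base_part A) (fibre_part w)) (base_part w) (base_part C)
      + chr g (base_part w) (base_part A) (fibre_part C)"
proof -
  have x: "base_part w \<in> S" using w by simp
  let ?F = "\<lambda>w. chr g (base_part w) (base_part A)"
  have lin: "linear (?F w)" if "w \<in> total" for w using that by (simp add: chr_linear)
  have d: "(\<lambda>w. ?F w \<eta>) differentiable (at w)" for \<eta>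
    by (rule der_base_compose(2)[OF chr_differentiable[OF x]])
  note lf = differentiable_linear_family[where F = ?F, OF open_total w lin d
      bounded_linear_differentiable[OF bounded_linear_parts(2)]]
  have "der (\<lambda>w. vertical_part g w A) w C = der (\<lambda>w. ?F w (fibre_part w)) w C"
    unfolding vertical_part_def using der_add[OF _ lf(1), of "\<lambda>_. fibre_part A" C] by simp
  also have "\<dots> = der (\<lambda>v. ?F v (fibre_part w)) w C + ?F w (der fibre_part w C)"
    by (rule lf(2))
  also have "der (\<lambda>v. ?F v (fibre_part w)) w C = der (\<lambda>x. chr g x (base_part A) (fibre_part w)) (base_part w) (base_part C)"
    by (rule der_base_compose(1)[OF chr_differentiable[OF x]])
  finally show ?thesis by (simp add: der_linear[OF bounded_linear_parts(2)])
qed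

lemma der_mus_form:
  assumes w: "w \<in> total"
  defines "x \<equiv> base_part w" and "K \<equiv> vertical_part g w" and "K' \<equiv> \<lambda>A C. der (\<lambda>w. vertical_part g w A) w C"
  defines "D \<equiv> \<lambda>A C. der (\<lambda>x. der \<phi> x (K A)) x (base_part C) + der \<phi> x (K' A C)"
  shows "der (\<lambda>w. mus_form g \<phi> w A B) w C
    = form (der g x (base_part C)) (base_part A) (base_part B)
    + (form (der g x (base_part C)) (K A) (K B) + form (g x) (K' A C) (K B) + form (g x) (K A) (K' B C))
    + (der \<phi> x (K A) * D B C + D A C * der \<phi> x (K B))"
proof -
  have x: "base_part w \<in> S" using w by simp
  have dg: "(\<lambda>w. g (base_part w)) differentiable (at w)"
    "der (\<lambda>w. g (base_part w)) w C = der g x (base_part C)"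
    using der_base_compose[OF diff_g[OF x]] by (simp_all add: x_def)
  have dK: "(\<lambda>w. vertical_part g w A) differentiable (at w)" for A
    by (rule smooth_on_differentiable[OF smooth_vertical_part w])
  have dP: "(\<lambda>w. der \<phi> (base_part w) (vertical_part g w A)) differentiable (at w)" for A
    by (rule smooth_on_differentiable[OF smooth_der_vertical w])
  have dc: "(\<lambda>_. c) differentiable (at w)" for c :: "real ^ 'n" by simp
  have D: "der (\<lambda>w. der \<phi> (base_part w) (vertical_part g w A)) w C = D A C" for A
  proof -
    have lin: "linear (der \<phi> (base_part w))" if "w \<in> total" for w using that by (simp add: der_\<phi>_linear)
    have d\<phi>: "(\<lambda>x. der \<phi> x \<eta>) differentiable (at (base_part w))" for \<eta>
      by (rule smooth_on_differentiable[OF smooth_on_der[OF smooth_\<phi>] x])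
    have d: "(\<lambda>w. der \<phi> (base_part w) \<eta>) differentiable (at w)" for \<eta>
      by (rule der_base_compose(2)[OF d\<phi>])
    have "der (\<lambda>w. der \<phi> (base_part w) (vertical_part g w A)) w C
        = der (\<lambda>v. der \<phi> (base_part v) (vertical_part g w A)) w C
          + der \<phi> (base_part w) (der (\<lambda>w. vertical_part g w A) w C)"
      by (rule differentiable_linear_family(2)[where F = "\<lambda>w. der \<phi> (base_part w)", OF open_total w lin d dK])
    also have "der (\<lambda>v. der \<phi> (base_part v) (vertical_part g w A)) w C
        = der (\<lambda>x. der \<phi> x (vertical_part g w A)) (base_part w) (base_part C)"
      by (rule der_base_compose(1)[OF d\<phi>])
    finally show ?thesis by (simp add: D_def K_def K'_def x_def)
  qed
  note f1 = der_form[OF dg(1) dc[of "base_part A"] dc[of "base_part B"]]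
  note f2 = der_form[OF dg(1) dK[of A] dK[of B]]
  note f3 = bounded_bilinear.differentiable_prod[OF bounded_bilinear_mult dP[of A] dP[of B]]
    bounded_bilinear.der_prod[OF bounded_bilinear_mult dP[of A] dP[of B]]
  have "der (\<lambda>w. mus_form g \<phi> w A B) w C
      = der (\<lambda>w. form (g (base_part w)) (base_part A) (base_part B)) w C
      + der (\<lambda>w. form (g (base_part w)) (vertical_part g w A) (vertical_part g w B)) w C
      + der (\<lambda>w. der \<phi> (base_part w) (vertical_part g w A) * der \<phi> (base_part w) (vertical_part g w B)) w C"
    unfolding mus_form_def
    by (simp only: der_add[OF f1(1) f2(1)] der_add[OF differentiable_add[OF f1(1) f2(1)] f3(1)])
  then show ?thesis
    unfolding f1(2) f2(2) f3(2) D dg(2) by (simp add: K_def K'_def x_def)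
qed

end

text \<open>\<open>G\<close> is the matrix of the Mus-Gradient metric in the induced coordinates. The Koszul formula is
  evaluated against horizontal vectors only, as \<open>G\<close> restricted to them is \<open>g\<close>.\<close>

locale coord_mus_matrix = coord_mus S g \<phi> for S and g :: "real ^ 'n::finite \<Rightarrow> real ^ 'n ^ 'n" and \<phi> +
  fixes G :: "real ^ ('n + 'n) \<Rightarrow> real ^ ('n + 'n) ^ ('n + 'n)"
  assumes G_metric: "coord_metric total G"
    and G_form: "w \<in> total \<Longrightarrow> form (G w) A B = mus_form g \<phi> w A B"
begin

sublocale G: coord_metric total G
  by (rule G_metric)

lemma form_der_G:
  assumes w: "w \<in> total"
  shows "form (der G w C) A B = der (\<lambda>w. mus_form g \<phi> w A B) w C"
proof -
  have "der (\<lambda>w. form (G w) A B) w = der (\<lambda>w. mus_form g \<phi> w A B) w"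
    using G_form by (rule der_cong[OF open_total w])
  then show ?thesis
    using der_bounded_linear[OF bounded_linear_form G.diff_g[OF w], of A B C] by simp
qed

lemma form_horizontal:
  assumes w: "w \<in> total"
  shows "form (G w) A (horizontal g w \<xi>) = form (g (base_part w)) (base_part A) \<xi>"
  using w by (simp add: G_form mus_form_def linear_0[OF der_\<phi>_linear])

text \<open>The vertical parts enter the metric as products. Those of horizontal vectors vanish at \<open>w\<close>, so the products
  vanish there to second order, and the Koszul formula reduces to that of \<open>g\<close>.\<close>

lemma chr_horizontal:
  assumes w: "w \<in> total"
  shows "base_part (chr G w (horizontal g w \<beta>) (horizontal g w \<beta>)) = chr g (base_part w) \<beta> \<beta>"
proof -
  have x: "base_part w \<in> S" using w by simp
  show ?thesis
  proof (rule form_cancel[OF x])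
    fix \<xi>
    have "2 * form (g (base_part w)) (base_part (chr G w (horizontal g w \<beta>) (horizontal g w \<beta>))) \<xi>
        = koszul G w (horizontal g w \<beta>) (horizontal g w \<beta>) (horizontal g w \<xi>)"
      unfolding form_horizontal[OF w, symmetric] by (rule G.chr_koszul[OF w])
    also have "\<dots> = koszul g (base_part w) \<beta> \<beta> \<xi>"
      using x by (simp add: koszul_def form_der_G[OF w] der_mus_form[OF w] linear_0[OF der_\<phi>_linear])
    also have "\<dots> = 2 * form (g (base_part w)) (chr g (base_part w) \<beta> \<beta>) \<xi>"
      by (rule chr_koszul[OF x, symmetric])
    finally show "form (g (base_part w)) (base_part (chr G w (horizontal g w \<beta>) (horizontal g w \<beta>))) \<xi>
        = form (g (base_part w)) (chr g (base_part w) \<beta> \<beta>) \<xi>" by simp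
  qed
qed

text \<open>Parallel transport preserves \<open>g\<close>, so the horizontal variation of the fibre metric
  \<open>g + df \<otimes> df\<close> only sees the covariant derivative of \<open>df\<close>, that is, the Hessian.\<close>

lemma chr_vertical:
  assumes w: "w \<in> total"
  defines "x \<equiv> base_part w"
  shows "form (g x) (base_part (chr G w (join 0 c) (join 0 c))) \<xi>
    = - (der \<phi> x c * form (g x) (cd g \<xi> (gradc g \<phi>) x) c)"
proof -
  let ?V = "join 0 c :: real ^ ('n + 'n)" and ?H = "horizontal g w \<xi>"
  have xS: "x \<in> S" using w by (simp add: x_def)
  have z: "chr g y 0 c = 0" if "y \<in> S" for y c by (simp add: chr_simps[OF that])
  have K0: "der (\<lambda>w. vertical_part g w ?V) w C = 0" for C
    using der_cong[OF open_total w, of "\<lambda>w. vertical_part g w ?V" "\<lambda>_. c"] by simp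
  have K1: "der (\<lambda>w. vertical_part g w ?H) w ?V = chr g x \<xi> c"
  proof -
    have "der (\<lambda>y. chr g y \<xi> (fibre_part w)) x 0 = 0" by (rule der_zero_vec[OF chr_differentiable[OF xS]])
    then show ?thesis by (simp add: der_vertical_part[OF w] x_def)
  qed
  have d\<phi>: "(\<lambda>y. der \<phi> y \<eta>) differentiable (at x)" for \<eta>
    by (rule smooth_on_differentiable[OF smooth_on_der[OF smooth_\<phi>] xS])
  have form0: "form 0 u v = 0" for u v :: "real ^ 'n" by (simp add: form_def)
  have "der g x 0 = 0" by (rule der_zero_vec[OF diff_g[OF xS]])
  then have 1: "form (der G w ?V) ?V ?H = form (g x) c (chr g x \<xi> c) + der \<phi> x c * der \<phi> x (chr g x \<xi> c)"
    using der_zero_vec[OF d\<phi>, of 0] w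
    by (simp add: form_der_G[OF w] der_mus_form[OF w] K0 K1 x_def[symmetric] linear_0[OF der_\<phi>_linear[OF xS]] form0)
  have 2: "form (der G w ?H) ?V ?V = form (der g x \<xi>) c c + 2 * (der \<phi> x c * der (\<lambda>y. der \<phi> y c) x \<xi>)"
    using w by (simp add: form_der_G[OF w] der_mus_form[OF w] K0 x_def[symmetric] linear_0[OF der_\<phi>_linear[OF xS]])
  have sF: "smooth_on S (gradc g \<phi>)" by (rule smooth_gradc[OF smooth_\<phi>])
  have F: "form (g y) (gradc g \<phi> y) \<zeta> = der \<phi> y \<zeta>" if "y \<in> S" for y \<zeta>
    by (rule gradc_form[OF that smooth_on_differentiable[OF smooth_\<phi> that]])
  have hess: "form (g x) (cd g \<xi> (gradc g \<phi>) x) c = der (\<lambda>y. der \<phi> y c) x \<xi> - der \<phi> x (chr g x \<xi> c)"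
  proof -
    have "der (\<lambda>y. der \<phi> y c) x = der (\<lambda>y. form (g y) (gradc g \<phi> y) c) x"
      by (rule der_cong[OF open_S xS]) (simp add: F)
    then show ?thesis
      using der_form_cd[OF xS smooth_on_differentiable[OF sF xS], of "\<lambda>_. c" \<xi>] F[OF xS, of "chr g x \<xi> c"]
      by (simp add: cd_def)
  qed
  have "2 * form (g x) (base_part (chr G w ?V ?V)) \<xi> = koszul G w ?V ?V ?H"
    unfolding x_def form_horizontal[OF w, symmetric] by (rule G.chr_koszul[OF w])
  also have "\<dots> = - 2 * (der \<phi> x c * form (g x) (cd g \<xi> (gradc g \<phi>) x) c)"
    unfolding koszul_def 1 2 hess
    using metric_compatible[OF xS, of \<xi> c c] form_commute[OF xS, of "chr g x \<xi> c" c] by (simp add: algebra_simps)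
  finally show ?thesis by simp
qed

text \<open>In such a basis a trace over the bundle splits into a horizontal and a fibre trace. The second claim
  evaluates the one fibre trace that does not vanish.\<close>

lemma adapted_basis:
  assumes w: "w \<in> total" and b: "onb (g (base_part w)) b"
  obtains c where "onb (G w) (\<lambda>k. case k of Inl i \<Rightarrow> horizontal g w (b i) | Inr j \<Rightarrow> join 0 (c j))"
    and "\<And>Z. (\<Sum>i\<in>UNIV. der \<phi> (base_part w) (c i) * form (g (base_part w)) Z (c i))
      = form (g (base_part w)) (gradc g \<phi> (base_part w)) Z
        / (1 + form (g (base_part w)) (gradc g \<phi> (base_part w)) (gradc g \<phi> (base_part w)))"
proof -
  let ?A = "g (base_part w)" and ?F = "gradc g \<phi> (base_part w)"
  let ?r = "sqrt (1 + form ?A ?F ?F)"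
  define c where "c i = b i - (form ?A ?F (b i) / (?r * (1 + ?r))) *\<^sub>R ?F" for i
  have x: "base_part w \<in> S" using w by simp
  have F: "form ?A ?F \<zeta> = der \<phi> (base_part w) \<zeta>" for \<zeta>
    by (rule gradc_form[OF x smooth_on_differentiable[OF smooth_\<phi> x]])
  note sb = shrunk_basis[OF pos[OF x] b, where F = ?F, folded c_def, unfolded F]
  show ?thesis
  proof (rule that[of c])
    show "onb (G w) (\<lambda>k. case k of Inl i \<Rightarrow> horizontal g w (b i) | Inr j \<Rightarrow> join 0 (c j))"
      using w b sb(1)
      by (auto simp: onb_def G_form mus_form_def linear_0[OF der_\<phi>_linear] split: sum.split)
    show "(\<Sum>i\<in>UNIV. der \<phi> (base_part w) (c i) * form ?A Z (c i)) = form ?A ?F Z / (1 + form ?A ?F ?F)" for Z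
      using sb(2)[of Z] by (simp add: F)
  qed
qed

text \<open>In an adapted basis the vertical vectors project to 0 and the horizontal ones to an orthonormal
  basis: the projection is a Riemannian submersion.\<close>

lemma base_trace:
  fixes B :: "real ^ 'n \<Rightarrow> real ^ 'n \<Rightarrow> 'c::real_vector"
  assumes w: "w \<in> total" and b: "onb (g (base_part w)) b" and E: "onb (G w) E" and B: "bilinear B"
  shows "(\<Sum>a\<in>UNIV. B (base_part (E a)) (base_part (E a))) = (\<Sum>i\<in>UNIV. B (b i) (b i))"
proof -
  obtain c where c: "onb (G w) (\<lambda>k. case k of Inl i \<Rightarrow> horizontal g w (b i) | Inr j \<Rightarrow> join 0 (c j))" (is "onb _ ?E'")
    by (rule adapted_basis[OF w b])
  have B': "bilinear (\<lambda>A A'. B (base_part A) (base_part A'))"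
    unfolding bilinear_def
    by (auto intro!: linearI simp: bilinear_ladd[OF B] bilinear_radd[OF B] bilinear_lmul[OF B] bilinear_rmul[OF B])
  have "(\<Sum>a\<in>UNIV. B (base_part (E a)) (base_part (E a))) = (\<Sum>a\<in>UNIV. B (base_part (?E' a)) (base_part (?E' a)))"
    by (rule onb_trace_unique[OF c E G.pos[OF w] B'])
  also have "\<dots> = (\<Sum>i\<in>UNIV. B (b i) (b i))"
    by (simp add: sum_UNIV_sum_type bilinear_lzero[OF B])
  finally show ?thesis .
qed

text \<open>The tension of the projection: only the vertical vectors contribute, and they contribute half the
  logarithmic derivative of the determinant \<open>\<alpha>\<close> of the fibre metric relative to \<open>g\<close>.\<close>

lemma tension_coord:
  assumes w: "w \<in> total" and E: "onb (G w) E"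
  defines "x \<equiv> base_part w" and "F \<equiv> gradc g \<phi>"
  shows "(\<Sum>a\<in>UNIV. chr g x (base_part (E a)) (base_part (E a)) - base_part (chr G w (E a) (E a)))
    = (1/2) *\<^sub>R gradc g (\<lambda>y. ln (1 + form (g y) (F y) (F y))) x" (is "?L = ?R")
proof -
  have xS: "x \<in> S" using w by (simp add: x_def)
  obtain b where b: "onb (g (base_part w)) b" using onb_exists[OF pos[OF xS]] by (auto simp: x_def)
  obtain c where c: "onb (G w) (\<lambda>k. case k of Inl i \<Rightarrow> horizontal g w (b i) | Inr j \<Rightarrow> join 0 (c j))" (is "onb _ ?E'")
    and "\<And>Z. (\<Sum>i\<in>UNIV. der \<phi> (base_part w) (c i) * form (g (base_part w)) Z (c i))
      = form (g (base_part w)) (gradc g \<phi> (base_part w)) Z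
        / (1 + form (g (base_part w)) (gradc g \<phi> (base_part w)) (gradc g \<phi> (base_part w)))"
    by (rule adapted_basis[OF w b]) (rule that)
  note csum = this(2)[folded x_def F_def]
  let ?T = "\<lambda>A A'. chr g x (base_part A) (base_part A') - base_part (chr G w A A')"
  have T: "bilinear ?T"
    unfolding bilinear_def by (auto intro!: linearI simp: chr_simps[OF xS] G.chr_simps[OF w] scaleR_diff_right)
  have L: "?L = - (\<Sum>i\<in>UNIV. base_part (chr G w (join 0 (c i)) (join 0 (c i))))"
  proof -
    have "?L = (\<Sum>a\<in>UNIV. ?T (?E' a) (?E' a))" by (rule onb_trace_unique[OF c E G.pos[OF w] T])
    also have "\<dots> = (\<Sum>i\<in>UNIV. ?T (join 0 (c i)) (join 0 (c i)))"
      by (simp add: sum_UNIV_sum_type chr_horizontal[OF w] x_def)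
    finally show ?thesis by (simp add: chr_simps[OF xS] sum_negf)
  qed
  have sF: "smooth_on S F" unfolding F_def by (rule smooth_gradc[OF smooth_\<phi>])
  have dF: "F differentiable (at x)" by (rule smooth_on_differentiable[OF sF xS])
  have F0: "form (g y) (F y) (F y) \<ge> 0" if "y \<in> S" for y
    using pos[OF that] unfolding pos_form_def by (cases "F y = 0") (auto intro: less_imp_le)
  let ?q = "\<lambda>y. form (g y) (F y) (F y)"
  have dq: "?q differentiable (at x)" by (rule der_form(1)[OF diff_g[OF xS] dF dF])
  have lnq: "((\<lambda>y. ln (1 + ?q y)) has_derivative (\<lambda>\<xi>. der ?q x \<xi> / (1 + ?q x))) (at x)"
    using F0[OF xS] by (auto intro!: derivative_eq_intros der_has_derivative[OF dq] simp: field_simps)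
  show ?thesis
  proof (rule form_cancel[OF xS])
    fix \<xi>
    let ?Z = "cd g \<xi> F x"
    have "form (g x) ?L \<xi> = (\<Sum>i\<in>UNIV. der \<phi> x (c i) * form (g x) ?Z (c i))"
      unfolding L using chr_vertical[OF w] by (simp add: form_sum x_def F_def sum_negf)
    also have "\<dots> = form (g x) (F x) ?Z / (1 + ?q x)" by (rule csum)
    also have "\<dots> = (1/2) * der (\<lambda>y. ln (1 + ?q y)) x \<xi>"
      unfolding der_eq[OF lnq] der_form_cd[OF xS dF dF] using form_commute[OF xS, of ?Z "F x"] by (simp add: field_simps)
    also have "\<dots> = form (g x) ?R \<xi>"
      using gradc_form[OF xS, of "\<lambda>y. ln (1 + ?q y)" \<xi>] lnq by (simp add: differentiableI)
    finally show "form (g x) ?L \<xi> = form (g x) ?R \<xi>" .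
  qed
qed

end


section \<open>The Mus-Gradient bundle as a Riemannian manifold\<close>

locale mus_bundle = riem_atlas M for M :: "('a, 'n::finite, 'z) riem_mfd_scheme" +
  fixes f :: "'a \<Rightarrow> real"
  assumes smooth_f: "smooth_function M f"
begin

abbreviation "T \<equiv> tangent_bundle M"
abbreviation "P \<equiv> mus_gradient_bundle M f"

lemma P_simps:
  "atlas P = atlas T" "topo P = topo T" "charts_at P z = charts_at T z"
  "tangent_space P z = tangent_space T z" "tangent_of P = tangent_of T"
  by (simp_all add: mus_gradient_bundle_def charts_at_def tangent_space_def tangent_of_def fun_eq_iff)

sublocale T: smooth_atlas T
  by (rule smooth_atlas_tangent_bundle)

lemma coord_mus_chart: "c \<in> atlas M \<Longrightarrow> coord_mus (img c) (metric_matrix M c) (\<lambda>x. f (cinv c x))"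
  using smooth_f coord_metric_chart by (simp add: coord_mus_def coord_mus_axioms_def smooth_function_def)

lemma induced_parts [simp]:
  "base_part (cmap (induced_chart M c) z) = cmap c (fst z)" "fibre_part (cmap (induced_chart M c) z) = snd z c"
  by (simp_all add: induced_chart_cmap)

lemma fst_points: "z \<in> points T \<Longrightarrow> fst z \<in> points M"
  by (simp add: points_tangent_bundle)

lemma total_chart: "c \<in> charts_at M (fst z) \<Longrightarrow> cmap (induced_chart M c) z \<in> {w. base_part w \<in> img c}"
  using in_img by simp

text \<open>The transformation law of the Christoffel symbols makes the lifts independent of the chart.\<close>

lemma lifts_chart:
  assumes z: "z \<in> points T" and c: "c \<in> charts_at M (fst z)" and X: "X \<in> tangent_space M (fst z)"
  shows "hlift M z X \<in> tangent_space T z" "vlift M z X \<in> tangent_space T z"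
    and "hlift M z X (induced_chart M c) = horizontal (metric_matrix M c) (cmap (induced_chart M c) z) (X c)"
    and "vlift M z X (induced_chart M c) = join 0 (X c)"
proof -
  let ?b = "chart_at M (fst z)"
  have b: "?b \<in> charts_at M (fst z)" by (rule chart_at[OF fst_points[OF z]])
  note ib = induced_charts_at[OF z b] and ic = induced_charts_at[OF z c]
  have u: "snd z \<in> tangent_space M (fst z)" using z by (simp add: points_tangent_bundle)
  have lin: "der (transition ?b c) (cmap ?b (fst z)) (- v) = - der (transition ?b c) (cmap ?b (fst z)) v"
    "der (transition ?b c) (cmap ?b (fst z)) 0 = 0" for v
    using transition_differentiable[OF b c] by (simp_all add: linear_frechet_derivative linear_neg)
  have d0: "der (\<lambda>x. der (transition ?b c) x (snd z ?b)) (cmap ?b (fst z)) 0 = 0"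
  proof (rule der_zero_vec)
    note a = charts_atD(1)[OF b] charts_atD(1)[OF c]
    show "(\<lambda>x. der (transition ?b c) x (snd z ?b)) differentiable (at (cmap ?b (fst z)))"
      by (rule smooth_on_differentiable[OF smooth_on_der[OF transition_smooth[OF a]] in_overlap[OF b c]])
  qed
  show "hlift M z X \<in> tangent_space T z" "vlift M z X \<in> tangent_space T z"
    unfolding hlift_def vlift_def Let_def by (rule T.tangent_of_tangent[OF ib])+
  show "hlift M z X (induced_chart M c) = horizontal (metric_matrix M c) (cmap (induced_chart M c) z) (X c)"
    unfolding hlift_def Let_def T.tangent_of_other[OF ic] der_induced_transition[OF z b c]
      christoffel_term_chart[OF b] join_parts lin chr_transition[OF b c]
      tangent_change[OF X b c] tangent_change[OF u b c] horizontal_def induced_parts by simp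
  show "vlift M z X (induced_chart M c) = join 0 (X c)"
    unfolding vlift_def Let_def T.tangent_of_other[OF ic] der_induced_transition[OF z b c]
      join_parts lin d0 tangent_change[OF X b c] by simp
qed

text \<open>The form is written down in the preferred chart, where the lifts are defined.\<close>

lemma mus_gradient_form_exists:
  assumes z: "z \<in> points T"
  shows "\<exists>G. mus_gradient_form M f z G"
proof -
  let ?p = "fst z" and ?c = "chart_at M (fst z)"
  let ?C = "induced_chart M ?c"
  have p: "?p \<in> points M" by (rule fst_points[OF z])
  have c: "?c \<in> charts_at M ?p" by (rule chart_at[OF p])
  interpret c: coord_mus "img ?c" "metric_matrix M ?c" "\<lambda>x. f (cinv ?c x)"
    by (rule coord_mus_chart[OF charts_atD(1)[OF c]])
  note w = total_chart[OF c]
  let ?m = "mus_form (metric_matrix M ?c) (\<lambda>x. f (cinv ?c x)) (cmap ?C z)"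
  note lz = linear_0[OF c.der_\<phi>_linear[OF in_img[OF c]]]
  have dirf: "dir M ?p X f = der (\<lambda>x. f (cinv ?c x)) (cmap ?c ?p) (X ?c)" if "X \<in> tangent_space M ?p" for X
    by (rule dir_chart[OF c that smooth_function_differentiable[OF smooth_f c]])
  have "mus_gradient_form M f z (\<lambda>A B. ?m (A ?C) (B ?C))"
    unfolding mus_gradient_form_def
  proof (intro conjI ballI)
    note bil = bilinear_ladd[OF c.mus_form_bilinear[OF w]] bilinear_radd[OF c.mus_form_bilinear[OF w]]
      bilinear_lmul[OF c.mus_form_bilinear[OF w]] bilinear_rmul[OF c.mus_form_bilinear[OF w]]
    show "tangent_bilinear T z (\<lambda>A B. ?m (A ?C) (B ?C))" unfolding tangent_bilinear_def bil by simp
    show "tangent_symmetric T z (\<lambda>A B. ?m (A ?C) (B ?C))"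
      unfolding tangent_symmetric_def using c.mus_form_commute[OF w] by blast
    fix X Y assume X: "X \<in> tangent_space M ?p" and Y: "Y \<in> tangent_space M ?p"
    show "?m (hlift M z X ?C) (hlift M z Y ?C) = riem M ?p X Y"
      "?m (hlift M z X ?C) (vlift M z Y ?C) = 0"
      "?m (vlift M z X ?C) (vlift M z Y ?C) = riem M ?p X Y + dir M ?p X f * dir M ?p Y f"
      unfolding lifts_chart(3,4)[OF z c X] lifts_chart(3,4)[OF z c Y] riem_chart[OF c X Y] dirf[OF X] dirf[OF Y] mus_form_def
      using lz c.vertical_part_join[OF w] by simp_all
  qed
  then show ?thesis by blast
qed

text \<open>Every tangent vector of the bundle is the sum of a horizontal and a vertical lift, so the defining
  identities leave no choice; as the lifts do not depend on the chart, neither does the formula.\<close>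

lemma mus_gradient_form_chart:
  assumes z: "z \<in> points T" and c: "c \<in> charts_at M (fst z)" and G: "mus_gradient_form M f z G"
    and A: "A \<in> tangent_space T z" and B: "B \<in> tangent_space T z"
  shows "G A B = mus_form (metric_matrix M c) (\<lambda>x. f (cinv c x)) (cmap (induced_chart M c) z)
    (A (induced_chart M c)) (B (induced_chart M c))"
proof -
  let ?p = "fst z" and ?C = "induced_chart M c" and ?g = "metric_matrix M c"
  let ?w = "cmap (induced_chart M c) z"
  interpret c: coord_mus "img c" ?g "\<lambda>x. f (cinv c x)" by (rule coord_mus_chart[OF charts_atD(1)[OF c]])
  note w = total_chart[OF c]
  define X where "X A = tangent_of M ?p c (base_part (A ?C))" for A :: "('a \<times> ('a, 'n) tvec, 'n + 'n) tvec"
  define Y where "Y A = tangent_of M ?p c (vertical_part ?g ?w (A ?C))" for A :: "('a \<times> ('a, 'n) tvec, 'n + 'n) tvec"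
  have XY: "X A \<in> tangent_space M ?p" "Y A \<in> tangent_space M ?p" for A
    unfolding X_def Y_def by (rule tangent_of_tangent[OF c])+
  note L = lifts_chart[OF z c XY(1)] lifts_chart[OF z c XY(2)]
  have split: "A = (\<lambda>d. hlift M z (X A) d + 1 *\<^sub>R vlift M z (Y A) d)" if "A \<in> tangent_space T z" for A
  proof (rule T.tangent_eqI[OF that _ induced_charts_at[OF z c]])
    show "(\<lambda>d. hlift M z (X A) d + 1 *\<^sub>R vlift M z (Y A) d) \<in> tangent_space T z"
      by (rule T.tangent_combination[OF L(1) L(6)])
    show "A ?C = hlift M z (X A) ?C + 1 *\<^sub>R vlift M z (Y A) ?C"
      unfolding L(3) L(8)
      by (rule parts_eqI)
        (simp_all add: X_def Y_def tangent_of_at[OF c] horizontal_def vertical_part_def)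
  qed
  have dirf: "dir M ?p (Y A) f = der (\<lambda>x. f (cinv c x)) (cmap c ?p) (Y A c)" for A
    by (rule dir_chart[OF c XY(2) smooth_function_differentiable[OF smooth_f c]])
  have tb: "tangent_bilinear T z G" using G unfolding mus_gradient_form_def by (rule conjunct1)
  have bil: "G (\<lambda>c. u c + 1 *\<^sub>R v c) w = G u w + G v w" "G w (\<lambda>c. u c + 1 *\<^sub>R v c) = G w u + G w v"
    if "u \<in> tangent_space T z" "v \<in> tangent_space T z" "w \<in> tangent_space T z" for u v w
    using tb[unfolded tangent_bilinear_def, rule_format, OF that, of 1] by simp_all
  have sym: "G u v = G v u" if "u \<in> tangent_space T z" "v \<in> tangent_space T z" for u v
    using G that unfolding mus_gradient_form_def tangent_symmetric_def by blast
  have vals: "G (hlift M z X) (hlift M z Y) = riem M ?p X Y" "G (hlift M z X) (vlift M z Y) = 0"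
    "G (vlift M z X) (vlift M z Y) = riem M ?p X Y + dir M ?p X f * dir M ?p Y f"
    if "X \<in> tangent_space M ?p" "Y \<in> tangent_space M ?p" for X Y
    using G that unfolding mus_gradient_form_def by blast+
  have cross: "G (vlift M z (Y A)) (hlift M z (X B)) = 0"
    using sym[OF L(6) L(1)] vals(2)[OF XY(1) XY(2)] by simp
  have "G A B = G (\<lambda>d. hlift M z (X A) d + 1 *\<^sub>R vlift M z (Y A) d) (\<lambda>d. hlift M z (X B) d + 1 *\<^sub>R vlift M z (Y B) d)"
    using split[OF A] split[OF B] by simp
  also have "\<dots> = G (hlift M z (X A)) (hlift M z (X B)) + G (hlift M z (X A)) (vlift M z (Y B))
      + (G (vlift M z (Y A)) (hlift M z (X B)) + G (vlift M z (Y A)) (vlift M z (Y B)))"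
    by (simp only: bil(1)[OF L(1) L(6) T.tangent_combination[OF L(1) L(6)]]
        bil(2)[OF L(1) L(6) L(1)] bil(2)[OF L(1) L(6) L(6)])
  also have "\<dots> = mus_form ?g (\<lambda>x. f (cinv c x)) ?w (A ?C) (B ?C)"
    unfolding vals(1)[OF XY(1) XY(1)] vals(2)[OF XY(1) XY(2)] vals(3)[OF XY(2) XY(2)] cross dirf
      riem_chart[OF c XY(1) XY(1)] riem_chart[OF c XY(2) XY(2)]
    by (simp add: mus_form_def X_def Y_def tangent_of_at[OF c])
  finally show ?thesis .
qed

lemma riem_P_chart:
  assumes z: "z \<in> points T" and c: "c \<in> charts_at M (fst z)"
    and A: "A \<in> tangent_space T z" and B: "B \<in> tangent_space T z"
  shows "riem P z A B = mus_form (metric_matrix M c) (\<lambda>x. f (cinv c x)) (cmap (induced_chart M c) z)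
    (A (induced_chart M c)) (B (induced_chart M c))"
  by (rule mus_gradient_form_chart[OF z c _ A B])
    (simp add: mus_gradient_bundle_def someI_ex[OF mus_gradient_form_exists[OF z]])

lemma metric_matrix_P:
  assumes c: "c \<in> atlas M" and w: "w \<in> {w. base_part w \<in> img c}"
  shows "form (metric_matrix P (induced_chart M c) w) A B = mus_form (metric_matrix M c) (\<lambda>x. f (cinv c x)) w A B"
proof -
  let ?C = "induced_chart M c"
  interpret c: coord_mus "img c" "metric_matrix M c" "\<lambda>x. f (cinv c x)" by (rule coord_mus_chart[OF c])
  have C: "?C \<in> atlas T" using c by (simp add: atlas_tangent_bundle)
  have wC: "w \<in> img ?C" using w by (simp only: induced_chart_img(1)[OF c])
  let ?z = "cinv ?C w"
  have z: "?C \<in> charts_at T ?z" and zw: "cmap ?C ?z = w"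
    using T.charts_at_cinv[OF C wC] T.cmap_cinv(1)[OF wC] by auto
  have cz: "c \<in> charts_at M (fst ?z)"
    using c T.charts_atD(2)[OF z] by (simp add: charts_at_def induced_chart_cdom)
  note t = T.tangent_of_tangent[OF z]
  have ax: "form (metric_matrix P ?C w) (axis i 1) (axis j 1)
      = mus_form (metric_matrix M c) (\<lambda>x. f (cinv c x)) w (axis i 1) (axis j 1)" for i j
    using riem_P_chart[OF T.charts_at_points[OF z] cz t t, of "axis i 1" "axis j 1"]
    by (simp only: form_axis metric_matrix_def vec_lambda_beta P_simps zw T.tangent_of_at[OF z])
  have l: "linear (\<lambda>A. mus_form (metric_matrix M c) (\<lambda>x. f (cinv c x)) w A B)"
    "linear (mus_form (metric_matrix M c) (\<lambda>x. f (cinv c x)) w A)" for A B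
    using c.mus_form_bilinear[OF w] by (simp_all add: bilinear_def)
  show ?thesis
    unfolding linear_family_expand[OF l(1), of A] linear_family_expand[OF form_linear(2), of _ A]
    unfolding linear_family_expand[OF l(2), of _ B] linear_family_expand[OF form_linear(1), of _ _ B] ax ..
qed

lemma riem_atlas_P: "riem_atlas P"
proof -
  have "smooth_atlas P"
    using T.smooth_atlas_axioms unfolding smooth_atlas_def P_simps .
  then interpret P: smooth_atlas P .
  show ?thesis
  proof
    fix z assume "z \<in> points P"
    then have z: "z \<in> points T" by (simp add: P_simps)
    have G: "mus_gradient_form M f z (riem P z)"
      by (simp add: mus_gradient_bundle_def someI_ex[OF mus_gradient_form_exists[OF z]])
    then show "tangent_bilinear P z (riem P z)" "tangent_symmetric P z (riem P z)"
      unfolding mus_gradient_form_def tangent_bilinear_def tangent_symmetric_def P_simps by blast+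
    fix A assume A: "A \<in> tangent_space P z" "A \<noteq> (\<lambda>_. 0)"
    then have At: "A \<in> tangent_space T z" by (simp add: P_simps)
    obtain c where c: "c \<in> charts_at M (fst z)" by (rule chart_of_points[OF fst_points[OF z]])
    interpret c: coord_mus "img c" "metric_matrix M c" "\<lambda>x. f (cinv c x)"
      by (rule coord_mus_chart[OF charts_atD(1)[OF c]])
    have "A (induced_chart M c) \<noteq> 0"
      using T.tangent_eqI[OF At T.tangent_zero induced_charts_at[OF z c]] A(2) by blast
    then show "0 < riem P z A A"
      unfolding riem_P_chart[OF z c At At] by (rule c.mus_form_pos[OF total_chart[OF c]])
  next
    fix C assume "C \<in> atlas P"
    then obtain c where c: "c \<in> atlas M" and C: "C = induced_chart M c"
      by (auto simp: P_simps atlas_tangent_bundle)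
    interpret c: coord_mus "img c" "metric_matrix M c" "\<lambda>x. f (cinv c x)" by (rule coord_mus_chart[OF c])
    have "smooth_on c.total (\<lambda>w. metric_matrix P C w $ i $ j)" for i j
      by (rule smooth_on_cong[THEN iffD1, OF c.open_total _ c.smooth_mus_form[of "axis i 1" "axis j 1"]])
        (simp add: metric_matrix_P[OF c, symmetric] form_axis C)
    then show "smooth_on (img C) (metric_matrix P C)"
      unfolding C induced_chart_img(1)[OF c] by (intro smooth_on_vec c.open_total)
  qed
qed

sublocale P: riem_atlas P
  by (rule riem_atlas_P)

lemma induced_charts_at_P: "z \<in> points T \<Longrightarrow> c \<in> charts_at M (fst z) \<Longrightarrow> induced_chart M c \<in> charts_at P z"
  by (simp add: induced_charts_at P_simps)

lemma coord_mus_matrix_chart: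
  assumes c: "c \<in> atlas M"
  shows "coord_mus_matrix (img c) (metric_matrix M c) (\<lambda>x. f (cinv c x)) (metric_matrix P (induced_chart M c))"
proof -
  have "coord_metric {w. base_part w \<in> img c} (metric_matrix P (induced_chart M c))"
    using P.coord_metric_chart[of "induced_chart M c"] c
    unfolding induced_chart_img(1)[OF c] by (simp add: P_simps atlas_tangent_bundle)
  then show ?thesis
    using coord_mus_chart[OF c] metric_matrix_P[OF c]
    by (simp add: coord_mus_matrix_def coord_mus_matrix_axioms_def)
qed

end


section \<open>The tension and bitension fields of the projection\<close>

context mus_bundle
begin

lemma fst_cinv_induced: "c \<in> atlas M \<Longrightarrow> base_part w \<in> img c \<Longrightarrow> fst (cinv (induced_chart M c) w) = cinv c (base_part w)"
  by (simp add: induced_chart_cinv)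

lemma induced_point:
  assumes d: "d \<in> atlas M" and w: "base_part w \<in> img d"
  shows "cinv (induced_chart M d) w \<in> points T" "d \<in> charts_at M (fst (cinv (induced_chart M d) w))"
proof -
  have "induced_chart M d \<in> charts_at T (cinv (induced_chart M d) w)"
    using w d induced_chart_img(1)[OF d] by (intro T.charts_at_cinv) (auto simp: atlas_tangent_bundle)
  then show "cinv (induced_chart M d) w \<in> points T" by (rule T.charts_at_points)
  show "d \<in> charts_at M (fst (cinv (induced_chart M d) w))"
    using fst_cinv_induced[OF d w] charts_at_cinv[OF d w] by simp
qed

lemma open_base_preimage:
  assumes U: "openin (topo M) U"
  shows "openin (topo T) {z \<in> points T. fst z \<in> U}"
proof -
  let ?V = "\<lambda>c. {z \<in> cdom (induced_chart M c). cmap (induced_chart M c) z \<in> {w. base_part w \<in> cmap c ` (U \<inter> cdom c)}}"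
  have "openin (topo T) (?V c)" if "c \<in> atlas M" for c
    by (intro open_tangent_bundle_basic that smooth_on_base(2)[OF chart_image_open[OF that U] smooth_on_const])
  then have "openin (topo T) (\<Union>c\<in>atlas M. ?V c)" by blast
  moreover have "{z \<in> points T. fst z \<in> U} = (\<Union>c\<in>atlas M. ?V c)"
  proof (intro equalityI subsetI)
    fix z assume z: "z \<in> {z \<in> points T. fst z \<in> U}"
    then obtain c where "c \<in> charts_at M (fst z)" using chart_of_points fst_points by blast
    then show "z \<in> (\<Union>c\<in>atlas M. ?V c)"
      using z by (intro UN_I[of c]) (auto simp: charts_at_def induced_chart_cdom points_tangent_bundle)
  next
    fix z assume "z \<in> (\<Union>c\<in>atlas M. ?V c)"
    then obtain c where c: "c \<in> atlas M" and z: "z \<in> cdom (induced_chart M c)"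
      "cmap c (fst z) \<in> cmap c ` (U \<inter> cdom c)" by auto
    have "fst z \<in> U"
      using z inj_on_image_mem_iff[OF chart_inj[OF c], of "fst z" "U \<inter> cdom c"] by (simp add: induced_chart_cdom)
    moreover have "fst z \<in> points M" using z(1) c chart_cover induced_chart_cdom by blast
    ultimately show "z \<in> {z \<in> points T. fst z \<in> U}"
      using z(1) by (simp add: points_tangent_bundle induced_chart_cdom)
  qed
  ultimately show ?thesis by simp
qed

text \<open>In induced coordinates the projection is a linear projection followed by a transition map of \<open>M\<close>.\<close>

lemma smooth_projection: "smooth_map P M fst"
  unfolding smooth_map_def P_simps
proof (intro conjI ballI)
  show "continuous_map (topo T) (topo M) fst"
    unfolding continuous_map_def using open_base_preimage fst_points by auto
  fix C d assume "C \<in> atlas T" and d: "d \<in> atlas M"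
  then obtain c where c: "c \<in> atlas M" and C: "C = induced_chart M c" by (auto simp: atlas_tangent_bundle)
  have dom: "{z \<in> cdom (induced_chart M c). fst z \<in> cdom d} = cdom (induced_chart M c) \<inter> cdom (induced_chart M d)"
    by (auto simp: induced_chart_cdom)
  note sb = smooth_on_base[OF open_overlap[OF c d] transition_smooth[OF c d]]
  show "smooth_on (cmap C ` {z \<in> cdom C. fst z \<in> cdom d}) (\<lambda>x. cmap d (fst (cinv C x)))"
    unfolding C dom induced_chart_img(2)[OF c]
    by (rule smooth_on_cong[THEN iffD1, OF sb(2) _ sb(1)]) (auto simp: fst_cinv_induced[OF c])
qed

lemma differential_chart:
  assumes z: "z \<in> points T" and v: "v \<in> tangent_space T z" and d: "d \<in> charts_at M (fst z)"
  shows "differential P M fst z v d = base_part (v (induced_chart M d))"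
proof -
  let ?D = "induced_chart M d" and ?w = "cmap (induced_chart M d) z"
  have da: "d \<in> atlas M" by (rule charts_atD(1)[OF d])
  let ?O = "{w :: real ^ ('n + 'n). base_part w \<in> img d}"
  have o: "open ?O" by (rule smooth_on_base(2)[OF open_img[OF da] smooth_on_const])
  have w: "?w \<in> ?O" by (rule total_chart[OF d])
  have e: "cmap d (fst (cinv ?D w)) = base_part w" if "w \<in> ?O" for w
    using that fst_cinv_induced[OF da, of w] cmap_cinv(1)[of "base_part w" d] by simp
  have "(\<lambda>w. cmap d (fst (cinv ?D w))) differentiable (at ?w)"
    using differentiable_cong_open[OF o w e] bounded_linear_differentiable[OF bounded_linear_parts(1)] by simp
  moreover have "der (\<lambda>w. cmap d (fst (cinv ?D w))) ?w = der base_part ?w" by (rule der_cong[OF o w e])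
  ultimately have "dir P z v (\<lambda>q. cmap d (fst q)) = base_part (v ?D)"
    using P.dir_chart[OF induced_charts_at_P[OF z d], of v "\<lambda>q. cmap d (fst q)"] v
    by (simp add: P_simps der_linear[OF bounded_linear_parts(1)])
  then show ?thesis using d by (simp add: differential_def)
qed

lemma differential_tangent:
  assumes z: "z \<in> points T" and v: "v \<in> tangent_space T z"
  shows "differential P M fst z v \<in> tangent_space M (fst z)"
  unfolding tangent_space_def
proof (intro CollectI conjI ballI allI impI)
  show "differential P M fst z v d = 0" if "d \<notin> charts_at M (fst z)" for d using that by (simp add: differential_def)
  fix c d assume c: "c \<in> charts_at M (fst z)" and d: "d \<in> charts_at M (fst z)"
  have "v (induced_chart M d) = der (transition (induced_chart M c) (induced_chart M d)) (cmap (induced_chart M c) z) (v (induced_chart M c))"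
    by (rule T.tangent_change[OF v induced_charts_at[OF z c] induced_charts_at[OF z d], symmetric])
  then have "base_part (v (induced_chart M d)) = der (transition c d) (cmap c (fst z)) (base_part (v (induced_chart M c)))"
    unfolding der_induced_transition[OF z c d] by simp
  then show "differential P M fst z v d = der (transition c d) (cmap c (fst z)) (differential P M fst z v c)"
    unfolding differential_chart[OF z v c] differential_chart[OF z v d] .
qed

text \<open>What is used of an orthonormal frame of the bundle around \<open>z\<close>, in the chart induced by \<open>d\<close>.\<close>

lemma frame_chart:
  assumes z: "z \<in> points T" and d: "d \<in> charts_at M (fst z)"
  obtains W where "open W" "cmap (induced_chart M d) z \<in> W" "W \<subseteq> {w. base_part w \<in> img d}"
    "\<And>w i. w \<in> W \<Longrightarrow> frame_at P z i (cinv (induced_chart M d) w) \<in> tangent_space T (cinv (induced_chart M d) w)"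
    "\<And>i. frame_at P z i z \<in> tangent_space T z"
    "\<And>i. cov P z (frame_at P z i z) (frame_at P z i) \<in> tangent_space T z"
    "\<And>i. (\<lambda>w. frame_at P z i (cinv (induced_chart M d) w) (induced_chart M d)) differentiable (at (cmap (induced_chart M d) z))"
    "onb (metric_matrix P (induced_chart M d) (cmap (induced_chart M d) z)) (\<lambda>i. frame_at P z i z (induced_chart M d))"
proof -
  let ?e = "frame_at P z" and ?D = "induced_chart M d"
  have da: "d \<in> atlas M" by (rule charts_atD(1)[OF d])
  have zP: "z \<in> points P" using z by (simp add: P_simps)
  have D: "?D \<in> charts_at P z" by (rule induced_charts_at_P[OF z d])
  obtain U where U: "openin (topo P) U" "z \<in> U" "\<And>i. smooth_field_on P U (?e i)"
    "\<And>q i. q \<in> U \<Longrightarrow> ?e i q \<in> tangent_space P q"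
    "\<And>q c. q \<in> U \<Longrightarrow> c \<in> charts_at P q \<Longrightarrow> onb (metric_matrix P c (cmap c q)) (\<lambda>i. ?e i q c)"
    using P.orthonormal_frameE[OF P.frame_at[OF zP]] by metis
  let ?W = "cmap ?D ` (U \<inter> cdom ?D)"
  show ?thesis
  proof (rule that[of ?W])
    show "open ?W" by (rule P.chart_image_open[OF P.charts_atD(1)[OF D] U(1)])
    show "cmap ?D z \<in> ?W" using U(2) P.charts_atD(2)[OF D] by blast
    show "?W \<subseteq> {w. base_part w \<in> img d}" using induced_chart_img(1)[OF da] by blast
    show "?e i (cinv ?D w) \<in> tangent_space T (cinv ?D w)" if w: "w \<in> ?W" for w i
    proof -
      obtain q where "q \<in> U" "q \<in> cdom ?D" "w = cmap ?D q" using w by blast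
      then have "cinv ?D w \<in> U" using P.cinv_cmap[OF P.charts_atD(1)[OF D]] by simp
      then show ?thesis using U(4) by (simp add: P_simps)
    qed
    show t: "?e i z \<in> tangent_space T z" for i using U(4)[OF U(2)] by (simp add: P_simps)
    show "cov P z (?e i z) (?e i) \<in> tangent_space T z" for i
      using P.cov_tangent[OF U(4)[OF U(2)] U(1,2,3)] by (simp add: P_simps)
    show "(\<lambda>w. ?e i (cinv ?D w) ?D) differentiable (at (cmap ?D z))" for i
      by (rule P.smooth_field_at[OF U(3,1,2) D])
    show "onb (metric_matrix P ?D (cmap ?D z)) (\<lambda>i. ?e i z ?D)" by (rule U(5)[OF U(2) D])
  qed
qed

context
  fixes \<alpha> :: "'a \<Rightarrow> real"
  assumes \<alpha>: "\<And>p. p \<in> points M \<Longrightarrow> \<alpha> p = 1 + (tangent_norm M p (grad M f p))\<^sup>2"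
begin

lemma ln_\<alpha>_chart:
  assumes c: "c \<in> atlas M" and x: "x \<in> img c"
  defines "F \<equiv> gradc (metric_matrix M c) (\<lambda>x. f (cinv c x))"
  shows "ln (\<alpha> (cinv c x)) = ln (1 + form (metric_matrix M c x) (F x) (F x))"
proof -
  have cx: "c \<in> charts_at M (cinv c x)" by (rule charts_at_cinv[OF c x])
  note gt = grad_chart(1)[OF cx smooth_function_differentiable[OF smooth_f cx]]
  show ?thesis
    using \<alpha>[OF charts_at_points[OF cx]] tangent_norm_square[OF cx gt] grad_components[OF smooth_f c x]
    by (simp add: F_def cmap_cinv(1)[OF x])
qed

lemma smooth_ln_\<alpha>: "smooth_function M (\<lambda>q. ln (\<alpha> q))"
  unfolding smooth_function_def
proof
  fix c assume c: "c \<in> atlas M"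
  interpret c: coord_mus "img c" "metric_matrix M c" "\<lambda>x. f (cinv c x)" by (rule coord_mus_chart[OF c])
  let ?F = "gradc (metric_matrix M c) (\<lambda>x. f (cinv c x))"
  let ?q = "\<lambda>x. 1 + form (metric_matrix M c x) (?F x) (?F x)"
  have q: "smooth_on (img c) ?q"
    by (intro smooth_on_add smooth_on_form smooth_on_const c.open_S c.smooth_g c.smooth_gradc c.smooth_\<phi>)
  have "?q x > 0" if "x \<in> img c" for x
    using c.pos[OF that] unfolding pos_form_def by (cases "?F x = 0") (auto intro: add_pos_pos)
  then have "smooth_on (img c) (\<lambda>x. ln (?q x))"
    by (intro smooth_on_compose[OF c.open_S open_greaterThan q smooth_on_ln]) auto
  then show "smooth_on (img c) (\<lambda>x. ln (\<alpha> (cinv c x)))"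
    by (rule smooth_on_cong[THEN iffD1, OF c.open_S, rotated]) (simp add: ln_\<alpha>_chart[OF c])
qed

text \<open>The sum that both the tension and the bitension field produce.\<close>

lemma frame_trace_chart:
  assumes d: "d \<in> charts_at M (fst z)"
  defines "g \<equiv> metric_matrix M d" and "G \<equiv> metric_matrix P (induced_chart M d)"
    and "x \<equiv> cmap d (fst z)" and "w \<equiv> cmap (induced_chart M d) z"
  assumes E: "onb (G w) E"
  shows "(\<Sum>a\<in>UNIV. chr g x (base_part (E a)) (base_part (E a)) - base_part (chr G w (E a) (E a)))
    = (1/2) *\<^sub>R gradc g (\<lambda>y. ln (\<alpha> (cinv d y))) x"
proof -
  have da: "d \<in> atlas M" by (rule charts_atD(1)[OF d])
  interpret m: coord_mus_matrix "img d" g "\<lambda>x. f (cinv d x)" G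
    unfolding g_def G_def by (rule coord_mus_matrix_chart[OF da])
  let ?F = "gradc g (\<lambda>x. f (cinv d x))"
  have w: "w \<in> m.total" "base_part w = x" using total_chart[OF d] by (simp_all add: w_def x_def)
  have "gradc g (\<lambda>y. ln (1 + form (g y) (?F y) (?F y))) x = gradc g (\<lambda>y. ln (\<alpha> (cinv d y))) x"
    using in_img[OF d] by (intro gradc_cong[OF m.open_S]) (simp_all add: ln_\<alpha>_chart[OF da] x_def g_def)
  then show ?thesis using m.tension_coord[OF w(1) E] by (simp add: w(2))
qed

text \<open>The derivatives of the frame cancel between the two terms of the tension field, because in induced
  coordinates the projection is linear; what remains is a trace of Christoffel symbols.\<close>

lemma tension_projection:
  assumes z: "z \<in> points T"
  shows "tension P M fst z = (\<lambda>d. (1/2) *\<^sub>R grad M (\<lambda>q. ln (\<alpha> q)) (fst z) d)"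
proof (rule ext)
  fix d
  let ?p = "fst z" and ?e = "frame_at P z"
  have p: "?p \<in> points M" by (rule fst_points[OF z])
  show "tension P M fst z d = (1/2) *\<^sub>R grad M (\<lambda>q. ln (\<alpha> q)) ?p d"
  proof (cases "d \<in> charts_at M ?p")
    case False
    obtain c where c: "c \<in> charts_at M ?p" by (rule chart_of_points[OF p])
    have "grad M (\<lambda>q. ln (\<alpha> q)) ?p \<in> tangent_space M ?p"
      by (rule grad_chart(1)[OF c smooth_function_differentiable[OF smooth_ln_\<alpha> c]])
    from tangent_outside[OF this False] show ?thesis
      using False by (simp add: tension_def Let_def pullback_cov_def differential_def)
  next
    case d: True
    have da: "d \<in> atlas M" by (rule charts_atD(1)[OF d])
    let ?g = "metric_matrix M d" and ?x = "cmap d ?p"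
    let ?D = "induced_chart M d"
    let ?w = "cmap ?D z" and ?G = "metric_matrix P ?D"
    have D: "?D \<in> charts_at P z" by (rule induced_charts_at_P[OF z d])
    interpret m: coord_mus_matrix "img d" ?g "\<lambda>x. f (cinv d x)" ?G by (rule coord_mus_matrix_chart[OF da])
    obtain W where W: "open W" "?w \<in> W" "W \<subseteq> m.total"
      and et: "\<And>w i. w \<in> W \<Longrightarrow> ?e i (cinv ?D w) \<in> tangent_space T (cinv ?D w)"
      and ez: "\<And>i. ?e i z \<in> tangent_space T z" and cov: "\<And>i. cov P z (?e i z) (?e i) \<in> tangent_space T z"
      and de: "\<And>i. (\<lambda>w. ?e i (cinv ?D w) ?D) differentiable (at ?w)"
      and on: "onb (?G ?w) (\<lambda>i. ?e i z ?D)"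
      by (rule frame_chart[OF z d]) (rule that)
    have q: "cinv ?D w \<in> points T" "d \<in> charts_at M (fst (cinv ?D w))" if "w \<in> W" for w
      using that W(3) induced_point[OF da, of w] by auto
    have zz: "cinv ?D ?w = z" by (rule P.cinv_cmap_at[OF D])
    have summand: "pullback_cov P M fst z (?e i z) (\<lambda>q. differential P M fst q (?e i q)) d
        - differential P M fst z (cov P z (?e i z) (?e i)) d
        = chr ?g ?x (base_part (?e i z ?D)) (base_part (?e i z ?D)) - base_part (chr ?G ?w (?e i z ?D) (?e i z ?D))" for i
    proof -
      let ?E = "\<lambda>w. ?e i (cinv ?D w) ?D"
      have e: "differential P M fst (cinv ?D w) (?e i (cinv ?D w)) d = base_part (?E w)" if "w \<in> W" for w
        by (rule differential_chart[OF q(1)[OF that] et[OF that] q(2)[OF that]])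
      have dd: "(\<lambda>w. differential P M fst (cinv ?D w) (?e i (cinv ?D w)) d) differentiable (at ?w)"
        using differentiable_cong_open[OF W(1,2) e] bounded_linear_compose_differentiable[OF bounded_linear_parts(1) de] by simp
      have "dir P z (?e i z) (\<lambda>q. differential P M fst q (?e i q) d)
          = der (\<lambda>w. differential P M fst (cinv ?D w) (?e i (cinv ?D w)) d) ?w (?e i z ?D)"
        by (rule P.dir_chart[OF D _ dd]) (use ez in \<open>simp add: P_simps\<close>)
      also have "\<dots> = base_part (der ?E ?w (?e i z ?D))"
        using der_cong[OF W(1,2) e] der_bounded_linear[OF bounded_linear_parts(1) de] by simp
      finally have 1: "dir P z (?e i z) (\<lambda>q. differential P M fst q (?e i q) d) = base_part (der ?E ?w (?e i z ?D))" .
      have "cov P z (?e i z) (?e i) ?D = cd ?G (?e i z ?D) ?E ?w"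
        by (rule P.cov_chart[OF D, of "?e i z" "?e i", OF _ de]) (use ez in \<open>simp add: P_simps\<close>)
      then have 2: "differential P M fst z (cov P z (?e i z) (?e i)) d
          = base_part (der ?E ?w (?e i z ?D)) + base_part (chr ?G ?w (?e i z ?D) (?e i z ?D))"
        unfolding differential_chart[OF z cov d] by (simp add: cd_def zz)
      show ?thesis
        unfolding 2 pullback_cov_def using d 1 by (simp add: differential_chart[OF z ez d] christoffel_term_chart[OF d])
    qed
    have "tension P M fst z d = (\<Sum>i\<in>UNIV. chr ?g ?x (base_part (?e i z ?D)) (base_part (?e i z ?D))
        - base_part (chr ?G ?w (?e i z ?D) (?e i z ?D)))"
      by (simp add: tension_def Let_def summand)
    also have "\<dots> = (1/2) *\<^sub>R gradc ?g (\<lambda>y. ln (\<alpha> (cinv d y))) ?x"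
      by (rule frame_trace_chart[OF d on])
    also have "gradc ?g (\<lambda>y. ln (\<alpha> (cinv d y))) ?x = grad M (\<lambda>q. ln (\<alpha> q)) ?p d"
      by (rule grad_chart(2)[OF d smooth_function_differentiable[OF smooth_ln_\<alpha> d], symmetric])
    finally show ?thesis .
  qed
qed

text \<open>For the field \<open>V\<close> on the base, the trace of the second covariant derivative of \<open>V \<circ> \<pi>\<close> is the
  trace over \<open>M\<close> plus the derivative of \<open>V\<close> along the tension field, here \<open>V\<close> itself.\<close>

lemma bitension_projection_chart:
  assumes z: "z \<in> points T" and d: "d \<in> charts_at M (fst z)"
  defines "g \<equiv> metric_matrix M d" and "x \<equiv> cmap d (fst z)"
  defines "V \<equiv> \<lambda>y. (1/2) *\<^sub>R gradc g (\<lambda>x. ln (\<alpha> (cinv d x))) y"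
  assumes b: "onb (g x) b"
  shows "bitension P M fst z d
    = - ((\<Sum>i\<in>UNIV. Rm g x (V x) (b i) (b i)) + (\<Sum>i\<in>UNIV. cd2 g V x (b i) (b i)) + cd g (V x) V x)"
proof -
  let ?e = "frame_at P z" and ?D = "induced_chart M d" and ?\<tau> = "tension P M fst"
  let ?w = "cmap ?D z"
  define G where "G = metric_matrix P ?D"
  have da: "d \<in> atlas M" by (rule charts_atD(1)[OF d])
  have D: "?D \<in> charts_at P z" by (rule induced_charts_at_P[OF z d])
  interpret m: coord_mus_matrix "img d" g "\<lambda>x. f (cinv d x)" G
    unfolding g_def G_def by (rule coord_mus_matrix_chart[OF da])
  have x: "x \<in> img d" unfolding x_def by (rule in_img[OF d])
  have w: "?w \<in> m.total" by (rule total_chart[OF d])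
  have bw: "base_part ?w = x" by (simp add: x_def)
  obtain W where W: "open W" "?w \<in> W" "W \<subseteq> m.total"
    and et: "\<And>w i. w \<in> W \<Longrightarrow> ?e i (cinv ?D w) \<in> tangent_space T (cinv ?D w)"
    and ez: "\<And>i. ?e i z \<in> tangent_space T z" and cov: "\<And>i. cov P z (?e i z) (?e i) \<in> tangent_space T z"
    and de: "\<And>i. (\<lambda>w. ?e i (cinv ?D w) ?D) differentiable (at ?w)"
    and "onb (metric_matrix P ?D ?w) (\<lambda>i. ?e i z ?D)"
    by (rule frame_chart[OF z d]) (rule that)
  note on = this(8)[folded G_def]
  have zz: "cinv ?D ?w = z" by (rule P.cinv_cmap_at[OF D])
  have "smooth_on (img d) (\<lambda>x. ln (\<alpha> (cinv d x)))" using smooth_ln_\<alpha> da by (simp add: smooth_function_def)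
  then have sV: "smooth_on (img d) V"
    unfolding V_def by (intro smooth_on_scaleR smooth_on_const m.open_S m.smooth_gradc)
  have dV: "V differentiable (at y)" if "y \<in> img d" for y by (rule smooth_on_differentiable[OF sV that])
  have lin: "linear (\<lambda>\<xi>. cd g \<xi> V y)" if "y \<in> img d" for y by (rule m.cd_linear[OF that dV[OF that]])
  have \<tau>V: "?\<tau> (cinv ?D w) d = V (base_part w)" if "w \<in> m.total" for w
  proof -
    have bp: "base_part w \<in> img d" using that by simp
    show ?thesis
      unfolding tension_projection[OF induced_point(1)[OF da bp]] fst_cinv_induced[OF da bp]
        grad_components[OF smooth_ln_\<alpha> da bp] V_def g_def ..
  qed
  \<comment> \<open>the covariant derivative of the tension field along a vector is that of \<open>V\<close> along its projection\<close>
  have first: "pullback_cov P M fst q v ?\<tau> d = cd g (base_part (v ?D)) V (cmap d (fst q))"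
    if q: "q \<in> points T" and dq: "d \<in> charts_at M (fst q)" and v: "v \<in> tangent_space T q" for q v
  proof -
    have Dq: "?D \<in> charts_at P q" by (rule induced_charts_at_P[OF q dq])
    have wq: "cmap ?D q \<in> m.total" by (rule total_chart[OF dq])
    have Vq: "V differentiable (at (base_part (cmap ?D q)))" using dV in_img[OF dq] by simp
    have dt: "(\<lambda>w. ?\<tau> (cinv ?D w) d) differentiable (at (cmap ?D q))"
      using differentiable_cong_open[OF m.open_total wq \<tau>V] der_base_compose(2)[OF Vq] by simp
    have "dir P q v (\<lambda>q. ?\<tau> q d) = der (\<lambda>w. ?\<tau> (cinv ?D w) d) (cmap ?D q) (v ?D)"
      by (rule P.dir_chart[OF Dq _ dt]) (use v in \<open>simp add: P_simps\<close>)
    also have "\<dots> = der V (cmap d (fst q)) (base_part (v ?D))"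
      using der_cong[OF m.open_total wq \<tau>V] der_base_compose(1)[OF Vq] by simp
    finally show ?thesis
      using \<tau>V[OF wq] P.cinv_cmap_at[OF Dq] dq
      by (simp add: pullback_cov_def cd_def differential_chart[OF q v dq] christoffel_term_chart[OF dq] g_def)
  qed
  have summand: "pullback_cov P M fst z (?e i z) (\<lambda>q. pullback_cov P M fst q (?e i q) ?\<tau>) d
      - pullback_cov P M fst z (cov P z (?e i z) (?e i)) ?\<tau> d
      = cd2 g V x (base_part (?e i z ?D)) (base_part (?e i z ?D))
        + cd g (chr g x (base_part (?e i z ?D)) (base_part (?e i z ?D)) - base_part (chr G ?w (?e i z ?D) (?e i z ?D))) V x" for i
  proof -
    let ?E = "\<lambda>w. ?e i (cinv ?D w) ?D"
    let ?\<xi> = "base_part (?e i z ?D)" and ?\<eta> = "base_part (der ?E ?w (?e i z ?D))"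
    have inner: "pullback_cov P M fst (cinv ?D w) (?e i (cinv ?D w)) ?\<tau> d = cd g (base_part (?E w)) V (base_part w)"
      if "w \<in> W" for w
    proof -
      have bp: "base_part w \<in> img d" using that W(3) by auto
      show ?thesis
        using first[OF induced_point[OF da bp] et[OF that]] fst_cinv_induced[OF da bp] cmap_cinv(1)[OF bp] by simp
    qed
    have linW: "linear (\<lambda>\<xi>. cd g \<xi> V (base_part w))" if "w \<in> W" for w
      using that W(3) by (intro lin) auto
    have dcd: "cd g \<xi> V differentiable (at (base_part ?w))" for \<xi>
      unfolding bw by (rule smooth_on_differentiable[OF m.smooth_cd_const[OF sV] x])
    have dE: "(\<lambda>w. base_part (?E w)) differentiable (at ?w)"
      by (rule bounded_linear_compose_differentiable[OF bounded_linear_parts(1) de])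
    note lf = differentiable_linear_family[where F = "\<lambda>w \<xi>. cd g \<xi> V (base_part w)", OF W(1,2) linW
        der_base_compose(2)[OF dcd] dE]
    have di: "(\<lambda>w. pullback_cov P M fst (cinv ?D w) (?e i (cinv ?D w)) ?\<tau> d) differentiable (at ?w)"
      using differentiable_cong_open[OF W(1,2) inner] lf(1) by simp
    have "dir P z (?e i z) (\<lambda>q. pullback_cov P M fst q (?e i q) ?\<tau> d)
        = der (\<lambda>w. pullback_cov P M fst (cinv ?D w) (?e i (cinv ?D w)) ?\<tau> d) ?w (?e i z ?D)"
      by (rule P.dir_chart[OF D _ di]) (use ez in \<open>simp add: P_simps\<close>)
    also have "\<dots> = der (\<lambda>w. cd g (base_part (?E w)) V (base_part w)) ?w (?e i z ?D)"
      using der_cong[OF W(1,2) inner] by simp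
    also have "\<dots> = der (\<lambda>w. cd g (base_part (?E ?w)) V (base_part w)) ?w (?e i z ?D)
        + cd g (der (\<lambda>w. base_part (?E w)) ?w (?e i z ?D)) V (base_part ?w)"
      by (rule lf(2))
    also have "\<dots> = der (cd g ?\<xi> V) x ?\<xi> + cd g ?\<eta> V x"
      using der_base_compose(1)[OF dcd] der_bounded_linear[OF bounded_linear_parts(1) de] by (simp add: zz x_def)
    finally have 1: "dir P z (?e i z) (\<lambda>q. pullback_cov P M fst q (?e i q) ?\<tau> d) = der (cd g ?\<xi> V) x ?\<xi> + cd g ?\<eta> V x" .
    have 2: "pullback_cov P M fst z (?e i z) (\<lambda>q. pullback_cov P M fst q (?e i q) ?\<tau>) d
        = cd g ?\<xi> (cd g ?\<xi> V) x + cd g ?\<eta> V x"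
      unfolding pullback_cov_def[of P M fst z "?e i z" "\<lambda>q. pullback_cov P M fst q (?e i q) ?\<tau>"]
      unfolding cd_def[of g ?\<xi> "cd g ?\<xi> V" x]
      using d 1 first[OF z d ez, of i]
      by (simp add: differential_chart[OF z ez d] christoffel_term_chart[OF d] g_def x_def)
    have "cov P z (?e i z) (?e i) ?D = cd G (?e i z ?D) ?E ?w"
      unfolding G_def by (rule P.cov_chart[OF D, of "?e i z" "?e i", OF _ de]) (use ez in \<open>simp add: P_simps\<close>)
    then have 3: "pullback_cov P M fst z (cov P z (?e i z) (?e i)) ?\<tau> d
        = cd g ?\<eta> V x + cd g (base_part (chr G ?w (?e i z ?D) (?e i z ?D))) V x"
      unfolding first[OF z d cov] by (simp add: cd_def[of G] zz linear_add[OF lin[OF x]] x_def[symmetric])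
    show ?thesis unfolding 2 3 cd2_def by (simp add: linear_diff[OF lin[OF x]])
  qed
  have t: "grad M (\<lambda>q. ln (\<alpha> q)) (fst z) \<in> tangent_space M (fst z)"
    by (rule grad_chart(1)[OF d smooth_function_differentiable[OF smooth_ln_\<alpha> d]])
  have \<tau>z: "?\<tau> z \<in> tangent_space M (fst z)" "?\<tau> z d = V x"
    using tangent_combination[OF tangent_zero t, of "1/2"] tension_projection[OF z] \<tau>V[OF w] by (simp_all add: zz x_def)
  have curv: "curvature M (fst z) (?\<tau> z) (differential P M fst z (?e i z)) (differential P M fst z (?e i z)) d
      = Rm g x (V x) (base_part (?e i z ?D)) (base_part (?e i z ?D))" for i
    using curvature_chart[OF d \<tau>z(1) differential_tangent[OF z ez] differential_tangent[OF z ez], of i i]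
    unfolding \<tau>z(2) differential_chart[OF z ez d] by (simp add: g_def x_def)
  have bb: "onb (g (base_part ?w)) b" using b by (simp only: bw)
  have "bitension P M fst z d = - (\<Sum>i\<in>UNIV. Rm g x (V x) (base_part (?e i z ?D)) (base_part (?e i z ?D)))
      - ((\<Sum>i\<in>UNIV. cd2 g V x (base_part (?e i z ?D)) (base_part (?e i z ?D)))
        + (\<Sum>i\<in>UNIV. cd g (chr g x (base_part (?e i z ?D)) (base_part (?e i z ?D)) - base_part (chr G ?w (?e i z ?D) (?e i z ?D))) V x))"
    unfolding bitension_def Let_def curv summand sum.distrib ..
  also have "(\<Sum>i\<in>UNIV. Rm g x (V x) (base_part (?e i z ?D)) (base_part (?e i z ?D))) = (\<Sum>i\<in>UNIV. Rm g x (V x) (b i) (b i))"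
    by (rule m.base_trace[OF w bb on m.Rm_bilinear[OF x]])
  also have "(\<Sum>i\<in>UNIV. cd2 g V x (base_part (?e i z ?D)) (base_part (?e i z ?D))) = (\<Sum>i\<in>UNIV. cd2 g V x (b i) (b i))"
    by (rule m.base_trace[OF w bb on m.cd2_bilinear[OF x sV]])
  also have "(\<Sum>i\<in>UNIV. cd g (chr g x (base_part (?e i z ?D)) (base_part (?e i z ?D)) - base_part (chr G ?w (?e i z ?D) (?e i z ?D))) V x)
      = cd g (V x) V x"
    unfolding linear_sum[OF lin[OF x], symmetric]
    using frame_trace_chart[OF d on[unfolded G_def]] by (simp add: V_def g_def x_def G_def)
  finally show ?thesis by simp
qed

text \<open>Outside the charts around the point every term has the default value 0.\<close>

lemma bitension_projection:
  assumes z: "z \<in> points T"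
  shows "bitension P M fst z = (\<lambda>d. - (ricci M (fst z) (grad M (\<lambda>q. ln (\<alpha> q)) (fst z)) d
      + (1/2) *\<^sub>R grad M (laplacian M (\<lambda>q. ln (\<alpha> q))) (fst z) d
      + (1/8) *\<^sub>R grad M (\<lambda>q. (tangent_norm M q (grad M (\<lambda>r. ln (\<alpha> r)) q))\<^sup>2) (fst z) d))"
proof (rule ext)
  fix d
  have onb: "\<exists>b. onb (metric_matrix M c (cmap c (fst z))) b" if c: "c \<in> charts_at M (fst z)" for c
  proof -
    interpret c: coord_metric "img c" "metric_matrix M c" by (rule coord_metric_chart[OF charts_atD(1)[OF c]])
    show ?thesis by (rule onb_exists[OF c.pos[OF in_img[OF c]]])
  qed
  show "bitension P M fst z d = - (ricci M (fst z) (grad M (\<lambda>q. ln (\<alpha> q)) (fst z)) d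
      + (1/2) *\<^sub>R grad M (laplacian M (\<lambda>q. ln (\<alpha> q))) (fst z) d
      + (1/8) *\<^sub>R grad M (\<lambda>q. (tangent_norm M q (grad M (\<lambda>r. ln (\<alpha> r)) q))\<^sup>2) (fst z) d)"
  proof (cases "d \<in> charts_at M (fst z)")
    case d: True
    obtain b where b: "onb (metric_matrix M d (cmap d (fst z))) b" using onb[OF d] by blast
    show ?thesis
      unfolding bitension_projection_chart[OF z d b] ricci_grad_equation_chart(1)[OF d smooth_ln_\<alpha> b] ..
  next
    case d: False
    obtain c where c: "c \<in> charts_at M (fst z)" by (rule chart_of_points[OF fst_points[OF z]])
    obtain b where b: "onb (metric_matrix M c (cmap c (fst z))) b" using onb[OF c] by blast
    note out = ricci_grad_equation_chart(2,3)[OF c smooth_ln_\<alpha> b, THEN tangent_outside, OF d]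
    show ?thesis
      using d out
      by (simp add: bitension_def Let_def pullback_cov_def ricci_def curvature_def curvature_field_def cov_def)
  qed
qed

end

end

theorem theorem4p3:
  fixes M :: "('a, 'n::finite) riem_mfd"
    and f :: "'a \<Rightarrow> real"
    and \<alpha> :: "'a \<Rightarrow> real"
  assumes "riemannian_manifold M"
    and "smooth_function M f"
    and "\<forall>p\<in>points M. f p > 0"
    and "\<forall>p\<in>points M. grad M f p \<noteq> (\<lambda>_. 0)"
    and "\<forall>p\<in>points M. \<alpha> p = 1 + (tangent_norm M p (grad M f p))\<^sup>2"
  shows "biharmonic (mus_gradient_bundle M f) M fst \<longleftrightarrow>
    (\<forall>p\<in>points M.
       (\<lambda>d. ricci M p (grad M (\<lambda>q. ln (\<alpha> q)) p) d
          + (1/2) *\<^sub>R grad M (laplacian M (\<lambda>q. ln (\<alpha> q))) p d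
          + (1/8) *\<^sub>R grad M (\<lambda>q. (tangent_norm M q (grad M (\<lambda>r. ln (\<alpha> r)) q))\<^sup>2) p d)
       = (\<lambda>_. 0))"
proof -
  interpret riem_atlas M by (rule riem_atlas_of_riemannian_manifold[OF assms(1)])
  interpret mus_bundle M f by standard (rule assms(2))
  define R where "R p = (\<lambda>d. ricci M p (grad M (\<lambda>q. ln (\<alpha> q)) p) d
          + (1/2) *\<^sub>R grad M (laplacian M (\<lambda>q. ln (\<alpha> q))) p d
          + (1/8) *\<^sub>R grad M (\<lambda>q. (tangent_norm M q (grad M (\<lambda>r. ln (\<alpha> r)) q))\<^sup>2) p d)" for p
  have "bitension P M fst z = (\<lambda>d. - R (fst z) d)" if "z \<in> points T" for z
    unfolding R_def using assms(5) by (intro bitension_projection that) simp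
  then have bit: "bitension P M fst z = (\<lambda>_. 0) \<longleftrightarrow> R (fst z) = (\<lambda>_. 0)" if "z \<in> points T" for z
    using that by (simp add: fun_eq_iff)
  have "biharmonic P M fst \<longleftrightarrow> (\<forall>z\<in>points T. R (fst z) = (\<lambda>_. 0))"
    using smooth_projection bit by (simp add: biharmonic_def P_simps)
  also have "\<dots> \<longleftrightarrow> (\<forall>p\<in>points M. R p = (\<lambda>_. 0))"
  proof
    assume *: "\<forall>z\<in>points T. R (fst z) = (\<lambda>_. 0)"
    show "\<forall>p\<in>points M. R p = (\<lambda>_. 0)"
    proof
      fix p assume "p \<in> points M"
      then have "(p, \<lambda>_. 0) \<in> points T" using tangent_zero by (simp add: points_tangent_bundle)
      from bspec[OF * this] show "R p = (\<lambda>_. 0)" by simp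
    qed
  qed (use fst_points in blast)
  finally show ?thesis unfolding R_def .
qed

end
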